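(* Let $\rho_1,\rho_2\colon\mathrm{Isom}(\mathbf H^1_{\mathbb C})_o\to\mathrm{Isom}(\mathbf H^\infty_{\mathbb C})_o$ be irreducible representations with $\ell(\rho_1)=\ell(\rho_2)$. Then $\rho_1$ and $\rho_2$ are equivalent (i.e. conjugate by an isometry of $\mathbf H^\infty_{\mathbb C}$) if and only if $\mathrm{Arg}(\rho_1)=\mathrm{Arg}(\rho_2)$.
   Context: Complex hyperbolic spaces: $\mathcal H$ a separable complex Hilbert space with a strongly non-degenerate Hermitian form $B$ (linear in the first variable) of signature $(1,n)$; $\mathbf H^n_{\mathbb C}=\{[v]:B(v,v)>0\}$ with $\cosh d([v],[w])=|B(v,w)|/\sqrt{B(v,v)B(w,w)}$, boundary = isotropic lines, $\mathrm{Isom}(\mathbf H^n_{\mathbb C})_o=PU(B)$; complex hyperbolic subspaces are projectivizations of closed complex subspaces of signature $(1,m')$. For $\mathbf H^1_{\mathbb C}$: $\mathbb C^2$ with $B(z,w)=z_1\bar w_1-z_2\bar w_2$, $\xi_1=(e_1+e_2)/\sqrt2,\ \xi_2=(e_1-e_2)/\sqrt2$; $g(\lambda,b)\in SU(1,1)$ ($\lambda>0,b\in\mathbb R$) has matrix $\begin{pmatrix}\lambda&ib\\0&\lambda^{-1}\end{pmatrix}$ in the basis $(\xi_1,\xi_2)$; same symbol for the induced isometry. Representations are orbitally continuous homomorphisms; non-elementary = no fixed point in $\mathbf H^\infty_{\mathbb C}\cup\partial\mathbf H^\infty_{\mathbb C}$ and no invariant pair of boundary points; irreducible = non-elementary with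 no proper invariant complex hyperbolic subspace. For non-elementary $\rho$: $\rho(g(\lambda,b))$ ($\lambda>0,b\in\mathbb R$) have a unique common fixed point $\eta_1\in\partial\mathbf H^\infty_{\mathbb C}$, and $\eta_2$ is the other endpoint of the common axis of the hyperbolic isometries $\rho(g(\lambda,0))$, $\lambda\ne1$. With isotropic representatives $B(\eta_1,\eta_2)=1$ and $E=\eta_1^\perp\cap\eta_2^\perp$: the lift $T_b\in U(B)$ of $\rho(g(1,b))$ with $T_b\eta_1=\eta_1$ satisfies $T_b\eta_2=K(b)\eta_1+\eta_2+c(b)$, $K(b)\in\mathbb C$, $c(b)\in E$. $\ell(\rho)$ is the $t>0$ with $\inf_xd(\rho(g(\lambda,0))x,x)=t|\ln\lambda|$ for all $\lambda>0$; $\mathrm{Arg}(\rho)$ is the argument of $K(1)$ (independent of choices).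
   Formalization: "Conjugate by an isometry" is taken as conjugate by a holomorphic isometry, an element of Isom(H^∞_C)_o = PU(B); conjugating by an antiholomorphic isometry keeps ℓ but negates Arg, so with all isometries the "only if" direction fails when Arg ≠ 0. *)

theory Defs
  imports "HOL-Analysis.Analysis"
begin

text \<open>Vectors are modelled as functions nat \<Rightarrow> complex.  A "space" is given by a
  carrier set V of such vectors together with a Hermitian form B.\<close>

definition vscale :: "complex \<Rightarrow> (nat \<Rightarrow> complex) \<Rightarrow> (nat \<Rightarrow> complex)" where
  "vscale c v = (\<lambda>n. c * v n)"

definition vadd :: "(nat \<Rightarrow> complex) \<Rightarrow> (nat \<Rightarrow> complex) \<Rightarrow> (nat \<Rightarrow> complex)" where
  "vadd v w = (\<lambda>n. v n + w n)"

definition lineof :: "(nat \<Rightarrow> complex) \<Rightarrow> (nat \<Rightarrow> complex) set" where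
  "lineof v = range (\<lambda>c. vscale c v)"

definition hpts :: "(nat \<Rightarrow> complex) set \<Rightarrow> ((nat \<Rightarrow> complex) \<Rightarrow> (nat \<Rightarrow> complex) \<Rightarrow> complex)
    \<Rightarrow> (nat \<Rightarrow> complex) set set" where
  "hpts V B = {lineof v | v. v \<in> V \<and> Re (B v v) > 0}"

definition bdry :: "(nat \<Rightarrow> complex) set \<Rightarrow> ((nat \<Rightarrow> complex) \<Rightarrow> (nat \<Rightarrow> complex) \<Rightarrow> complex)
    \<Rightarrow> (nat \<Rightarrow> complex) set set" where
  "bdry V B = {lineof v | v. v \<in> V \<and> v \<noteq> (\<lambda>n. 0) \<and> B v v = 0}"

definition hdist :: "((nat \<Rightarrow> complex) \<Rightarrow> (nat \<Rightarrow> complex) \<Rightarrow> complex)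
    \<Rightarrow> (nat \<Rightarrow> complex) set \<Rightarrow> (nat \<Rightarrow> complex) set \<Rightarrow> real" where
  "hdist B p q =
     (let v = (SOME v. v \<in> p \<and> Re (B v v) > 0); w = (SOME w. w \<in> q \<and> Re (B w w) > 0)
      in arcosh (cmod (B v w) / sqrt (Re (B v v) * Re (B w w))))"

definition UB :: "(nat \<Rightarrow> complex) set \<Rightarrow> ((nat \<Rightarrow> complex) \<Rightarrow> (nat \<Rightarrow> complex) \<Rightarrow> complex)
    \<Rightarrow> ((nat \<Rightarrow> complex) \<Rightarrow> (nat \<Rightarrow> complex)) set" where
  "UB V B = {T. bij_betw T V V
       \<and> (\<forall>v\<in>V. \<forall>w\<in>V. \<forall>a b. T (vadd (vscale a v) (vscale b w)) = vadd (vscale a (T v)) (vscale b (T w)))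
       \<and> (\<forall>v\<in>V. \<forall>w\<in>V. B (T v) (T w) = B v w)}"

definition hdom :: "(nat \<Rightarrow> complex) set \<Rightarrow> ((nat \<Rightarrow> complex) \<Rightarrow> (nat \<Rightarrow> complex) \<Rightarrow> complex)
    \<Rightarrow> (nat \<Rightarrow> complex) set set" where
  "hdom V B = hpts V B \<union> bdry V B"

definition ind :: "(nat \<Rightarrow> complex) set \<Rightarrow> ((nat \<Rightarrow> complex) \<Rightarrow> (nat \<Rightarrow> complex) \<Rightarrow> complex)
    \<Rightarrow> ((nat \<Rightarrow> complex) \<Rightarrow> (nat \<Rightarrow> complex)) \<Rightarrow> (nat \<Rightarrow> complex) set \<Rightarrow> (nat \<Rightarrow> complex) set" where
  "ind V B T = restrict (\<lambda>p. T ` p) (hdom V B)"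

text \<open>PU(B) = Isom_o.\<close>
definition PU :: "(nat \<Rightarrow> complex) set \<Rightarrow> ((nat \<Rightarrow> complex) \<Rightarrow> (nat \<Rightarrow> complex) \<Rightarrow> complex)
    \<Rightarrow> ((nat \<Rightarrow> complex) set \<Rightarrow> (nat \<Rightarrow> complex) set) set" where
  "PU V B = ind V B ` UB V B"

definition V1 :: "(nat \<Rightarrow> complex) set" where
  "V1 = {v. \<forall>n\<ge>2. v n = 0}"

definition B1 :: "(nat \<Rightarrow> complex) \<Rightarrow> (nat \<Rightarrow> complex) \<Rightarrow> complex" where
  "B1 v w = v 0 * cnj (w 0) - v 1 * cnj (w 1)"

definition Vinf :: "(nat \<Rightarrow> complex) set" where
  "Vinf = {v. summable (\<lambda>n. (cmod (v n))\<^sup>2)}"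

definition Binf :: "(nat \<Rightarrow> complex) \<Rightarrow> (nat \<Rightarrow> complex) \<Rightarrow> complex" where
  "Binf v w = v 0 * cnj (w 0) - (\<Sum>n. v (Suc n) * cnj (w (Suc n)))"

definition l2norm :: "(nat \<Rightarrow> complex) \<Rightarrow> real" where
  "l2norm v = sqrt (\<Sum>n. (cmod (v n))\<^sup>2)"

abbreviation "G1 \<equiv> PU V1 B1"
abbreviation "Ginf \<equiv> PU Vinf Binf"
abbreviation "D1 \<equiv> hdom V1 B1"
abbreviation "Dinf \<equiv> hdom Vinf Binf"

text \<open>In the basis xi1 = (e1+e2)/sqrt 2, xi2 = (e1-e2)/sqrt 2 the matrix is
  [[\<lambda>, i b],[0, 1/\<lambda>]]; a = (v0+v1)/sqrt 2, c = (v0-v1)/sqrt 2 are the xi-coordinates.\<close>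
definition gmat :: "real \<Rightarrow> real \<Rightarrow> (nat \<Rightarrow> complex) \<Rightarrow> (nat \<Rightarrow> complex)" where
  "gmat lam b v =
     (let a = (v 0 + v 1) / complex_of_real (sqrt 2);
          c = (v 0 - v 1) / complex_of_real (sqrt 2);
          a' = complex_of_real lam * a + \<i> * complex_of_real b * c;
          c' = c / complex_of_real lam
      in (\<lambda>n. if n = 0 then (a' + c') / complex_of_real (sqrt 2)
              else if n = 1 then (a' - c') / complex_of_real (sqrt 2) else 0))"

definition gg :: "real \<Rightarrow> real \<Rightarrow> (nat \<Rightarrow> complex) set \<Rightarrow> (nat \<Rightarrow> complex) set" where
  "gg lam b = ind V1 B1 (gmat lam b)"

type_synonym isom = "(nat \<Rightarrow> complex) set \<Rightarrow> (nat \<Rightarrow> complex) set"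

text \<open>Orbital continuity.  The topology on Isom(H^1_C)_o is that of pointwise
  convergence (= compact-open topology, which is metrizable), so sequential continuity
  of the orbit maps is used.\<close>
definition orb_cont :: "(isom \<Rightarrow> isom) \<Rightarrow> bool" where
  "orb_cont \<rho> \<longleftrightarrow>
     (\<forall>x\<in>hpts Vinf Binf. \<forall>g gs. g \<in> G1 \<and> (\<forall>n. gs n \<in> G1) \<and>
        (\<forall>y\<in>hpts V1 B1. (\<lambda>n. hdist B1 (gs n y) (g y)) \<longlonglongrightarrow> 0)
        \<longrightarrow> (\<lambda>n. hdist Binf (\<rho> (gs n) x) (\<rho> g x)) \<longlonglongrightarrow> 0)"

definition is_rep :: "(isom \<Rightarrow> isom) \<Rightarrow> bool" where
  "is_rep \<rho> \<longleftrightarrow> (\<forall>g\<in>G1. \<rho> g \<in> Ginf)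
     \<and> (\<forall>g\<in>G1. \<forall>h\<in>G1. \<rho> (compose D1 g h) = compose Dinf (\<rho> g) (\<rho> h))
     \<and> orb_cont \<rho>"

definition non_elementary :: "(isom \<Rightarrow> isom) \<Rightarrow> bool" where
  "non_elementary \<rho> \<longleftrightarrow>
     \<not> (\<exists>p\<in>Dinf. \<forall>g\<in>G1. \<rho> g p = p)
     \<and> \<not> (\<exists>\<xi>\<in>bdry Vinf Binf. \<exists>\<eta>\<in>bdry Vinf Binf. \<xi> \<noteq> \<eta> \<and>
            (\<forall>g\<in>G1. \<rho> g ` {\<xi>, \<eta>} = {\<xi>, \<eta>}))"

definition closed_csubspace :: "(nat \<Rightarrow> complex) set \<Rightarrow> bool" where
  "closed_csubspace W \<longleftrightarrow> W \<subseteq> Vinf \<and> (\<lambda>n. 0) \<in> W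
     \<and> (\<forall>v\<in>W. \<forall>w\<in>W. \<forall>a b. vadd (vscale a v) (vscale b w) \<in> W)
     \<and> (\<forall>ws v. (\<forall>n. ws n \<in> W) \<and> v \<in> Vinf \<and>
          (\<lambda>n. l2norm (vadd (ws n) (vscale (-1) v))) \<longlonglongrightarrow> 0 \<longrightarrow> v \<in> W)"

definition sig_1 :: "(nat \<Rightarrow> complex) set \<Rightarrow> bool" where
  "sig_1 W \<longleftrightarrow> (\<exists>v\<in>W. Re (Binf v v) > 0 \<and>
      (\<forall>w\<in>W. Binf w v = 0 \<and> w \<noteq> (\<lambda>n. 0) \<longrightarrow> Re (Binf w w) < 0))"

definition ch_subspace :: "(nat \<Rightarrow> complex) set set \<Rightarrow> bool" where
  "ch_subspace S \<longleftrightarrow> (\<exists>W. closed_csubspace W \<and> sig_1 W \<and>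
      S = {p \<in> hpts Vinf Binf. p \<subseteq> W})"

definition irreducible_rep :: "(isom \<Rightarrow> isom) \<Rightarrow> bool" where
  "irreducible_rep \<rho> \<longleftrightarrow> non_elementary \<rho>
     \<and> \<not> (\<exists>S. ch_subspace S \<and> S \<noteq> hpts Vinf Binf \<and> (\<forall>g\<in>G1. \<rho> g ` S = S))"

definition ell :: "(isom \<Rightarrow> isom) \<Rightarrow> real" where
  "ell \<rho> = (THE t. t > 0 \<and> (\<forall>lam>0.
      (INF x\<in>hpts Vinf Binf. hdist Binf (\<rho> (gg lam 0) x) x) = t * \<bar>ln lam\<bar>))"

definition eta1 :: "(isom \<Rightarrow> isom) \<Rightarrow> (nat \<Rightarrow> complex) set" where
  "eta1 \<rho> = (THE \<eta>. \<eta> \<in> bdry Vinf Binf \<and> (\<forall>lam>0. \<forall>b. \<rho> (gg lam b) \<eta> = \<eta>))"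

text \<open>The other endpoint of the common axis of the hyperbolic isometries
  \<rho>(g(\<lambda>,0)), \<lambda> \<noteq> 1, i.e. their other common boundary fixed point.\<close>
definition eta2 :: "(isom \<Rightarrow> isom) \<Rightarrow> (nat \<Rightarrow> complex) set" where
  "eta2 \<rho> = (THE \<eta>. \<eta> \<in> bdry Vinf Binf \<and> \<eta> \<noteq> eta1 \<rho> \<and> (\<forall>lam>0. \<rho> (gg lam 0) \<eta> = \<eta>))"

definition Kval :: "(isom \<Rightarrow> isom) \<Rightarrow> complex" where
  "Kval \<rho> = (SOME K. \<exists>e1 e2 T c.
      e1 \<in> eta1 \<rho> \<and> e2 \<in> eta2 \<rho> \<and> Binf e1 e2 = 1 \<and>
      T \<in> UB Vinf Binf \<and> ind Vinf Binf T = \<rho> (gg 1 1) \<and> T e1 = e1 \<and>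
      c \<in> Vinf \<and> Binf c e1 = 0 \<and> Binf c e2 = 0 \<and>
      T e2 = vadd (vadd (vscale K e1) e2) c)"

definition Argrho :: "(isom \<Rightarrow> isom) \<Rightarrow> real" where
  "Argrho \<rho> = Arg (Kval \<rho>)"

definition equivalent :: "(isom \<Rightarrow> isom) \<Rightarrow> (isom \<Rightarrow> isom) \<Rightarrow> bool" where
  "equivalent \<rho>1 \<rho>2 \<longleftrightarrow> (\<exists>\<phi>\<in>Ginf. \<forall>g\<in>G1.
      compose Dinf \<phi> (\<rho>1 g) = compose Dinf (\<rho>2 g) \<phi>)"

end

theory Submission
  imports Defs
begin

text \<open>
  Lift \<open>\<rho>\<close> projectively to unitary operators of the form. The orbit of the diagonal matrices is
  unbounded and accumulates at a boundary point fixed by the Borel subgroup; the Weyl element maps it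
  to a second one, and isotropic vectors \<open>e1\<close>, \<open>e2\<close> on the two lines with \<open>B e1 e2 = 1\<close> form a frame.
  Conjugation by \<open>gg l 0\<close> gives \<open>K (l\<^sup>2 b) = l powr (2 * ell \<rho>) * K b\<close>, so \<open>ell \<rho>\<close> and the argument of
  \<open>K 1\<close> determine \<open>K\<close> up to rescaling the frame. By the Bruhat decomposition the boundary circle is
  mapped equivariantly onto the lines of \<open>e1\<close> and of the \<open>T b e2\<close>, whose Gram matrix is given by \<open>K\<close>.
  Irreducibility makes these vectors total, so equal \<open>K\<close> yields a unitary operator matching the two
  boundary circles. As the off-diagonal Gram entries do not vanish, an operator fixing all these lines
  is a scalar; hence the unitary operator intertwines the representations.
\<close>

section \<open>The Hilbert space of square-summable sequences\<close>

text \<open>Two features of infinite dimension shape the proof. Closed balls are not norm compact,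
  so fixed points cannot come from subsequences: bounded orbits are treated by circumcentres,
  unbounded ones by Gromov products, and both times a sequence is shown to be Cauchy by an explicit
  estimate in the chart where the \<open>e0\<close>-coordinate is 1. Moreover a form-preserving
  linear map need not be onto, so the unitary operator is assembled from two isometries in opposite
  directions. Lifts are unique only up to a unit scalar. Identities between them stay projective
  (\<open>peq\<close>) until a vector on which both sides agree makes them exact; for the unipotent
  group the normalisation at \<open>e1\<close> provides it. Orbital continuity enters at the
  identity only. It bounds displacements there, and it makes \<open>K\<close> continuous at 0, which
  forces \<open>cmod (\<alpha> l) > 1\<close> for \<open>l > 1\<close>; Cauchy's functional equation
  then yields a power of \<open>l\<close>. The modulus of \<open>K 1\<close> is no invariant:
  scaling \<open>e1\<close> by \<open>s\<close> and \<open>e2\<close> by \<open>1 / s\<close>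
  divides \<open>K\<close> by \<open>s^2\<close>.\<close>

lemma summable_mult_cnj:
  assumes "v \<in> Vinf" "w \<in> Vinf"
  shows "summable (\<lambda>n. v n * cnj (w n))"
proof (rule summable_comparison_test')
  show "summable (\<lambda>n. (cmod (v n))\<^sup>2 + (cmod (w n))\<^sup>2)"
    using assms by (auto simp: Vinf_def intro: summable_add)
  fix n :: nat
  have "2 * (cmod (v n) * cmod (w n)) \<le> (cmod (v n))\<^sup>2 + (cmod (w n))\<^sup>2"
    using sum_squares_bound[of "cmod (v n)" "cmod (w n)"] by (simp add: mult.assoc)
  moreover have "0 \<le> cmod (v n) * cmod (w n)" by simp
  ultimately show "norm (v n * cnj (w n)) \<le> (cmod (v n))\<^sup>2 + (cmod (w n))\<^sup>2"
    by (simp only: norm_mult complex_mod_cnj)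
qed

lemma Vinf_0: "(\<lambda>n. 0) \<in> Vinf"
  by (simp add: Vinf_def)

lemma Vinf_add:
  assumes "v \<in> Vinf" "w \<in> Vinf"
  shows "(\<lambda>n. v n + w n) \<in> Vinf"
proof -
  have "summable (\<lambda>n. 2 * (cmod (v n))\<^sup>2 + 2 * (cmod (w n))\<^sup>2)"
    using assms by (auto simp: Vinf_def intro!: summable_add summable_mult)
  moreover have "norm ((cmod (v n + w n))\<^sup>2) \<le> 2 * (cmod (v n))\<^sup>2 + 2 * (cmod (w n))\<^sup>2" for n
  proof -
    have "(cmod (v n + w n))\<^sup>2 \<le> (cmod (v n) + cmod (w n))\<^sup>2"
      by (intro power_mono norm_triangle_ineq) auto
    also have "\<dots> \<le> 2 * (cmod (v n))\<^sup>2 + 2 * (cmod (w n))\<^sup>2"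
      using sum_squares_bound[of "cmod (v n)" "cmod (w n)"] by (simp add: power2_sum)
    finally show ?thesis by simp
  qed
  ultimately show ?thesis
    unfolding Vinf_def mem_Collect_eq by (rule summable_comparison_test')
qed

lemma Vinf_scale:
  assumes "v \<in> Vinf"
  shows "(\<lambda>n. c * v n) \<in> Vinf"
  using assms by (auto simp: Vinf_def norm_mult power_mult_distrib intro: summable_mult)

text \<open>A type of its own makes the classes \<open>real_inner\<close> and
  \<open>complete_space\<close> available, so limits, closures and bounded linear maps carry no side
  conditions on membership in \<open>Vinf\<close>.\<close>

typedef ell2 = Vinf morphisms coord mk_ell2
  using Vinf_0 by blast

setup_lifting type_definition_ell2

lemma coord_Vinf [simp]: "coord x \<in> Vinf"
  by (rule coord)

lemma summable_coord_sq: "summable (\<lambda>n. (cmod (coord x n))\<^sup>2)"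
  using coord[of x] by (simp add: Vinf_def)

lemma ell2_eqI: "(\<And>n. coord x n = coord y n) \<Longrightarrow> x = y"
  by (metis coord_inject ext)

text \<open>The classes instantiated for this type know real scalars only; complex scalars act
  through this separate operation.\<close>

lift_definition csc :: "complex \<Rightarrow> ell2 \<Rightarrow> ell2" (infixr "*c" 75) is "\<lambda>c v n. c * v n"
  by (rule Vinf_scale)

instantiation ell2 :: real_vector
begin
lift_definition zero_ell2 :: ell2 is "\<lambda>n. 0" by (rule Vinf_0)
lift_definition plus_ell2 :: "ell2 \<Rightarrow> ell2 \<Rightarrow> ell2" is "\<lambda>v w n. v n + w n" by (rule Vinf_add)
lift_definition uminus_ell2 :: "ell2 \<Rightarrow> ell2" is "\<lambda>v n. - v n"
  by (simp add: Vinf_def)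
lift_definition minus_ell2 :: "ell2 \<Rightarrow> ell2 \<Rightarrow> ell2" is "\<lambda>v w n. v n - w n"
proof -
  fix v w assume "v \<in> Vinf" "w \<in> Vinf"
  then show "(\<lambda>n. v n - w n) \<in> Vinf"
    using Vinf_add[of v "\<lambda>n. - 1 * w n"] Vinf_scale[of w "-1"] by simp
qed
lift_definition scaleR_ell2 :: "real \<Rightarrow> ell2 \<Rightarrow> ell2" is "\<lambda>r v n. of_real r * v n"
  by (rule Vinf_scale)
instance
  by standard (transfer; simp add: fun_eq_iff algebra_simps)+
end

lemma coord_simps [simp]:
  "coord 0 n = 0" "coord (x + y) n = coord x n + coord y n"
  "coord (- x) n = - coord x n" "coord (x - y) n = coord x n - coord y n"
  "coord (c *c x) n = c * coord x n" "coord (r *\<^sub>R x) n = of_real r * coord x n"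
  by (transfer; simp)+

definition cinner :: "ell2 \<Rightarrow> ell2 \<Rightarrow> complex" where
  "cinner x y = (\<Sum>n. coord x n * cnj (coord y n))"

lemma summable_cinner: "summable (\<lambda>n. coord x n * cnj (coord y n))"
  by (rule summable_mult_cnj) auto

lemma cinner_add_left: "cinner (x + y) z = cinner x z + cinner y z"
  by (simp add: cinner_def distrib_right suminf_add summable_cinner)

lemma cinner_csc_left: "cinner (c *c x) z = c * cinner x z"
  by (simp add: cinner_def mult.assoc suminf_mult summable_cinner)

lemma cinner_cnj: "cnj (cinner x y) = cinner y x"
proof -
  have "(\<lambda>n. cnj (coord x n * cnj (coord y n))) sums cnj (cinner x y)"
    unfolding sums_cnj cinner_def using summable_cinner by (rule summable_sums)
  then show ?thesis
    by (simp add: cinner_def sums_iff mult.commute)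
qed

lemma cinner_self: "cinner x x = of_real (\<Sum>n. (cmod (coord x n))\<^sup>2)"
  unfolding cinner_def complex_norm_square[symmetric]
  by (simp add: suminf_of_real[OF summable_coord_sq])

instantiation ell2 :: real_inner
begin
definition inner_ell2 :: "ell2 \<Rightarrow> ell2 \<Rightarrow> real" where "inner_ell2 x y = Re (cinner x y)"
definition norm_ell2 :: "ell2 \<Rightarrow> real" where "norm_ell2 x = sqrt (inner x x)"
definition dist_ell2 :: "ell2 \<Rightarrow> ell2 \<Rightarrow> real" where "dist_ell2 x y = norm (x - y)"
definition sgn_ell2 :: "ell2 \<Rightarrow> ell2" where "sgn_ell2 x = x /\<^sub>R norm x"
definition uniformity_ell2 :: "(ell2 \<times> ell2) filter" where
  "uniformity_ell2 = (INF e\<in>{0<..}. principal {(x, y). dist x y < e})"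
definition open_ell2 :: "ell2 set \<Rightarrow> bool" where
  "open_ell2 U \<longleftrightarrow> (\<forall>x\<in>U. eventually (\<lambda>(x', y). x' = x \<longrightarrow> y \<in> U) uniformity)"
instance
proof
  fix x y z :: ell2 and r :: real
  show "dist x y = norm (x - y)" by (rule dist_ell2_def)
  show "sgn x = x /\<^sub>R norm x" by (rule sgn_ell2_def)
  show "uniformity = (INF e\<in>{0<..}. principal {(x, y). dist (x::ell2) y < e})"
    by (rule uniformity_ell2_def)
  show "open U \<longleftrightarrow> (\<forall>x\<in>U. eventually (\<lambda>(x', y). x' = x \<longrightarrow> y \<in> U) uniformity)" for U :: "ell2 set"
    by (rule open_ell2_def)
  show "inner x y = inner y x"
    using arg_cong[OF cinner_cnj[of x y], of Re] by (simp add: inner_ell2_def)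
  show "inner (x + y) z = inner x z + inner y z"
    by (simp add: inner_ell2_def cinner_add_left)
  have "r *\<^sub>R x = of_real r *c x" by (rule ell2_eqI) simp
  then show "inner (r *\<^sub>R x) y = r * inner x y"
    by (simp add: inner_ell2_def cinner_csc_left)
  show "0 \<le> inner x x"
    by (simp add: inner_ell2_def cinner_self suminf_nonneg summable_coord_sq)
  have "inner x x = 0 \<longleftrightarrow> (\<forall>n. coord x n = 0)"
    by (simp add: inner_ell2_def cinner_self suminf_eq_zero_iff summable_coord_sq)
  also have "\<dots> \<longleftrightarrow> x = 0" by (metis coord_simps(1) ell2_eqI)
  finally show "inner x x = 0 \<longleftrightarrow> x = 0" .
  show "norm x = sqrt (inner x x)" by (rule norm_ell2_def)
qed
end

lemma ell2_norm_sq: "(norm x)\<^sup>2 = (\<Sum>n. (cmod (coord x n))\<^sup>2)"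
  by (simp add: power2_norm_eq_inner inner_ell2_def cinner_self)

lemma ell2_norm: "norm x = l2norm (coord x)"
  by (simp add: l2norm_def ell2_norm_sq[symmetric])

lemma cmod_coord_le: "cmod (coord x n) \<le> norm x"
proof -
  have "(cmod (coord x n))\<^sup>2 \<le> (norm x)\<^sup>2"
    unfolding ell2_norm_sq using sum_le_suminf[OF summable_coord_sq, of "{n}" x] by simp
  then show ?thesis by (rule power2_le_imp_le) simp
qed

lemma norm_csc [simp]: "norm (c *c x) = cmod c * norm x"
proof -
  have "(norm (c *c x))\<^sup>2 = (cmod c * norm x)\<^sup>2"
    by (simp add: ell2_norm_sq norm_mult power_mult_distrib suminf_mult summable_coord_sq)
  then show ?thesis by (rule power2_eq_imp_eq) auto
qed

lemma csc_algebra [simp]: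
  "c *c (d *c x) = (c * d) *c x" "1 *c x = x" "0 *c x = 0" "c *c 0 = (0::ell2)"
  "(- c) *c x = - (c *c x)" "c *c (- x) = - (c *c x)"
  by (rule ell2_eqI; simp)+

lemma csc_distrib:
  "c *c (x + y) = c *c x + c *c y" "(c + d) *c x = c *c x + d *c x"
  "c *c (x - y) = c *c x - c *c y" "(c - d) *c x = c *c x - d *c x"
  by (rule ell2_eqI; simp add: algebra_simps)+

lemma scaleR_csc: "r *\<^sub>R x = of_real r *c x" for x :: ell2
  by (rule ell2_eqI) simp

lemma csc_eq_0_iff [simp]: "c *c x = 0 \<longleftrightarrow> c = 0 \<or> x = 0"
  by (metis norm_csc norm_eq_zero mult_eq_0_iff)

lemma bounded_bilinear_csc: "bounded_bilinear csc"
proof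
  show "\<exists>K. \<forall>c x. norm (c *c x) \<le> norm c * norm x * K"
    by (rule exI[of _ 1]) simp
qed (auto simp: csc_distrib scaleR_csc scaleR_conv_of_real mult.commute)

lemmas tendsto_csc [tendsto_intros] = bounded_bilinear.tendsto[OF bounded_bilinear_csc]

instance ell2 :: complete_space
proof
  fix X :: "nat \<Rightarrow> ell2"
  assume X: "Cauchy X"
  have "Cauchy (\<lambda>k. coord (X k) n)" for n
  proof (rule metric_CauchyI)
    fix e :: real assume "e > 0"
    then obtain M where "\<forall>j\<ge>M. \<forall>k\<ge>M. dist (X j) (X k) < e"
      using X metric_CauchyD by blast
    moreover have "dist (coord (X j) n) (coord (X k) n) \<le> dist (X j) (X k)" for j k
      using cmod_coord_le[of "X j - X k" n] by (simp add: dist_norm)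
    ultimately show "\<exists>M. \<forall>j\<ge>M. \<forall>k\<ge>M. dist (coord (X j) n) (coord (X k) n) < e"
      by (meson le_less_trans)
  qed
  then have "\<exists>l. (\<lambda>k. coord (X k) n) \<longlonglongrightarrow> l" for n
    by (simp add: Cauchy_convergent_iff convergent_def)
  then obtain l where l: "\<And>n. (\<lambda>k. coord (X k) n) \<longlonglongrightarrow> l n" by metis
  \<comment> \<open>The limit in \<open>j\<close> is taken in a finite sum. As the bound does not
    depend on \<open>N\<close>, it yields both square-summability of \<open>l\<close> minus
    \<open>X k\<close> and the norm estimate.\<close>
  have fin: "(\<Sum>n<N. (cmod (l n - coord (X k) n))\<^sup>2) \<le> e\<^sup>2"
    if "\<And>j. j \<ge> M \<Longrightarrow> dist (X j) (X k) < e" for M N k e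
  proof (rule tendsto_upperbound)
    show "(\<lambda>j. \<Sum>n<N. (cmod (coord (X j) n - coord (X k) n))\<^sup>2)
        \<longlonglongrightarrow> (\<Sum>n<N. (cmod (l n - coord (X k) n))\<^sup>2)"
      by (intro tendsto_intros l)
    show "\<forall>\<^sub>F j in sequentially. (\<Sum>n<N. (cmod (coord (X j) n - coord (X k) n))\<^sup>2) \<le> e\<^sup>2"
    proof (rule eventually_sequentiallyI)
      fix j assume "j \<ge> M"
      have "(\<Sum>n<N. (cmod (coord (X j) n - coord (X k) n))\<^sup>2) \<le> (norm (X j - X k))\<^sup>2"
        unfolding ell2_norm_sq
        using sum_le_suminf[OF summable_coord_sq, of "{..<N}" "X j - X k"] by simp
      also have "\<dots> \<le> e\<^sup>2"
        using that[OF \<open>j \<ge> M\<close>] by (intro power_mono) (auto simp: dist_norm)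
      finally show "(\<Sum>n<N. (cmod (coord (X j) n - coord (X k) n))\<^sup>2) \<le> e\<^sup>2" .
    qed
  qed simp
  have mem: "(\<lambda>n. l n - coord (X k) n) \<in> Vinf" if d: "\<And>j. j \<ge> M \<Longrightarrow> dist (X j) (X k) < e" for M k e
    unfolding Vinf_def mem_Collect_eq by (rule summableI_nonneg_bounded[OF _ fin[OF d]]) auto
  obtain M where M: "\<forall>j\<ge>M. \<forall>k\<ge>M. dist (X j) (X k) < 1"
    using X metric_CauchyD[of X 1] by auto
  have "(\<lambda>n. l n - coord (X M) n) \<in> Vinf"
    by (rule mem[of M M 1]) (use M in blast)
  then have "(\<lambda>n. (l n - coord (X M) n) + coord (X M) n) \<in> Vinf"
    by (rule Vinf_add) simp
  then have lV: "l \<in> Vinf" by simp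
  define x where "x = mk_ell2 l"
  have cx: "coord x = l" by (simp add: x_def mk_ell2_inverse lV)
  have "X \<longlonglongrightarrow> x"
  proof (rule metric_LIMSEQ_I)
    fix e :: real assume "e > 0"
    then obtain M where M: "\<forall>j\<ge>M. \<forall>k\<ge>M. dist (X j) (X k) < e/2"
      using X metric_CauchyD[of X "e/2"] by auto
    have "dist (X k) x < e" if "k \<ge> M" for k
    proof -
      have "(norm (x - X k))\<^sup>2 \<le> (e/2)\<^sup>2"
        unfolding ell2_norm_sq
      proof (rule suminf_le_const[OF summable_coord_sq])
        fix N
        have "(\<Sum>n<N. (cmod (l n - coord (X k) n))\<^sup>2) \<le> (e/2)\<^sup>2"
          by (rule fin[of M]) (use M that in blast)
        then show "(\<Sum>n<N. (cmod (coord (x - X k) n))\<^sup>2) \<le> (e/2)\<^sup>2"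
          by (simp add: cx)
      qed
      then have "norm (x - X k) \<le> e/2"
        by (rule power2_le_imp_le) (use \<open>e > 0\<close> in simp)
      then show ?thesis using \<open>e > 0\<close> norm_minus_commute[of x "X k"] unfolding dist_norm by linarith
    qed
    then show "\<exists>M. \<forall>k\<ge>M. dist (X k) x < e" by blast
  qed
  then show "convergent X" by (auto simp: convergent_def)
qed

section \<open>The Hermitian form of signature (1, infinity)\<close>

definition B :: "ell2 \<Rightarrow> ell2 \<Rightarrow> complex" where
  "B x y = Binf (coord x) (coord y)"

lift_definition e0 :: ell2 is "\<lambda>n. if n = 0 then 1 else 0"
proof -
  have "summable (\<lambda>n. (cmod (if n = 0 then 1 else 0))\<^sup>2)"
    by (rule summable_finite[of "{0}"]) auto
  then show "(\<lambda>n::nat. if n = 0 then 1 else 0 :: complex) \<in> Vinf" by (simp add: Vinf_def)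
qed

lemma coord_e0 [simp]: "coord e0 n = (if n = 0 then 1 else 0)"
  by (simp add: e0.rep_eq)

text \<open>The form is a rank-one term minus the inner product, so sesquilinearity and boundedness
  pass from \<open>cinner\<close> to \<open>B\<close>.\<close>

lemma B_cinner: "B x y = 2 * (coord x 0 * cnj (coord y 0)) - cinner x y"
  unfolding B_def Binf_def cinner_def using suminf_split_head[OF summable_cinner, of x y] by simp

lemma B_e0_right: "B x e0 = coord x 0"
  by (simp add: B_def Binf_def)

lemma B_cnj: "cnj (B x y) = B y x"
  by (simp add: B_cinner cinner_cnj mult.commute)

lemma B_add_left: "B (x + y) z = B x z + B y z"
  by (simp add: B_cinner cinner_add_left algebra_simps)

lemma B_csc_left [simp]: "B (c *c x) z = c * B x z"
  by (simp add: B_cinner cinner_csc_left algebra_simps)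

lemma B_csc_right [simp]: "B z (c *c x) = cnj c * B z x"
  by (metis B_cnj B_csc_left complex_cnj_mult)

lemma B_add_right: "B z (x + y) = B z x + B z y"
  by (metis B_cnj B_add_left complex_cnj_add)

lemma B_minus [simp]: "B (- x) y = - B x y" "B x (- y) = - B x y"
  using B_csc_left[of "-1" x y] B_csc_right[of x "-1" y] by simp_all

lemma B_diff_left: "B (x - y) z = B x z - B y z"
  using B_add_left[of x "- y" z] by simp

lemma B_diff_right: "B z (x - y) = B z x - B z y"
  using B_add_right[of z x "- y"] by simp

lemma B_zero [simp]: "B 0 x = 0" "B x 0 = 0"
  using B_csc_left[of 0 0 x] B_csc_right[of x 0 0] by simp_all

lemmas B_simps = B_add_left B_add_right B_diff_left B_diff_right

lemma Im_B_self [simp]: "Im (B x x) = 0"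
  using arg_cong[OF B_cnj[of x x], of Im] by simp

lemma B_self_real: "B x x = of_real (Re (B x x))"
  by (simp add: complex_eq_iff)

lemma cmod_B_commute: "cmod (B x y) = cmod (B y x)"
  by (metis B_cnj complex_mod_cnj)

text \<open>Changing the sign of the form off \<open>e0\<close> gives back the Hilbert norm; this is
  how norm estimates are obtained for maps known only to preserve \<open>B\<close>.\<close>

lemma ell2_norm_B: "(norm x)\<^sup>2 = 2 * (cmod (B x e0))\<^sup>2 - Re (B x x)"
proof -
  have "Re (B x x) = 2 * (cmod (coord x 0))\<^sup>2 - (norm x)\<^sup>2"
    by (simp add: B_cinner ell2_norm_sq cinner_self complex_norm_square[symmetric] flip: of_real_mult)
  then show ?thesis by (simp add: B_e0_right)
qed

lemma B_e0_e0 [simp]: "B e0 e0 = 1"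
  by (simp add: B_e0_right)

text \<open>The factor 2 comes from bounding real and imaginary part separately by the real
  Cauchy-Schwarz inequality; the imaginary part is, up to sign, the real part for
  \<open>\<i> *c x\<close>.\<close>

lemma cinner_bound: "cmod (cinner x y) \<le> 2 * (norm x * norm y)"
proof -
  have 1: "\<bar>Re (cinner x y)\<bar> \<le> norm x * norm y" for x y
    using Cauchy_Schwarz_ineq2[of x y] by (simp add: inner_ell2_def)
  have "\<bar>Im (cinner x y)\<bar> \<le> norm x * norm y"
    using 1[of "\<i> *c x" y] by (simp add: cinner_csc_left)
  then show ?thesis using 1[of x y] cmod_le[of "cinner x y"] by linarith
qed

lemma bounded_bilinear_B: "bounded_bilinear B"
proof
  have "cmod (B x y) \<le> norm x * norm y * 4" for x y
  proof -
    have "cmod (B x y) \<le> cmod (2 * (coord x 0 * cnj (coord y 0))) + cmod (cinner x y)"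
      unfolding B_cinner by (rule norm_triangle_ineq4)
    also have "\<dots> \<le> 2 * (norm x * norm y) + 2 * (norm x * norm y)"
      using cinner_bound[of x y] mult_mono[OF cmod_coord_le[of x 0] cmod_coord_le[of y 0]]
      by (simp add: norm_mult)
    finally show ?thesis by simp
  qed
  then show "\<exists>K. \<forall>x y. norm (B x y) \<le> norm x * norm y * K" by blast
qed (auto simp: B_simps scaleR_csc scaleR_conv_of_real)

lemmas tendsto_B [tendsto_intros] = bounded_bilinear.tendsto[OF bounded_bilinear_B]

lemma B_bound: obtains K where "K > 0" "\<And>x y. cmod (B x y) \<le> K * norm x * norm y"
  using bounded_bilinear.pos_bounded[OF bounded_bilinear_B] by (metis mult.commute mult.left_commute)

lemma B_negative_definite: "B x e0 = 0 \<Longrightarrow> x \<noteq> 0 \<Longrightarrow> Re (B x x) < 0"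
  using ell2_norm_B[of x] zero_less_power[of "norm x" 2] by simp

lemma B_nondegenerate: "(\<And>y. B x y = 0) \<Longrightarrow> x = 0"
  using ell2_norm_B[of x] by simp

text \<open>There is only one positive direction: the combination \<open>z\<close> of
  \<open>v\<close> and \<open>w\<close> without \<open>e0\<close>-coordinate lies in a negative
  definite space, while the hypotheses make \<open>B z z\<close> nonnegative.\<close>

lemma orthogonal_positive_imp_zero:
  assumes "Re (B v v) > 0" "B w v = 0" "Re (B w w) \<ge> 0"
  shows "w = 0"
proof -
  let ?a = "B w e0" and ?b = "B v e0"
  define z where "z = ?a *c v - ?b *c w"
  have "B v w = 0" using assms(2) B_cnj[of w v] by simp
  then have "B z z = ?a * cnj ?a * B v v + ?b * cnj ?b * B w w"
    using assms(2) by (simp add: z_def B_simps)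
  then have Bz: "Re (B z z) = (cmod ?a)\<^sup>2 * Re (B v v) + (cmod ?b)\<^sup>2 * Re (B w w)"
    by (simp add: complex_norm_square[symmetric] flip: of_real_power)
  have "Re (B z z) \<ge> 0" unfolding Bz using assms by simp
  moreover have "B z e0 = 0" by (simp add: z_def B_simps)
  ultimately have "z = 0" using B_negative_definite[of z] by force
  then have "(cmod ?a)\<^sup>2 * Re (B v v) + (cmod ?b)\<^sup>2 * Re (B w w) = 0" using Bz by simp
  moreover have "(cmod ?b)\<^sup>2 * Re (B w w) \<ge> 0" using assms(3) by simp
  ultimately have "(cmod ?a)\<^sup>2 * Re (B v v) \<le> 0" by linarith
  then have a: "?a = 0" using assms(1) by (simp add: mult_le_0_iff)
  have "?b \<noteq> 0"
    using ell2_norm_B[of v] assms(1) zero_le_power2[of "norm v"] by (auto simp del: zero_le_power2)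
  with \<open>z = 0\<close> a show ?thesis by (simp add: z_def)
qed

text \<open>The combination \<open>z\<close> cancelling the \<open>e0\<close>-coordinates is
  isotropic in a negative definite space, hence zero. This is the criterion by which boundary points
  are recognised as fixed.\<close>

lemma isotropic_orthogonal_parallel:
  assumes "B x x = 0" "B y y = 0" "B x y = 0" "y \<noteq> 0"
  shows "\<exists>c. x = c *c y"
proof -
  define z where "z = B y e0 *c x - B x e0 *c y"
  have "B y x = 0" using assms(3) B_cnj[of x y] by simp
  then have "B z z = 0" using assms by (simp add: z_def B_simps)
  moreover have "B z e0 = 0" by (simp add: z_def B_simps)
  ultimately have "z = 0" using B_negative_definite[of z] by force
  moreover have b: "B y e0 \<noteq> 0" using orthogonal_positive_imp_zero[of e0 y] assms by auto
  ultimately have eq: "B y e0 *c x = B x e0 *c y" by (simp add: z_def)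
  have "x = (1 / B y e0) *c (B y e0 *c x)" using b by simp
  also have "\<dots> = (B x e0 / B y e0) *c y" unfolding eq by simp
  finally have "x = (B x e0 / B y e0) *c y" .
  then show ?thesis by blast
qed

text \<open>The component \<open>z\<close> of \<open>w\<close> orthogonal to the positive vector
  \<open>v\<close> has nonpositive square, and equality means that this component vanishes.\<close>

lemma reverse_CS:
  assumes "Re (B v v) > 0"
  shows "Re (B v v) * Re (B w w) \<le> (cmod (B w v))\<^sup>2"
    and "Re (B v v) * Re (B w w) = (cmod (B w v))\<^sup>2 \<Longrightarrow> w = (B w v / B v v) *c v"
proof -
  define c where "c = B w v / B v v"
  define z where "z = w - c *c v"
  have nz: "B v v \<noteq> 0" using assms by auto
  then have zv: "B z v = 0" by (simp add: z_def B_simps c_def)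
  then have "B v z = 0" using B_cnj[of z v] by simp
  have "B z z = B w z" using \<open>B v z = 0\<close> by (subst z_def) (simp add: B_simps)
  also have "\<dots> = B w w - cnj c * B w v" by (simp add: z_def B_simps)
  also have "cnj c * B w v = of_real ((cmod (B w v))\<^sup>2 / Re (B v v))"
    unfolding of_real_divide complex_norm_square B_self_real[of v, symmetric]
    by (simp add: c_def B_cnj mult.commute)
  finally have zz: "Re (B z z) = Re (B w w) - (cmod (B w v))\<^sup>2 / Re (B v v)" by simp
  have le: "Re (B z z) \<le> 0" using orthogonal_positive_imp_zero[OF assms zv] by force
  then show "Re (B v v) * Re (B w w) \<le> (cmod (B w v))\<^sup>2"
    using zz assms by (simp add: field_simps)
  assume "Re (B v v) * Re (B w w) = (cmod (B w v))\<^sup>2"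
  then have "Re (B z z) = 0" using zz assms by (simp add: field_simps)
  then have "z = 0" using orthogonal_positive_imp_zero[OF assms zv] by simp
  then show "w = (B w v / B v v) *c v" by (simp add: z_def c_def)
qed

lemma cmod_B_ge_1:
  assumes "B x x = 1" "B y y = 1"
  shows "1 \<le> cmod (B x y)"
proof -
  have "1\<^sup>2 \<le> (cmod (B x y))\<^sup>2" using reverse_CS(1)[of y x] assms by simp
  then show ?thesis by (rule power2_le_imp_le) simp
qed

text \<open>The bracket is the square of the norm obtained by changing the sign of the form on the
  orthogonal complement of \<open>p\<close>; every positive vector, not only \<open>e0\<close>,
  gives a norm that dominates the original one up to a constant.\<close>

lemma norm_le_adapted_norm:
  assumes "Re (B p p) > 0"
  obtains C where "C > 0" "\<And>x. (norm x)\<^sup>2 \<le> C * (2 * (cmod (B x p))\<^sup>2 / Re (B p p) - Re (B x x))"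
proof -
  let ?q = "Re (B p p)"
  have nz: "B p p \<noteq> 0" using assms by auto
  \<comment> \<open>\<open>f\<close> represents pairing with \<open>e0\<close> on the orthogonal
    complement of \<open>p\<close>; the Cauchy-Schwarz inequality for the negative form there bounds
    \<open>B z e0\<close>.\<close>
  define f where "f = e0 - (B e0 p / B p p) *c p"
  have fp: "B f p = 0" using nz by (simp add: f_def B_simps)
  have pf: "B p f = 0" using fp B_cnj[of f p] by simp
  let ?F = "- Re (B f f)"
  have F0: "?F \<ge> 0" using orthogonal_positive_imp_zero[OF assms fp] by force
  have CS: "(cmod (B z e0))\<^sup>2 \<le> ?F * (- Re (B z z))" if zp: "B z p = 0" for z
  proof -
    have zf: "B z f = B z e0" using zp by (simp add: f_def B_simps)
    show ?thesis
    proof (cases "f = 0")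
      case True then show ?thesis using zf by simp
    next
      case False
      then have Fpos: "?F > 0" using orthogonal_positive_imp_zero[OF assms fp] by force
      define y where "y = B f f *c z - B z f *c f"
      have "B y p = 0" using zp fp by (simp add: y_def B_simps)
      then have "Re (B y y) \<le> 0" using orthogonal_positive_imp_zero[OF assms] by force
      moreover have "B y f = 0" by (simp add: y_def B_simps)
      then have "B y y = B y (B f f *c z)" by (subst (2) y_def) (simp add: B_simps)
      then have "B y y = cnj (B f f) * (B f f * B z z - B z f * cnj (B z f))"
        by (simp add: y_def B_simps B_cnj)
      then have "Re (B y y) = ?F * (?F * Re (B z z) + (cmod (B z f))\<^sup>2)"
        by (simp add: complex_norm_square[symmetric] flip: of_real_power) (simp add: algebra_simps)
      ultimately have "?F * (?F * Re (B z z) + (cmod (B z f))\<^sup>2) \<le> 0"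
        by linarith
      then have "?F * Re (B z z) + (cmod (B z f))\<^sup>2 \<le> 0"
        unfolding mult_le_0_iff using Fpos by argo
      then show ?thesis by (simp add: zf)
    qed
  qed
  have neg: "Re (B z z) \<le> 0" if "B z p = 0" for z
    using orthogonal_positive_imp_zero[OF assms that] by force
  \<comment> \<open>The two entries dominate the part of \<open>x\<close> orthogonal to
    \<open>p\<close> and the part along \<open>p\<close>, each with the factor 2 from squaring a
    sum.\<close>
  define C where "C = max (2 * (2 * ?F + 1)) (2 * (norm p)\<^sup>2 / ?q) + 1"
  have C0: "C > 0" using F0 by (simp add: C_def max_def)
  moreover have "(norm x)\<^sup>2 \<le> C * (2 * (cmod (B x p))\<^sup>2 / ?q - Re (B x x))" for x
  proof -
    define c where "c = B x p / B p p"
    define z where "z = x - c *c p"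
    have zp: "B z p = 0" using nz by (simp add: z_def B_simps c_def)
    have pz: "B p z = 0" using zp B_cnj[of z p] by simp
    have x: "x = z + c *c p" by (simp add: z_def)
    have "B x x = B z z + c * cnj c * B p p" using zp pz by (simp add: x B_simps)
    then have xx: "Re (B x x) = Re (B z z) + (cmod c)\<^sup>2 * ?q"
      by (simp add: complex_norm_square[symmetric] flip: of_real_power)
    have "B x p = c * B p p" using nz by (simp add: c_def)
    then have xp: "(cmod (B x p))\<^sup>2 = (cmod c)\<^sup>2 * ?q\<^sup>2"
      by (subst (asm) B_self_real) (simp add: norm_mult power_mult_distrib)
    have R: "2 * (cmod (B x p))\<^sup>2 / ?q - Re (B x x) = (cmod c)\<^sup>2 * ?q - Re (B z z)"
      unfolding xp xx using assms by (simp add: power2_eq_square)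
    have "(norm x)\<^sup>2 \<le> (norm z + cmod c * norm p)\<^sup>2"
      unfolding x using norm_triangle_ineq[of z "c *c p"] by (intro power_mono) auto
    also have "\<dots> \<le> 2 * (norm z)\<^sup>2 + 2 * (cmod c * norm p)\<^sup>2"
      using sum_squares_bound[of "norm z" "cmod c * norm p"] by (simp add: power2_sum)
    also have "(norm z)\<^sup>2 \<le> (2 * ?F + 1) * (- Re (B z z))"
      using CS[OF zp] ell2_norm_B[of z] by (simp add: algebra_simps)
    also have "2 * ((2 * ?F + 1) * (- Re (B z z))) \<le> C * (- Re (B z z))"
      unfolding mult.assoc[symmetric] using neg[OF zp] by (intro mult_right_mono) (auto simp: C_def)
    also have "2 * (cmod c * norm p)\<^sup>2 = (2 * (norm p)\<^sup>2 / ?q) * ((cmod c)\<^sup>2 * ?q)"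
      using assms by (simp add: power_mult_distrib)
    also have "\<dots> \<le> C * ((cmod c)\<^sup>2 * ?q)"
      using assms by (intro mult_right_mono) (auto simp: C_def)
    finally show ?thesis unfolding R by (simp add: algebra_simps)
  qed
  ultimately show ?thesis using that by blast
qed

section \<open>Unitary operators of the form\<close>

lemma mult_cnj_cmod:
  "z * cnj z = (of_real (cmod z))\<^sup>2" "cnj z * z = (of_real (cmod z))\<^sup>2"
  using complex_norm_square[of z] by (simp_all add: mult.commute)

text \<open>Injectivity follows from nondegeneracy of the form (\<open>isU_bij\<close>) and
  continuity from preservation of the form (\<open>isU_bounded_linear\<close>).\<close>

definition isU :: "(ell2 \<Rightarrow> ell2) \<Rightarrow> bool" where
  "isU T \<longleftrightarrow> surj T \<and> (\<forall>x y. T (x + y) = T x + T y) \<and> (\<forall>c x. T (c *c x) = c *c T x)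
     \<and> (\<forall>x y. B (T x) (T y) = B x y)"

lemma isU_add: "isU T \<Longrightarrow> T (x + y) = T x + T y"
  and isU_csc: "isU T \<Longrightarrow> T (c *c x) = c *c T x"
  and isU_B: "isU T \<Longrightarrow> B (T x) (T y) = B x y"
  and isU_surj: "isU T \<Longrightarrow> surj T"
  by (simp_all add: isU_def)

lemma isU_zero: "isU T \<Longrightarrow> T 0 = 0"
  using isU_csc[of T 0 0] by simp

lemma isU_diff: "isU T \<Longrightarrow> T (x - y) = T x - T y"
  using isU_add[of T x "(-1) *c y"] isU_csc[of T "-1" y] by simp

lemma isU_eq_0_iff:
  assumes "isU T"
  shows "T x = 0 \<longleftrightarrow> x = 0"
proof
  assume "T x = 0"
  then have "B x y = 0" for y using isU_B[OF assms, of x y] by simp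
  then show "x = 0" by (rule B_nondegenerate)
qed (simp add: isU_zero[OF assms])

lemma isU_bij:
  assumes "isU T"
  shows "bij T"
proof -
  have "inj T"
    by (rule injI) (metis assms isU_diff isU_eq_0_iff eq_iff_diff_eq_0)
  then show ?thesis using isU_surj[OF assms] by (simp add: bij_def)
qed

lemma isU_id: "isU (\<lambda>x. x)"
  by (simp add: isU_def)

lemma isU_comp: "isU S \<Longrightarrow> isU T \<Longrightarrow> isU (\<lambda>x. S (T x))"
  unfolding isU_def using comp_surj[of T S] by (auto simp: comp_def)

lemma isU_unit_scale:
  assumes "isU T" "cmod c = 1"
  shows "isU (\<lambda>x. c *c T x)"
proof -
  have c: "c * cnj c = 1" using assms(2) by (simp add: complex_norm_square[symmetric])
  then have c0: "c \<noteq> 0" by auto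
  have "\<exists>x. y = c *c T x" for y
  proof -
    obtain x where "y = T x" using isU_surj[OF assms(1)] by blast
    then have "y = c *c T ((1/c) *c x)" using c0 by (simp add: isU_csc[OF assms(1)])
    then show ?thesis by blast
  qed
  moreover have "B (c *c T x) (c *c T y) = B x y" for x y
    using c by (simp add: isU_B[OF assms(1)] mult.assoc[symmetric] mult.commute[of "cnj c"])
  ultimately show ?thesis
    using assms(1) by (auto simp: isU_def csc_distrib mult.commute surj_def)
qed

lemma isU_inv:
  assumes "isU T"
  shows "isU (inv T)" and "T (inv T x) = x" and "inv T (T x) = x"
proof -
  show 1: "T (inv T x) = x" for x using isU_bij[OF assms] by (simp add: bij_is_surj surj_f_inv_f)
  show 2: "inv T (T x) = x" for x using isU_bij[OF assms] by (simp add: bij_is_inj)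
  have "inv T (x + y) = inv T x + inv T y" for x y
    by (metis 1 2 isU_add[OF assms])
  moreover have "inv T (c *c x) = c *c inv T x" for c x
    by (metis 1 2 isU_csc[OF assms])
  moreover have "B (inv T x) (inv T y) = B x y" for x y
    by (metis 1 isU_B[OF assms])
  ultimately show "isU (inv T)"
    using 2 unfolding isU_def by (metis surjI)
qed

text \<open>As \<open>B (T x) e0 = B x (inv T e0)\<close>, the identity \<open>ell2_norm_B\<close> bounds \<open>T\<close> by \<open>norm (T e0)\<close>.\<close>

lemma isU_norm_bound:
  obtains K where "K > 0"
    "\<And>T x. isU T \<Longrightarrow> norm (T x) \<le> (2 * K * norm (T e0) + 1) * norm x"
proof -
  obtain K where K: "K > 0" "\<And>x y. cmod (B x y) \<le> K * norm x * norm y" using B_bound by blast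
  have "norm (T x) \<le> (2 * K * norm (T e0) + 1) * norm x" if T: "isU T" for T x
  proof -
    let ?s = "norm (T e0)"
    have ie: "B (T x) e0 = B x (inv T e0)" for x
      using isU_B[OF T, of x "inv T e0"] isU_inv(2)[OF T] by simp
    have "(norm (inv T e0))\<^sup>2 = ?s\<^sup>2"
      unfolding ell2_norm_B[of "inv T e0"] ell2_norm_B[of "T e0"] ie
      using cmod_B_commute[of "inv T e0" e0] isU_B[OF T, of e0 e0] isU_B[OF isU_inv(1)[OF T], of e0 e0]
      by simp
    then have s: "norm (inv T e0) = ?s" by simp
    have "cmod (B x (inv T e0)) \<le> K * norm x * ?s" using K(2)[of x "inv T e0"] s by simp
    then have "(cmod (B x (inv T e0)))\<^sup>2 \<le> (K * norm x * ?s)\<^sup>2" by (intro power_mono) auto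
    moreover have "- Re (B x x) \<le> (norm x)\<^sup>2" using ell2_norm_B[of x] by simp
    ultimately have "(norm (T x))\<^sup>2 \<le> 2 * (K * norm x * ?s)\<^sup>2 + (norm x)\<^sup>2"
      unfolding ell2_norm_B[of "T x"] ie isU_B[OF T] by linarith
    also have "\<dots> \<le> ((2 * K * ?s + 1) * norm x)\<^sup>2"
    proof -
      have "0 \<le> 2 * K\<^sup>2 * ?s\<^sup>2 + 4 * K * ?s" using K(1) by simp
      then have "(2 * K\<^sup>2 * ?s\<^sup>2 + 1) * (norm x)\<^sup>2 \<le> (2 * K * ?s + 1)\<^sup>2 * (norm x)\<^sup>2"
        by (intro mult_right_mono) (auto simp: power2_sum power_mult_distrib)
      moreover have "2 * (K * norm x * ?s)\<^sup>2 + (norm x)\<^sup>2 = (2 * K\<^sup>2 * ?s\<^sup>2 + 1) * (norm x)\<^sup>2"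
        by (simp add: power_mult_distrib algebra_simps)
      ultimately show ?thesis by (simp only: power_mult_distrib)
    qed
    finally show ?thesis
      by (rule power2_le_imp_le) (use K(1) in simp)
  qed
  with K(1) show ?thesis using that by blast
qed

lemma isU_bounded_linear:
  assumes "isU T"
  shows "bounded_linear T"
proof -
  obtain K where "\<And>x. norm (T x) \<le> (2 * K * norm (T e0) + 1) * norm x"
    using isU_norm_bound assms by metis
  then show ?thesis
    using assms by (intro bounded_linear_intro[where K = "2 * K * norm (T e0) + 1"])
      (auto simp: isU_add isU_csc scaleR_csc mult.commute)
qed

lemma isU_tendsto: "isU T \<Longrightarrow> (f \<longlongrightarrow> l) F \<Longrightarrow> ((\<lambda>n. T (f n)) \<longlongrightarrow> T l) F"
  by (rule bounded_linear.tendsto[OF isU_bounded_linear])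

text \<open>Equality in the projective unitary group.\<close>

definition peq :: "(ell2 \<Rightarrow> ell2) \<Rightarrow> (ell2 \<Rightarrow> ell2) \<Rightarrow> bool" where
  "peq S T \<longleftrightarrow> (\<exists>c. cmod c = 1 \<and> (\<forall>x. S x = c *c T x))"

lemma peqE:
  assumes "peq S T"
  obtains c where "cmod c = 1" "c * cnj c = 1" "c \<noteq> 0" "\<And>x. S x = c *c T x"
proof -
  obtain c where c: "cmod c = 1" "\<And>x. S x = c *c T x" using assms by (auto simp: peq_def)
  moreover have "c * cnj c = 1" using c(1) by (simp add: complex_norm_square[symmetric])
  moreover have "c \<noteq> 0" using c(1) by auto
  ultimately show ?thesis using that by blast
qed

lemma peq_refl: "peq T T"
  unfolding peq_def by (intro exI[of _ 1]) simp

lemma peq_sym: "peq S T \<Longrightarrow> peq T S"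
proof (erule peqE)
  fix c assume c: "cmod c = 1" "c \<noteq> 0" "\<And>x. S x = c *c T x"
  then show ?thesis unfolding peq_def by (intro exI[of _ "1/c"]) (simp add: norm_divide)
qed

lemma peq_trans: "peq S T \<Longrightarrow> peq T R \<Longrightarrow> peq S R"
  unfolding peq_def by (metis csc_algebra(1) norm_mult mult_1)

lemma peq_cmod_B: "peq S T \<Longrightarrow> cmod (B (S x) y) = cmod (B (T x) y)"
  by (erule peqE) (simp add: norm_mult)

lemma peq_norm: "peq S T \<Longrightarrow> norm (S x) = norm (T x)"
  by (erule peqE) simp

lemma unit_if_positive_scaled:
  assumes "isU S" "isU T" "Re (B x x) > 0" "S x = c *c T x"
  shows "cmod c = 1"
proof -
  have "(c * cnj c) * B x x = B x x"
    using isU_B[OF assms(1), of x x] isU_B[OF assms(2), of x x] assms(4)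
    by (simp add: mult.assoc[symmetric] mult.commute[of "cnj c"])
  moreover have "B x x \<noteq> 0" using assms(3) by auto
  ultimately have "complex_of_real ((cmod c)\<^sup>2) = 1"
    unfolding complex_norm_square by (metis mult_cancel_right1)
  then have "(cmod c)\<^sup>2 = 1" by (simp only: of_real_eq_1_iff)
  then show ?thesis using norm_ge_zero[of c] unfolding power2_eq_1_iff by linarith
qed

text \<open>For \<open>x\<close> orthogonal to \<open>e0\<close> and small \<open>\<epsilon>\<close> the line of \<open>e0 + \<epsilon> x\<close> is positive; comparing its image
  with that of \<open>e0\<close> shows that the scalar does not depend on the line.\<close>

lemma peq_if_lines_agree:
  assumes S: "isU S" and T: "isU T"
    and lines: "\<And>x. Re (B x x) > 0 \<Longrightarrow> \<exists>c. S x = c *c T x"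
  shows "peq S T"
proof -
  obtain c where c: "S e0 = c *c T e0" using lines[of e0] by auto
  have c1: "cmod c = 1" by (rule unit_if_positive_scaled[OF S T _ c]) simp
  have perp: "S x = c *c T x" if x: "B x e0 = 0" for x
  proof (cases "x = 0")
    case True then show ?thesis by (simp add: isU_zero[OF S] isU_zero[OF T])
  next
    case False
    define q where "q = - Re (B x x)"
    have q: "q > 0" using B_negative_definite[OF x False] by (simp add: q_def)
    define e where "e = 1 / (q + 1)"
    have e: "e > 0" "e\<^sup>2 * q < 1"
    proof -
      show "e > 0" using q by (simp add: e_def)
      have "q < (q + 1)\<^sup>2" using q by (simp add: power2_eq_square algebra_simps add_pos_pos)
      then show "e\<^sup>2 * q < 1" using q by (simp add: e_def power_divide)
    qed
    have x': "B e0 x = 0" using x B_cnj[of x e0] by simp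
    let ?y = "e0 + of_real e *c x"
    have "Re (B ?y ?y) = 1 - e\<^sup>2 * q"
      using x x' by (simp add: B_simps q_def power2_eq_square)
    then obtain d where d: "S ?y = d *c T ?y" using lines[of ?y] e by auto
    then have "c *c T e0 + of_real e *c S x = d *c T e0 + (d * of_real e) *c T x"
      by (simp add: isU_add[OF S] isU_add[OF T] isU_csc[OF S] isU_csc[OF T] c csc_distrib)
    then have eq: "(c - d) *c T e0 = (d * of_real e) *c T x - of_real e *c S x"
      by (simp add: csc_distrib algebra_simps)
    \<comment> \<open>Pairing \<open>eq\<close> with \<open>T e0\<close> annihilates its right-hand
      side and leaves \<open>c - d\<close>.\<close>
    have "B (S x) (T e0) = 0"
    proof -
      have "T e0 = (1/c) *c S e0" using c1 c by auto
      then show ?thesis using isU_B[OF S, of x e0] x by simp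
    qed
    moreover have "B (T x) (T e0) = 0" using isU_B[OF T] x by simp
    moreover have "B (T e0) (T e0) = 1" using isU_B[OF T] by simp
    ultimately have "c - d = 0" using arg_cong[OF eq, of "\<lambda>z. B z (T e0)"] by (simp add: B_simps)
    then have "d = c" by simp
    then have "of_real e *c S x = of_real e *c (c *c T x)"
      using eq by (simp add: mult.commute)
    then have "of_real (1/e) *c (of_real e *c S x)
        = of_real (1/e) *c (of_real e *c (c *c T x))" by (rule arg_cong)
    then show ?thesis using e(1) by simp
  qed
  have "S x = c *c T x" for x
  proof -
    define z where "z = x - B x e0 *c e0"
    have "S z = c *c T z" by (rule perp) (simp add: z_def B_simps)
    moreover have x: "x = z + B x e0 *c e0" by (simp add: z_def)
    have "S x = S z + B x e0 *c S e0" "T x = T z + B x e0 *c T e0"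
      by (subst x, simp only: isU_add[OF S] isU_csc[OF S] isU_add[OF T] isU_csc[OF T])+
    ultimately show ?thesis by (simp add: c csc_distrib mult.commute)
  qed
  with c1 show ?thesis by (auto simp: peq_def)
qed

section \<open>Circumcentres of bounded sets\<close>

lemma Cauchy_if_dist_sq_le:
  fixes u :: "nat \<Rightarrow> 'a::real_normed_vector"
  assumes "\<And>i j. i \<le> j \<Longrightarrow> (norm (u i - u j))\<^sup>2 \<le> \<delta> i" and "\<delta> \<longlonglongrightarrow> (0::real)"
  shows "Cauchy u"
proof (rule metric_CauchyI)
  fix e :: real assume e: "e > 0"
  then have "\<forall>\<^sub>F i in sequentially. \<delta> i < e\<^sup>2"
    using assms(2) by (intro order_tendstoD(2)[of _ 0]) auto
  then obtain M where M: "\<And>i. i \<ge> M \<Longrightarrow> \<delta> i < e\<^sup>2" by (auto simp: eventually_sequentially)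
  have *: "dist (u i) (u j) < e" if "M \<le> i" "i \<le> j" for i j
  proof -
    have "(norm (u i - u j))\<^sup>2 < e\<^sup>2" using assms(1)[OF that(2)] M[OF that(1)] by linarith
    then show ?thesis unfolding dist_norm by (rule power2_less_imp_less) (use e in simp)
  qed
  show "\<exists>M. \<forall>i\<ge>M. \<forall>j\<ge>M. dist (u i) (u j) < e"
    by (intro exI[of _ M]) (metis * dist_commute linear)
qed

text \<open>Normalised to \<open>e0\<close>-coordinate 1, the vectors differ by something orthogonal
  to \<open>e0\<close>, where the squared norm is minus the form. Bounds on \<open>B x y\<close>
  thus become norm estimates in the ball model.\<close>

lemma projective_dist_sq:
  assumes "B x x = 1" "B y y = 1"
  defines "s \<equiv> B x e0" and "t \<equiv> B y e0"
  shows "(norm ((1/s) *c x - (1/t) *c y))\<^sup>2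
    \<le> 2 * cmod (B x y) / (cmod s * cmod t) - 1 / (cmod s)\<^sup>2 - 1 / (cmod t)\<^sup>2"
proof -
  have nz: "s \<noteq> 0" "t \<noteq> 0"
    using orthogonal_positive_imp_zero[of e0 x] orthogonal_positive_imp_zero[of e0 y] assms by auto
  let ?z = "(1/s) *c x - (1/t) *c y"
  define w where "w = B x y / (s * cnj t)"
  have "B ?z e0 = 0" using nz by (simp add: B_simps s_def t_def)
  then have "(norm ?z)\<^sup>2 = - Re (B ?z ?z)" using ell2_norm_B[of ?z] by simp
  also have "B ?z ?z = 1 / (s * cnj s) + 1 / (t * cnj t) - (w + cnj w)"
    using assms(1,2) by (simp add: w_def B_simps B_cnj algebra_simps)
  also have "s * cnj s = of_real ((cmod s)\<^sup>2)"
    by (simp only: complex_norm_square)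
  also have "t * cnj t = of_real ((cmod t)\<^sup>2)"
    by (simp only: complex_norm_square)
  also have "- Re (1 / of_real ((cmod s)\<^sup>2) + 1 / of_real ((cmod t)\<^sup>2) - (w + cnj w))
      = 2 * Re w - 1 / (cmod s)\<^sup>2 - 1 / (cmod t)\<^sup>2"
  proof -
    have "Re (1 / of_real r) = 1 / r" for r
      by (metis Re_complex_of_real of_real_1 of_real_divide)
    then show ?thesis by (simp del: of_real_power)
  qed
  also have "Re w \<le> cmod w" by (rule complex_Re_le_cmod)
  also have "cmod w = cmod (B x y) / (cmod s * cmod t)" by (simp add: w_def norm_divide norm_mult)
  finally show ?thesis by simp
qed

lemma polar_form: "\<exists>t. cmod t = 1 \<and> z = t * of_real (cmod z)"
  using rcis_cmod_Arg[of z] by (intro exI[of _ "cis (Arg z)"]) (simp add: rcis_def mult.commute)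

text \<open>The phase \<open>c\<close> aligns \<open>y\<close> with \<open>x\<close>, so that
  \<open>B v v = 2 + 2 * |B x y|\<close> is as large as possible; \<open>m\<close> spans the
  geodesic midpoint. The inequality plays the role of the CAT(0) inequality.\<close>

lemma normalised_midpoint:
  assumes "B x x = 1" "B y y = 1"
  obtains m where "B m m = 1"
    "\<And>z. cmod (B z m) \<le> (cmod (B z x) + cmod (B z y)) / sqrt (2 + 2 * cmod (B x y))"
proof -
  let ?r = "cmod (B x y)"
  obtain c where c: "cmod c = 1" "B x y = c * of_real ?r" using polar_form by blast
  have cc: "c * cnj c = 1" using c(1) by (simp add: complex_norm_square[symmetric])
  let ?k = "2 + 2 * ?r"
  have k: "?k > 0" by (smt (verit) norm_ge_zero)
  define v where "v = x + c *c y"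
  have yx: "B y x = cnj c * of_real ?r"
    using arg_cong[OF c(2), of cnj] by (simp add: B_cnj)
  have "cnj c * B x y = of_real ?r"
    by (subst c(2)) (simp add: cc mult.assoc[symmetric] mult.commute[of "cnj c"])
  moreover have "c * B y x = of_real ?r"
    by (subst yx) (simp add: cc mult.assoc[symmetric])
  ultimately have "B v v = of_real ?k"
    using cc assms by (simp add: v_def B_simps distrib_left mult.commute[of "cnj c" c])
  then show ?thesis
  proof (intro that[of "of_real (1 / sqrt ?k) *c v"])
    assume v: "B v v = of_real ?k"
    have "1 / sqrt ?k * (1 / sqrt ?k * ?k) = 1" using k by simp
    then show "B (of_real (1 / sqrt ?k) *c v) (of_real (1 / sqrt ?k) *c v) = 1"
      unfolding B_csc_left B_csc_right v complex_cnj_complex_of_real by (metis of_real_1 of_real_mult)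
    fix z
    have "cmod (B z v) \<le> cmod (B z x) + cmod (B z y)"
      using norm_triangle_ineq[of "B z x" "cnj c * B z y"] c(1) by (simp add: v_def B_simps norm_mult)
    then show "cmod (B z (of_real (1 / sqrt ?k) *c v)) \<le> (cmod (B z x) + cmod (B z y)) / sqrt ?k"
      using k by (simp add: norm_mult divide_right_mono norm_divide)
  qed
qed

text \<open>The circumcentre minimises \<open>sup\<^bsub>o\<in>A\<^esub> |B(o,x)|\<close>, the hyperbolic cosine of the circumradius;
  the midpoint inequality makes minimising sequences Cauchy and the minimiser unique.\<close>

lemma circumcentre:
  assumes e0: "e0 \<in> A" and bnd: "\<And>v. v \<in> A \<Longrightarrow> norm v \<le> M"
  obtains x where "B x x = 1"
    "\<And>y. B y y = 1 \<Longrightarrow> (\<And>s. (\<forall>v\<in>A. cmod (B v x) \<le> s) \<Longrightarrow> (\<forall>v\<in>A. cmod (B v y) \<le> s))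
      \<Longrightarrow> \<exists>c. y = c *c x"
proof -
  obtain K where K: "K > 0" "\<And>x y. cmod (B x y) \<le> K * norm x * norm y" using B_bound by blast
  define r where "r x = (SUP v\<in>A. cmod (B v x))" for x
  have bdd: "bdd_above ((\<lambda>v. cmod (B v x)) ` A)" for x
  proof (rule bdd_aboveI2)
    fix v assume "v \<in> A"
    have "cmod (B v x) \<le> K * norm v * norm x" by (rule K)
    also have "\<dots> \<le> K * M * norm x"
      using bnd[OF \<open>v \<in> A\<close>] K(1) by (intro mult_right_mono mult_left_mono) auto
    finally show "cmod (B v x) \<le> K * M * norm x" .
  qed
  have le_r: "v \<in> A \<Longrightarrow> cmod (B v x) \<le> r x" for v x
    unfolding r_def by (rule cSUP_upper[OF _ bdd])
  have r_le: "r x \<le> s" if "\<forall>v\<in>A. cmod (B v x) \<le> s" for x s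
    unfolding r_def using e0 that by (intro cSUP_least) auto
  have r1: "r x \<ge> 1" if "B x x = 1" for x
    using cmod_B_ge_1[OF B_e0_e0 that] le_r[OF e0, of x] by linarith
  define Q where "Q = {x. B x x = 1}"
  define R where "R = (INF x\<in>Q. r x)"
  have Q0: "Q \<noteq> {}" unfolding Q_def using B_e0_e0 by blast
  have bddQ: "bdd_below (r ` Q)" by (rule bdd_belowI2[of _ 1]) (auto simp: Q_def r1)
  have R1: "R \<ge> 1" unfolding R_def using Q0 by (intro cINF_greatest) (auto simp: Q_def r1)
  have R_le: "B x x = 1 \<Longrightarrow> R \<le> r x" for x
    unfolding R_def by (rule cINF_lower[OF bddQ]) (simp add: Q_def)
  \<comment> \<open>The midpoint competes for the infimum \<open>R\<close>; solving
    \<open>R \<le> r m\<close> for \<open>|B x y|\<close> shows that two vectors with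
    \<open>r\<close> near \<open>R\<close> are close to each other.\<close>
  have mid: "cmod (B x y) \<le> (r x + r y)\<^sup>2 / (2 * R\<^sup>2) - 1" if xy: "B x x = 1" "B y y = 1" for x y
  proof -
    obtain m where m: "B m m = 1"
      "\<And>z. cmod (B z m) \<le> (cmod (B z x) + cmod (B z y)) / sqrt (2 + 2 * cmod (B x y))"
      using normalised_midpoint[OF xy] by blast
    let ?k = "2 + 2 * cmod (B x y)"
    have k: "?k > 0" by (smt (verit) norm_ge_zero)
    have "r m \<le> (r x + r y) / sqrt ?k"
    proof (intro r_le ballI)
      fix v assume "v \<in> A"
      then show "cmod (B v m) \<le> (r x + r y) / sqrt ?k"
        using m(2)[of v] le_r[of v x] le_r[of v y] k
        by (meson add_mono divide_right_mono order_trans real_sqrt_ge_zero less_imp_le)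
    qed
    then have "R \<le> (r x + r y) / sqrt ?k" using R_le[OF m(1)] by linarith
    then have "R * sqrt ?k \<le> r x + r y" using k by (simp add: pos_le_divide_eq)
    then have "(R * sqrt ?k)\<^sup>2 \<le> (r x + r y)\<^sup>2" using R1 k by (intro power_mono) auto
    then have "R\<^sup>2 * ?k \<le> (r x + r y)\<^sup>2" using k by (simp add: power_mult_distrib)
    then have "R\<^sup>2 * 2 * (1 + cmod (B x y)) \<le> (r x + r y)\<^sup>2" by (simp add: algebra_simps)
    then show ?thesis using R1 by (simp add: field_simps)
  qed
  have "\<exists>x. B x x = 1 \<and> r x < R + 1 / real (Suc n)" for n
  proof -
    have "R < R + 1 / real (Suc n)" by simp
    then show ?thesis using cINF_less_iff[OF Q0 bddQ, of "R + 1 / real (Suc n)"]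
      unfolding R_def[symmetric] by (simp add: Q_def)
  qed
  then obtain X where X: "\<And>n. B (X n) (X n) = 1" "\<And>n. r (X n) < R + 1 / real (Suc n)" by metis
  define z where "z n = B (X n) e0" for n
  define u where "u n = (1 / z n) *c X n" for n
  have z1: "cmod (z n) \<ge> 1" for n
    unfolding z_def by (rule cmod_B_ge_1[OF X(1) B_e0_e0])
  have zR: "cmod (z n) \<le> R + 1" for n
  proof -
    have "cmod (z n) \<le> r (X n)" using le_r[OF e0, of "X n"] by (simp add: z_def cmod_B_commute)
    also have "\<dots> \<le> R + 1 / real (Suc n)" using X(2)[of n] by simp
    also have "\<dots> \<le> R + 1" by simp
    finally show ?thesis .
  qed
  \<comment> \<open>\<open>D i - 1\<close> bounds \<open>|B (X i) (X j)|\<close> for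
    \<open>i \<le> j\<close> through \<open>mid\<close>. This bound tends to 1, so
    \<open>\<delta>\<close> tends to 0.\<close>
  define D where "D n = (2 * R + 2 * (1 / real (Suc n)))\<^sup>2 / (2 * R\<^sup>2)" for n
  define \<delta> where "\<delta> n = 2 * (D n - 2)" for n
  have "Cauchy u"
  proof (rule Cauchy_if_dist_sq_le)
    show "\<delta> \<longlonglongrightarrow> 0"
    proof -
      have "\<delta> \<longlonglongrightarrow> 2 * ((2 * R + 2 * 0)\<^sup>2 / (2 * R\<^sup>2) - 2)"
        unfolding \<delta>_def D_def using R1 LIMSEQ_Suc[OF lim_1_over_n]
        by (intro tendsto_intros) (auto simp: lim_1_over_n)
      moreover have "2 * ((2 * R + 2 * 0)\<^sup>2 / (2 * R\<^sup>2) - 2) = 0"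
        using R1 by (simp add: power_mult_distrib)
      ultimately show ?thesis by simp
    qed
    fix i j :: nat assume ij: "i \<le> j"
    let ?a = "1 / cmod (z i)" and ?b = "1 / cmod (z j)"
    have ab: "0 < ?a" "?a \<le> 1" "0 < ?b" "?b \<le> 1"
      using z1[of i] z1[of j] by (auto simp: divide_le_eq_1)
    have "(norm (u i - u j))\<^sup>2 \<le> 2 * cmod (B (X i) (X j)) * (?a * ?b) - ?a\<^sup>2 - ?b\<^sup>2"
      using projective_dist_sq[OF X(1) X(1), of i j] by (simp add: u_def z_def power_divide)
    also have "\<dots> \<le> 2 * (cmod (B (X i) (X j)) - 1) * (?a * ?b)"
      using sum_squares_bound[of ?a ?b] by (simp add: algebra_simps)
    also have "\<dots> \<le> 2 * (cmod (B (X i) (X j)) - 1) * 1"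
    proof (intro mult_left_mono)
      show "0 \<le> 2 * (cmod (B (X i) (X j)) - 1)" using cmod_B_ge_1[OF X(1) X(1), of i j] by simp
      show "?a * ?b \<le> 1" using ab by (intro mult_le_one) auto
    qed
    also have "\<dots> \<le> \<delta> i"
    proof -
      have "1 / real (Suc j) \<le> 1 / real (Suc i)" using ij by (intro divide_left_mono) auto
      then have "r (X i) + r (X j) \<le> 2 * R + 2 * (1 / real (Suc i))"
        using X(2)[of i] X(2)[of j] by linarith
      then have "(r (X i) + r (X j))\<^sup>2 \<le> (2 * R + 2 * (1 / real (Suc i)))\<^sup>2"
        using r1[OF X(1)[of i]] r1[OF X(1)[of j]] by (intro power_mono) auto
      then have "(r (X i) + r (X j))\<^sup>2 / (2 * R\<^sup>2) \<le> D i"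
        unfolding D_def by (intro divide_right_mono) auto
      then have "cmod (B (X i) (X j)) \<le> D i - 1" using mid[OF X(1) X(1), of i j] by linarith
      then show ?thesis by (simp add: \<delta>_def)
    qed
    finally show "(norm (u i - u j))\<^sup>2 \<le> \<delta> i" .
  qed
  then obtain l where l: "u \<longlonglongrightarrow> l" using Cauchy_convergent convergent_def by blast
  define q where "q = Re (B l l)"
  have Buu: "B (u n) (u n) = of_real (1 / (cmod (z n))\<^sup>2)" for n
    using X(1)[of n] by (simp add: u_def mult_cnj_cmod)
  have lq: "(\<lambda>n. 1 / (cmod (z n))\<^sup>2) \<longlonglongrightarrow> q"
    using tendsto_Re[OF tendsto_B[OF l l]] by (simp add: q_def Buu flip: of_real_power)
  \<comment> \<open>Since \<open>|z n|\<close> stays below \<open>R + 1\<close>, the limit does not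
    drift to the boundary but is a positive vector.\<close>
  have "1 / (R + 1)\<^sup>2 \<le> q"
  proof (rule tendsto_lowerbound[OF lq])
    have "1 / (R + 1)\<^sup>2 \<le> 1 / (cmod (z n))\<^sup>2" for n
    proof -
      have "0 < cmod (z n)" using z1[of n] by linarith
      moreover have "(cmod (z n))\<^sup>2 \<le> (R + 1)\<^sup>2" using zR[of n] by (intro power_mono) auto
      ultimately show ?thesis using R1 by (intro divide_left_mono mult_pos_pos zero_less_power) auto
    qed
    then show "\<forall>\<^sub>F n in sequentially. 1 / (R + 1)\<^sup>2 \<le> 1 / (cmod (z n))\<^sup>2" by simp
  qed simp
  moreover have "0 < 1 / (R + 1)\<^sup>2" using R1 by simp
  ultimately have q: "q > 0" by linarith
  define x where "x = of_real (1 / sqrt q) *c l"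
  have Bll: "B l l = of_real q" by (simp add: q_def B_self_real[symmetric])
  have "1 / sqrt q * (1 / sqrt q * q) = 1" using q by simp
  then have Bx: "B x x = 1"
    unfolding x_def B_csc_left B_csc_right Bll complex_cnj_complex_of_real by (metis of_real_1 of_real_mult)
  have "cmod (B v l) \<le> R * sqrt q" if v: "v \<in> A" for v
  proof (rule LIMSEQ_le)
    show "(\<lambda>n. cmod (B v (u n))) \<longlonglongrightarrow> cmod (B v l)" by (intro tendsto_intros l)
    show "(\<lambda>n. (R + 1 / real (Suc n)) * sqrt (1 / (cmod (z n))\<^sup>2)) \<longlonglongrightarrow> R * sqrt q"
      using tendsto_mult[OF tendsto_add[OF tendsto_const[of R] LIMSEQ_Suc[OF lim_1_over_n]] tendsto_real_sqrt[OF lq]]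
      by simp
    have "cmod (B v (u n)) \<le> (R + 1 / real (Suc n)) * sqrt (1 / (cmod (z n))\<^sup>2)" for n
    proof -
      have "cmod (B v (u n)) = cmod (B v (X n)) * (1 / cmod (z n))"
        by (simp add: u_def norm_mult norm_divide)
      also have "\<dots> \<le> (R + 1 / real (Suc n)) * (1 / cmod (z n))"
        using le_r[OF v, of "X n"] X(2)[of n] by (intro mult_right_mono) auto
      finally show ?thesis by (simp add: real_sqrt_divide)
    qed
    then show "\<exists>N. \<forall>n\<ge>N. cmod (B v (u n)) \<le> (R + 1 / real (Suc n)) * sqrt (1 / (cmod (z n))\<^sup>2)" by blast
  qed
  then have "\<forall>v\<in>A. cmod (B v x) \<le> R"
    using q by (auto simp: x_def norm_divide field_simps)
  then have xR: "\<forall>v\<in>A. cmod (B v x) \<le> R" "r x \<le> R" by (auto intro: r_le)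
  show ?thesis
  proof (rule that[OF Bx])
    fix y assume y: "B y y = 1"
      and imp: "\<And>s. (\<forall>v\<in>A. cmod (B v x) \<le> s) \<Longrightarrow> (\<forall>v\<in>A. cmod (B v y) \<le> s)"
    have "r y \<le> R" by (rule r_le) (rule imp[OF xR(1)])
    then have "cmod (B y x) \<le> (2 * R)\<^sup>2 / (2 * R\<^sup>2) - 1"
    proof -
      have "(r y + r x)\<^sup>2 \<le> (2 * R)\<^sup>2" using \<open>r y \<le> R\<close> xR(2) r1[OF y] r1[OF Bx] by (intro power_mono) auto
      then have "(r y + r x)\<^sup>2 / (2 * R\<^sup>2) \<le> (2 * R)\<^sup>2 / (2 * R\<^sup>2)" by (intro divide_right_mono) auto
      then show ?thesis using mid[OF y Bx] by linarith
    qed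
    then have "cmod (B y x) \<le> 1" using R1 by (simp add: power_mult_distrib)
    then have "cmod (B y x) = 1" using cmod_B_ge_1[OF y Bx] by linarith
    then show "\<exists>c. y = c *c x" using reverse_CS(2)[of x y] Bx y by auto
  qed
qed

section \<open>Lines, and the action of unitary operators on them\<close>

lemma vscale_vscale [simp]: "vscale a (vscale b v) = vscale (a * b) v"
  by (simp add: vscale_def mult.assoc)

lemma vscale_1 [simp]: "vscale 1 v = v"
  by (simp add: vscale_def)

lemma lineof_vscale: "c \<noteq> 0 \<Longrightarrow> lineof (vscale c v) = lineof v"
proof -
  assume c: "c \<noteq> 0"
  have "vscale a v = vscale (a / c) (vscale c v)" for a using c by simp
  then have "range (\<lambda>a. vscale a v) \<subseteq> range (\<lambda>a. vscale a (vscale c v))"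
    by (metis image_subsetI rangeI)
  then show ?thesis by (auto simp: lineof_def)
qed

lemma lineof_self: "v \<in> lineof v"
  unfolding lineof_def using vscale_1 by (metis rangeI)

text \<open>Treats \<open>V1\<close> with \<open>B1\<close> and \<open>Vinf\<close> with
  \<open>Binf\<close> at once; for the action on lines homogeneity of the form suffices.\<close>

locale scaled_carrier =
  fixes V :: "(nat \<Rightarrow> complex) set" and H :: "(nat \<Rightarrow> complex) \<Rightarrow> (nat \<Rightarrow> complex) \<Rightarrow> complex"
  assumes zero_mem: "(\<lambda>n. 0) \<in> V"
    and scale_mem: "v \<in> V \<Longrightarrow> vscale c v \<in> V"
    and H_scale: "v \<in> V \<Longrightarrow> w \<in> V \<Longrightarrow> H (vscale a v) (vscale b w) = a * cnj b * H v w"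
    and H_self_real: "v \<in> V \<Longrightarrow> Im (H v v) = 0"
begin

lemma UB_scale: 
  assumes "T \<in> UB V H" "v \<in> V"
  shows "T (vscale c v) = vscale c (T v)"
proof -
  have "T (vadd (vscale c v) (vscale 0 v)) = vadd (vscale c (T v)) (vscale 0 (T v))"
    using assms by (simp add: UB_def)
  then show ?thesis by (simp add: vadd_def vscale_def)
qed

lemma UB_mem: "T \<in> UB V H \<Longrightarrow> v \<in> V \<Longrightarrow> T v \<in> V"
  by (auto simp: UB_def bij_betw_def)

lemma UB_lineof:
  assumes "T \<in> UB V H" "v \<in> V"
  shows "T ` lineof v = lineof (T v)"
  using UB_scale[OF assms] by (auto simp: lineof_def image_iff)

lemma hdom_iff: "p \<in> hdom V H \<longleftrightarrow> (\<exists>v\<in>V. p = lineof v \<and> v \<noteq> (\<lambda>n. 0) \<and> Re (H v v) \<ge> 0)"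
proof -
  have "v \<noteq> (\<lambda>n. 0)" if "v \<in> V" "Re (H v v) > 0" for v
    using H_scale[of v v 0 0] that by (auto simp: vscale_def)
  moreover have "H v v = 0" if "v \<in> V" "Re (H v v) = 0" for v
    using H_self_real[OF that(1)] that(2) by (simp add: complex_eq_iff)
  ultimately show ?thesis
    unfolding hdom_def hpts_def bdry_def by (fastforce simp: order_le_less)
qed

lemma UB_zero: "T \<in> UB V H \<Longrightarrow> T (\<lambda>n. 0) = (\<lambda>n. 0)"
  using UB_scale[of T "\<lambda>n. 0" 0] zero_mem by (simp add: vscale_def)

lemma UB_nonzero:
  assumes "T \<in> UB V H" "v \<in> V" "v \<noteq> (\<lambda>n. 0)"
  shows "T v \<noteq> (\<lambda>n. 0)"
proof
  assume "T v = (\<lambda>n. 0)"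
  then have "T v = T (\<lambda>n. 0)" using UB_zero[OF assms(1)] by simp
  moreover have "inj_on T V" using assms(1) by (auto simp: UB_def bij_betw_def)
  ultimately show False using assms(2,3) zero_mem by (auto dest: inj_onD)
qed

lemma UB_hdom:
  assumes T: "T \<in> UB V H" and "p \<in> hdom V H"
  shows "T ` p \<in> hdom V H"
proof -
  obtain v where v: "v \<in> V" "p = lineof v" "v \<noteq> (\<lambda>n. 0)" "Re (H v v) \<ge> 0"
    using assms(2) hdom_iff by blast
  have "H (T v) (T v) = H v v" using T v by (simp add: UB_def)
  then show ?thesis
    unfolding hdom_iff v(2) UB_lineof[OF T v(1)]
    using UB_mem[OF T v(1)] UB_nonzero[OF T v(1,3)] v(4) by (intro bexI[of _ "T v"]) auto
qed

lemma ind_lineof: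
  assumes "T \<in> UB V H" "v \<in> V" "v \<noteq> (\<lambda>n. 0)" "Re (H v v) \<ge> 0"
  shows "ind V H T (lineof v) = lineof (T v)"
proof -
  have "lineof v \<in> hdom V H" using assms hdom_iff by blast
  then show ?thesis using UB_lineof[OF assms(1,2)] by (simp add: ind_def)
qed

lemma UB_comp:
  assumes "T \<in> UB V H" "S \<in> UB V H"
  shows "(\<lambda>v. T (S v)) \<in> UB V H"
proof -
  have "bij_betw (\<lambda>v. T (S v)) V V"
    using assms bij_betw_trans[of S V V T V] by (simp add: UB_def comp_def)
  then show ?thesis using assms UB_mem[OF assms(2)] by (simp add: UB_def)
qed

lemma ind_compose:
  assumes "T \<in> UB V H" "S \<in> UB V H"
  shows "compose (hdom V H) (ind V H T) (ind V H S) = ind V H (\<lambda>v. T (S v))"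
proof
  fix p
  show "compose (hdom V H) (ind V H T) (ind V H S) p = ind V H (\<lambda>v. T (S v)) p"
    using UB_hdom[OF assms(2), of p]
    by (cases "p \<in> hdom V H") (simp_all add: compose_def ind_def image_image)
qed

lemma ind_cong:
  assumes "T \<in> UB V H" "S \<in> UB V H" "\<And>v. v \<in> V \<Longrightarrow> T v = vscale c (S v)" "c \<noteq> 0"
  shows "ind V H T = ind V H S"
proof
  fix p
  show "ind V H T p = ind V H S p"
  proof (cases "p \<in> hdom V H")
    case True
    then obtain v where v: "v \<in> V" "p = lineof v" using hdom_iff by blast
    have "lineof (T v) = lineof (S v)" using assms(3)[OF v(1)] lineof_vscale[OF assms(4)] by simp
    then show ?thesis
      using True v UB_lineof[OF assms(1) v(1)] UB_lineof[OF assms(2) v(1)] by (simp add: ind_def)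
  qed (simp add: ind_def)
qed

text \<open>The representatives chosen inside \<open>hdist\<close> are nonzero multiples of
  \<open>v\<close> and \<open>w\<close>, and the quotient is homogeneous of degree zero in
  each.\<close>

lemma hdist_lineof:
  assumes "v \<in> V" "w \<in> V" "Re (H v v) > 0" "Re (H w w) > 0"
  shows "hdist H (lineof v) (lineof w) = arcosh (cmod (H v w) / sqrt (Re (H v v) * Re (H w w)))"
proof -
  have ex: "\<exists>c. (SOME v'. v' \<in> lineof v \<and> Re (H v' v') > 0) = vscale c v
      \<and> Re (H (vscale c v) (vscale c v)) > 0" if "Re (H v v) > 0" for v
  proof -
    let ?P = "\<lambda>v'. v' \<in> lineof v \<and> Re (H v' v') > 0"
    have "?P (SOME v'. ?P v')" by (rule someI[of ?P v]) (use that lineof_self in auto)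
    then show ?thesis unfolding lineof_def by auto
  qed
  have sq: "Re (H (vscale c v) (vscale c v)) = (cmod c)\<^sup>2 * Re (H v v)" if "v \<in> V" for c v
    using H_scale[OF that that, of c c] by (simp add: mult_cnj_cmod flip: of_real_power)
  obtain a where a: "(SOME v'. v' \<in> lineof v \<and> Re (H v' v') > 0) = vscale a v"
      "Re (H (vscale a v) (vscale a v)) > 0" using ex[OF assms(3)] by blast
  obtain b where b: "(SOME w'. w' \<in> lineof w \<and> Re (H w' w') > 0) = vscale b w"
      "Re (H (vscale b w) (vscale b w)) > 0" using ex[OF assms(4)] by blast
  have ab: "a \<noteq> 0" "b \<noteq> 0"
    using a(2) b(2) sq[OF assms(1), of a] sq[OF assms(2), of b] by auto
  have "sqrt (((cmod a)\<^sup>2 * Re (H v v)) * ((cmod b)\<^sup>2 * Re (H w w)))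
      = cmod a * cmod b * sqrt (Re (H v v) * Re (H w w))"
    by (simp add: real_sqrt_mult)
  then show ?thesis
    unfolding hdist_def a(1) b(1) Let_def sq[OF assms(1)] sq[OF assms(2)]
    using ab H_scale[OF assms(1,2), of a b] by (simp add: norm_mult)
qed

end

definition cline :: "ell2 \<Rightarrow> (nat \<Rightarrow> complex) set" where
  "cline x = lineof (coord x)"

lemma coord_csc: "coord (c *c x) = vscale c (coord x)"
  by (simp add: vscale_def fun_eq_iff)

lemma coord_mk [simp]: "v \<in> Vinf \<Longrightarrow> coord (mk_ell2 v) = v"
  by (rule mk_ell2_inverse)

lemma mem_cline: "v \<in> cline x \<longleftrightarrow> (\<exists>c. v = coord (c *c x))"
  by (auto simp: cline_def lineof_def coord_csc)

lemma coord_mem_cline: "coord y \<in> cline x \<longleftrightarrow> (\<exists>c. y = c *c x)"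
  by (simp add: mem_cline coord_inject)

lemma cline_eq_iff: "cline x = cline y \<longleftrightarrow> (\<exists>c. c \<noteq> 0 \<and> x = c *c y)"
proof
  assume eq: "cline x = cline y"
  have "coord x \<in> cline x" "coord y \<in> cline y" by (simp_all add: cline_def lineof_self)
  then obtain c d where cd: "x = c *c y" "y = d *c x"
    using eq coord_mem_cline by metis
  show "\<exists>c. c \<noteq> 0 \<and> x = c *c y"
  proof (cases "c = 0")
    case True then show ?thesis using cd by (intro exI[of _ 1]) simp
  qed (use cd in blast)
qed (auto simp: cline_def coord_csc lineof_vscale)

lemma cline_csc: "c \<noteq> 0 \<Longrightarrow> cline (c *c x) = cline x"
  by (auto simp: cline_eq_iff)

interpretation infdim: scaled_carrier Vinf Binf
proof
  fix v w :: "nat \<Rightarrow> complex" and a b c :: complex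
  show "(\<lambda>n. 0) \<in> Vinf" by (rule Vinf_0)
  assume v: "v \<in> Vinf"
  show "vscale c v \<in> Vinf" using Vinf_scale[OF v] by (simp add: vscale_def)
  have "coord (mk_ell2 v) = v" using v by simp
  then show "Im (Binf v v) = 0" using Im_B_self[of "mk_ell2 v"] by (simp add: B_def)
  assume w: "w \<in> Vinf"
  have "B (a *c mk_ell2 v) (b *c mk_ell2 w) = a * cnj b * B (mk_ell2 v) (mk_ell2 w)" by simp
  then show "Binf (vscale a v) (vscale b w) = a * cnj b * Binf v w"
    using v w by (simp add: B_def coord_csc)
qed

lemma coord_eq_zero_iff: "coord x = (\<lambda>n. 0) \<longleftrightarrow> x = 0"
  by (metis coord_inject coord_simps(1) ext)

lemma ex_Vinf: "(\<exists>v. v \<in> Vinf \<and> P v) \<longleftrightarrow> (\<exists>x. P (coord x))"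
  by (metis coord coord_mk)

lemma hpts_iff: "p \<in> hpts Vinf Binf \<longleftrightarrow> (\<exists>x. p = cline x \<and> Re (B x x) > 0)"
  using ex_Vinf[of "\<lambda>v. p = lineof v \<and> Re (Binf v v) > 0"]
  unfolding hpts_def cline_def B_def by blast

lemma bdry_iff: "p \<in> bdry Vinf Binf \<longleftrightarrow> (\<exists>x. p = cline x \<and> x \<noteq> 0 \<and> B x x = 0)"
  using ex_Vinf[of "\<lambda>v. p = lineof v \<and> v \<noteq> (\<lambda>n. 0) \<and> Binf v v = 0"]
  unfolding bdry_def cline_def B_def coord_eq_zero_iff[symmetric] by blast

definition cone :: "ell2 set" where
  "cone = {x. x \<noteq> 0 \<and> Re (B x x) \<ge> 0}"

lemma Dinf_iff: "p \<in> Dinf \<longleftrightarrow> (\<exists>x\<in>cone. p = cline x)"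
  using ex_Vinf[of "\<lambda>v. p = lineof v \<and> v \<noteq> (\<lambda>n. 0) \<and> Re (Binf v v) \<ge> 0"]
  unfolding infdim.hdom_iff cline_def B_def cone_def coord_eq_zero_iff[symmetric] by blast

lemma cone_positive: "Re (B x x) > 0 \<Longrightarrow> x \<in> cone"
  by (auto simp: cone_def)

lemma cone_isotropic: "x \<noteq> 0 \<Longrightarrow> B x x = 0 \<Longrightarrow> x \<in> cone"
  by (simp add: cone_def)

lemma cone_isU: "isU T \<Longrightarrow> x \<in> cone \<Longrightarrow> T x \<in> cone"
  by (simp add: cone_def isU_B isU_eq_0_iff)

section \<open>Passage between operators on sequences and operators on \<open>ell2\<close>\<close>

definition lift :: "((nat \<Rightarrow> complex) \<Rightarrow> (nat \<Rightarrow> complex)) \<Rightarrow> ell2 \<Rightarrow> ell2" where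
  "lift F x = mk_ell2 (F (coord x))"

definition unlift :: "(ell2 \<Rightarrow> ell2) \<Rightarrow> (nat \<Rightarrow> complex) \<Rightarrow> (nat \<Rightarrow> complex)" where
  "unlift T v = coord (T (mk_ell2 v))"

lemma coord_lift: "F \<in> UB Vinf Binf \<Longrightarrow> coord (lift F x) = F (coord x)"
  by (simp add: lift_def infdim.UB_mem)

lemma isU_lift:
  assumes F: "F \<in> UB Vinf Binf"
  shows "isU (lift F)"
proof -
  have lin: "F (vadd (vscale a (coord x)) (vscale b (coord y)))
      = vadd (vscale a (F (coord x))) (vscale b (F (coord y)))" for a b x y
    using F by (simp add: UB_def)
  have "lift F (x + y) = lift F x + lift F y" for x y
  proof -
    have "coord (x + y) = vadd (vscale 1 (coord x)) (vscale 1 (coord y))"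
      by (simp add: vadd_def fun_eq_iff)
    then have "coord (lift F (x + y)) = coord (lift F x + lift F y)"
      using lin[of 1 x 1 y] by (simp add: coord_lift[OF F]) (simp add: vadd_def fun_eq_iff coord_lift[OF F])
    then show ?thesis by (simp only: coord_inject)
  qed
  moreover have "lift F (c *c x) = c *c lift F x" for c x
    by (rule coord_inject[THEN iffD1]) (simp add: coord_lift[OF F] coord_csc infdim.UB_scale[OF F])
  moreover have "B (lift F x) (lift F y) = B x y" for x y
    using F by (simp add: B_def coord_lift[OF F] UB_def)
  moreover have "\<exists>x. y = lift F x" for y
  proof -
    have "coord y \<in> F ` Vinf" using F by (simp add: UB_def bij_betw_def)
    then obtain v where "v \<in> Vinf" "coord y = F v" by blast
    then have "coord y = coord (lift F (mk_ell2 v))" by (simp add: coord_lift[OF F])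
    then show ?thesis by (auto simp: coord_inject)
  qed
  ultimately show ?thesis by (auto simp: isU_def surj_def)
qed

lemma unlift_UB:
  assumes T: "isU T"
  shows "unlift T \<in> UB Vinf Binf"
proof -
  have inj: "inj_on (unlift T) Vinf"
    by (rule inj_onI) (metis unlift_def coord_inject coord_mk T isU_bij bij_is_inj injD)
  have surj: "unlift T ` Vinf = Vinf"
  proof (intro equalityI subsetI)
    fix v assume v: "v \<in> Vinf"
    obtain x where "T x = mk_ell2 v" using isU_surj[OF T] by (metis surjD)
    then have "unlift T (coord x) = v" using v by (simp add: unlift_def coord_inverse)
    then show "v \<in> unlift T ` Vinf" by (metis coord imageI)
  qed (auto simp: unlift_def)
  have lin: "unlift T (vadd (vscale a v) (vscale b w)) = vadd (vscale a (unlift T v)) (vscale b (unlift T w))"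
    if "v \<in> Vinf" "w \<in> Vinf" for v w a b
  proof -
    have "mk_ell2 (vadd (vscale a v) (vscale b w)) = a *c mk_ell2 v + b *c mk_ell2 w"
      by (metis (no_types, lifting) coord_inverse coord_simps(2) coord_csc coord_mk ext that vadd_def)
    then show ?thesis
      by (simp add: unlift_def isU_add[OF T] isU_csc[OF T] vadd_def vscale_def fun_eq_iff)
  qed
  have "Binf (unlift T v) (unlift T w) = Binf v w" if "v \<in> Vinf" "w \<in> Vinf" for v w
    using isU_B[OF T, of "mk_ell2 v" "mk_ell2 w"] that by (simp add: B_def unlift_def)
  with inj surj lin show ?thesis by (simp add: UB_def bij_betw_def)
qed

lemma lift_unlift: "lift (unlift T) = T"
  by (simp add: lift_def unlift_def fun_eq_iff coord_inverse)

lemma ind_cline: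
  assumes "F \<in> UB Vinf Binf" "x \<in> cone"
  shows "ind Vinf Binf F (cline x) = cline (lift F x)"
proof -
  have "Re (Binf (coord x) (coord x)) \<ge> 0" "coord x \<noteq> (\<lambda>n. 0)"
    using assms(2) by (simp_all add: cone_def B_def coord_eq_zero_iff)
  then show ?thesis using infdim.ind_lineof[OF assms(1)]
    by (simp add: cline_def coord_lift[OF assms(1)])
qed

lemma ind_eq_if_peq:
  assumes "F \<in> UB Vinf Binf" "F' \<in> UB Vinf Binf" "peq (lift F) (lift F')"
  shows "ind Vinf Binf F = ind Vinf Binf F'"
proof -
  obtain c where c: "c \<noteq> 0" "\<And>x. lift F x = c *c lift F' x" using peqE[OF assms(3)] by metis
  have "F v = vscale c (F' v)" if "v \<in> Vinf" for v
    using arg_cong[OF c(2)[of "mk_ell2 v"], of coord] that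
    by (simp add: coord_lift assms(1,2) coord_csc)
  then show ?thesis using infdim.ind_cong[OF assms(1,2)] c(1) by blast
qed

lemma hdist_cline:
  assumes "Re (B x x) > 0" "Re (B y y) > 0"
  shows "hdist Binf (cline x) (cline y) = arcosh (cmod (B x y) / sqrt (Re (B x x) * Re (B y y)))"
  using infdim.hdist_lineof[of "coord x" "coord y"] assms by (simp add: cline_def B_def)

text \<open>Keeps the argument of \<open>arcosh\<close> where \<open>cosh\<close> inverts it, so
  that convergence of distances becomes convergence of \<open>|B|\<close>.\<close>

lemma hdist_argument_ge_1:
  assumes "Re (B x x) > 0" "Re (B y y) > 0"
  shows "1 \<le> cmod (B x y) / sqrt (Re (B x x) * Re (B y y))"
proof -
  have "Re (B x x) * Re (B y y) \<le> (cmod (B x y))\<^sup>2"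
    using reverse_CS(1)[OF assms(1), of y] cmod_B_commute[of x y] by simp
  then have "sqrt (Re (B x x) * Re (B y y)) \<le> cmod (B x y)"
    by (metis norm_ge_zero real_le_lsqrt mult_nonneg_nonneg less_imp_le assms real_sqrt_le_iff real_sqrt_abs abs_of_nonneg)
  then show ?thesis using assms by (simp add: pos_le_divide_eq)
qed

section \<open>The isometry group of the complex hyperbolic line\<close>

text \<open>\<open>xvec a c\<close> is \<open>a \<xi>\<^sub>1 + c \<xi>\<^sub>2\<close>.\<close>

definition xvec :: "complex \<Rightarrow> complex \<Rightarrow> nat \<Rightarrow> complex" where
  "xvec a c = (\<lambda>n. if n = 0 then (a + c) / of_real (sqrt 2)
     else if n = 1 then (a - c) / of_real (sqrt 2) else 0)"

lemma sqrt2_sq: "complex_of_real (sqrt 2) * complex_of_real (sqrt 2) = 2"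
  by (metis of_real_mult of_real_numeral real_sqrt_mult_self abs_numeral)

lemma xvec_coords:
  "(xvec a c 0 + xvec a c 1) / of_real (sqrt 2) = a"
  "(xvec a c 0 - xvec a c 1) / of_real (sqrt 2) = c"
  using sqrt2_sq by (simp_all add: xvec_def add_divide_distrib[symmetric] diff_divide_distrib[symmetric])

lemma xvec_V1: "xvec a c \<in> V1"
  by (simp add: V1_def xvec_def)

lemma V1_xvec:
  assumes "v \<in> V1"
  shows "v = xvec ((v 0 + v 1) / of_real (sqrt 2)) ((v 0 - v 1) / of_real (sqrt 2))"
proof
  fix n :: nat
  have "n = 0 \<or> n = 1 \<or> n \<ge> 2" by linarith
  then show "v n = xvec ((v 0 + v 1) / of_real (sqrt 2)) ((v 0 - v 1) / of_real (sqrt 2)) n"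
    using assms sqrt2_sq
    by (auto simp: xvec_def V1_def add_divide_distrib[symmetric] diff_divide_distrib[symmetric])
qed

lemma V1E:
  assumes "v \<in> V1"
  obtains a c where "v = xvec a c"
  using V1_xvec[OF assms] by blast

lemma xvec_lin: "vadd (vscale s (xvec a c)) (vscale t (xvec a' c')) = xvec (s * a + t * a') (s * c + t * c')"
  by (auto simp: vadd_def vscale_def xvec_def fun_eq_iff field_simps)

lemma vscale_xvec: "vscale s (xvec a c) = xvec (s * a) (s * c)"
  by (auto simp: vscale_def xvec_def fun_eq_iff field_simps)

lemma B1_xvec: "B1 (xvec a c) (xvec a' c') = a * cnj c' + c * cnj a'"
proof -
  have "B1 (xvec a c) (xvec a' c') = ((a + c) * cnj (a' + c') - (a - c) * cnj (a' - c'))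
      / (of_real (sqrt 2) * of_real (sqrt 2))"
    by (simp add: B1_def xvec_def diff_divide_distrib[symmetric])
  also have "(a + c) * cnj (a' + c') - (a - c) * cnj (a' - c') = (a * cnj c' + c * cnj a') * 2"
    by (simp add: algebra_simps)
  also have "(a * cnj c' + c * cnj a') * 2 / (of_real (sqrt 2) * of_real (sqrt 2))
      = a * cnj c' + c * cnj a'"
    unfolding sqrt2_sq by simp
  finally show ?thesis .
qed

interpretation dim1: scaled_carrier V1 B1
proof
  fix v w :: "nat \<Rightarrow> complex" and a b c :: complex
  show "(\<lambda>n. 0) \<in> V1" by (simp add: V1_def)
  show "v \<in> V1 \<Longrightarrow> vscale c v \<in> V1" by (simp add: V1_def vscale_def)
  show "B1 (vscale a v) (vscale b w) = a * cnj b * B1 v w"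
    by (simp add: B1_def vscale_def algebra_simps)
  show "Im (B1 v v) = 0" by (simp add: B1_def)
qed

lemma gmat_xvec: "gmat l b (xvec a c) = xvec (of_real l * a + \<i> * of_real b * c) (c / of_real l)"
  unfolding gmat_def Let_def xvec_coords unfolding xvec_def ..

text \<open>The Weyl element, exchanging the two isotropic basis vectors. Its determinant is -1,
  which is allowed since \<open>G1\<close> is induced by all of U(1,1).\<close>

definition wmat :: "(nat \<Rightarrow> complex) \<Rightarrow> (nat \<Rightarrow> complex)" where
  "wmat v = (\<lambda>n. if n = 0 then v 0 else if n = 1 then - v 1 else 0)"

lemma wmat_xvec: "wmat (xvec a c) = xvec c a"
  by (auto simp: wmat_def xvec_def fun_eq_iff diff_divide_distrib add.commute)

lemma UB_vecI:
  assumes lin: "\<And>a c. T (xvec a c) = xvec (a * p + c * q) (a * r + c * s)"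
    and form: "\<And>a c a' c'. B1 (T (xvec a c)) (T (xvec a' c')) = B1 (xvec a c) (xvec a' c')"
    and surj: "\<And>a c. \<exists>a' c'. T (xvec a' c') = xvec a c"
  shows "T \<in> UB V1 B1"
proof -
  have "inj_on T V1"
  proof (rule inj_onI)
    fix v w assume "v \<in> V1" "w \<in> V1" and eq: "T v = T w"
    then obtain a c a' c' where vw: "v = xvec a c" "w = xvec a' c'" by (metis V1E)
    have "B1 (xvec a c) u = B1 (xvec a' c') u" if "u \<in> {xvec 1 0, xvec 0 1}" for u
      using form[of a c] form[of a' c'] eq vw that by auto
    from this[of "xvec 1 0"] this[of "xvec 0 1"] have "a = a' \<and> c = c'" by (simp add: B1_xvec)
    then show "v = w" using vw by simp
  qed
  moreover have "T ` V1 = V1"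
  proof (intro equalityI subsetI)
    fix v assume "v \<in> T ` V1"
    then obtain a c where "v = T (xvec a c)" by (metis V1E imageE)
    then show "v \<in> V1" using lin xvec_V1 by metis
  next
    fix v assume "v \<in> V1"
    then obtain a c where "v = xvec a c" by (metis V1E)
    then show "v \<in> T ` V1" using surj[of a c] xvec_V1 by (metis imageI)
  qed
  moreover have "T (vadd (vscale x v) (vscale y w)) = vadd (vscale x (T v)) (vscale y (T w))"
    if vw: "v \<in> V1" "w \<in> V1" for v w x y
  proof -
    obtain a c a' c' where "v = xvec a c" "w = xvec a' c'" using vw by (metis V1E)
    then show ?thesis by (simp add: xvec_lin lin algebra_simps)
  qed
  moreover have "B1 (T v) (T w) = B1 v w" if "v \<in> V1" "w \<in> V1" for v w
    using form that by (metis V1E)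
  ultimately show ?thesis by (simp add: UB_def bij_betw_def)
qed

lemma gmat_UB: 
  assumes "l > 0"
  shows "gmat l b \<in> UB V1 B1"
proof (rule UB_vecI[of _ "of_real l" "\<i> * of_real b" 0 "1 / of_real l"])
  fix a c a' c'
  show "gmat l b (xvec a c) = xvec (a * of_real l + c * (\<i> * of_real b)) (a * 0 + c * (1 / of_real l))"
    by (simp add: gmat_xvec mult.commute)
  show "B1 (gmat l b (xvec a c)) (gmat l b (xvec a' c')) = B1 (xvec a c) (xvec a' c')"
    using assms by (simp add: gmat_xvec B1_xvec field_simps)
  have "gmat l b (xvec ((a - \<i> * of_real b * (of_real l * c)) / of_real l) (of_real l * c)) = xvec a c"
    using assms by (simp add: gmat_xvec)
  then show "\<exists>a' c'. gmat l b (xvec a' c') = xvec a c" by blast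
qed

lemma wmat_UB: "wmat \<in> UB V1 B1"
  by (rule UB_vecI[of _ 0 1 1 0]) (auto simp: wmat_xvec B1_xvec)

definition gw :: isom where
  "gw = ind V1 B1 wmat"

lemma gg_G1: "l > 0 \<Longrightarrow> gg l b \<in> G1"
  unfolding PU_def gg_def by (rule imageI) (rule gmat_UB)

lemma gw_G1: "gw \<in> G1"
  unfolding PU_def gw_def by (rule imageI) (rule wmat_UB)

lemma G1_compose:
  assumes "g \<in> G1" "h \<in> G1"
  shows "compose D1 g h \<in> G1"
proof -
  obtain S T where "S \<in> UB V1 B1" "T \<in> UB V1 B1" "g = ind V1 B1 S" "h = ind V1 B1 T"
    using assms by (auto simp: PU_def)
  then show ?thesis using dim1.ind_compose dim1.UB_comp by (auto simp: PU_def)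
qed

lemma ind_V1_eqI:
  assumes "S \<in> UB V1 B1" "T \<in> UB V1 B1" "\<And>a c. S (xvec a c) = vscale k (T (xvec a c))" "k \<noteq> 0"
  shows "ind V1 B1 S = ind V1 B1 T"
  by (rule dim1.ind_cong[OF assms(1,2) _ assms(4)]) (metis assms(3) V1E)

section \<open>Relations between the generators of the group\<close>

lemma gg_gg:
  assumes "l > 0" "l' > 0"
  shows "compose D1 (gg l b) (gg l' b') = gg (l * l') (l * b' + b / l')"
proof -
  have ll: "l * l' > 0" using assms by simp
  note U = gmat_UB[OF assms(1)] gmat_UB[OF assms(2)]
  show ?thesis
    unfolding gg_def dim1.ind_compose[OF U]
    by (rule ind_V1_eqI[OF dim1.UB_comp[OF U] gmat_UB[OF ll], where k = 1])
      (use assms in \<open>simp_all add: gmat_xvec algebra_simps\<close>)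
qed

lemma gw_gw: "compose D1 gw gw = gg 1 0"
  unfolding gw_def gg_def dim1.ind_compose[OF wmat_UB wmat_UB]
  by (rule ind_V1_eqI[OF dim1.UB_comp[OF wmat_UB wmat_UB] gmat_UB, where k = 1])
    (simp_all add: gmat_xvec wmat_xvec)

lemma gw_gg:
  assumes "l > 0"
  shows "compose D1 gw (gg l 0) = compose D1 (gg (1 / l) 0) gw"
proof -
  have "1 / l > 0" using assms by simp
  note U = gmat_UB[OF assms] gmat_UB[OF this]
  show ?thesis
    unfolding gw_def gg_def dim1.ind_compose[OF wmat_UB U(1)] dim1.ind_compose[OF U(2) wmat_UB]
    by (rule ind_V1_eqI[OF dim1.UB_comp[OF wmat_UB U(1)] dim1.UB_comp[OF U(2) wmat_UB], where k = 1])
      (simp_all add: gmat_xvec wmat_xvec mult.commute)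
qed

lemma gg_1_0: "g \<in> G1 \<Longrightarrow> compose D1 (gg 1 0) g = g"
proof -
  assume "g \<in> G1"
  then obtain T where T: "T \<in> UB V1 B1" "g = ind V1 B1 T" by (auto simp: PU_def)
  have id: "gmat 1 0 v = v" if "v \<in> V1" for v
    using that by (metis V1E gmat_xvec add_0_right div_by_1 lambda_one mult_zero_left mult_zero_right of_real_0 of_real_1)
  have "gmat 1 0 \<in> UB V1 B1" by (rule gmat_UB) simp
  note 1 = this
  show ?thesis unfolding gg_def T(2) dim1.ind_compose[OF 1 T(1)]
    by (rule dim1.ind_cong[OF dim1.UB_comp[OF 1 T(1)] T(1), where c = 1])
      (simp_all add: id dim1.UB_mem[OF T(1)])
qed

lemma UB_inv_into:
  assumes T: "T \<in> UB V1 B1"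
  shows "inv_into V1 T \<in> UB V1 B1" and "v \<in> V1 \<Longrightarrow> inv_into V1 T (T v) = v"
proof -
  have bij: "bij_betw T V1 V1" using T by (simp add: UB_def)
  then show l: "inv_into V1 T (T v) = v" if "v \<in> V1" for v
    using that by (simp add: bij_betw_inv_into_left)
  have mem: "vadd (vscale a v) (vscale b w) \<in> V1" if "v \<in> V1" "w \<in> V1" for a b v w
    using that by (simp add: V1_def vadd_def vscale_def)
  have "inv_into V1 T (vadd (vscale a v) (vscale b w))
        = vadd (vscale a (inv_into V1 T v)) (vscale b (inv_into V1 T w))
      \<and> B1 (inv_into V1 T v) (inv_into V1 T w) = B1 v w"
    if "v \<in> V1" "w \<in> V1" for a b v w
  proof -
    obtain x y where xy: "x \<in> V1" "v = T x" "y \<in> V1" "w = T y"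
      using \<open>v \<in> V1\<close> \<open>w \<in> V1\<close> bij by (metis bij_betw_imp_surj_on imageE)
    have "vadd (vscale a v) (vscale b w) = T (vadd (vscale a x) (vscale b y))" "B1 v w = B1 x y"
      using T xy by (simp_all add: UB_def)
    then show ?thesis using xy mem by (simp add: l)
  qed
  then show "inv_into V1 T \<in> UB V1 B1" using bij_betw_inv_into[OF bij] by (simp add: UB_def)
qed

lemma G1_inverse:
  assumes "g \<in> G1"
  obtains h where "h \<in> G1" "compose D1 h g = gg 1 0"
proof -
  obtain T where T: "T \<in> UB V1 B1" "g = ind V1 B1 T" using assms by (auto simp: PU_def)
  note inv = UB_inv_into[OF T(1)]
  have 1: "gmat 1 0 \<in> UB V1 B1" by (rule gmat_UB) simp
  have "compose D1 (ind V1 B1 (inv_into V1 T)) g = gg 1 0"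
    unfolding T(2) dim1.ind_compose[OF inv(1) T(1)] gg_def
    by (rule ind_V1_eqI[OF dim1.UB_comp[OF inv(1) T(1)] 1, where k = 1])
      (simp_all add: inv(2)[OF xvec_V1] gmat_xvec)
  then show ?thesis using that inv(1) by (auto simp: PU_def)
qed

section \<open>The Borel subgroup and the Bruhat decomposition\<close>

lemma upper_triangular:
  assumes T: "T \<in> UB V1 B1" and 0: "T (xvec 1 0) = xvec \<alpha> 0"
  obtains l b where "l > 0" "ind V1 B1 T = gg l b"
proof -
  obtain \<gamma> \<delta> where gd: "T (xvec 0 1) = xvec \<gamma> \<delta>" using dim1.UB_mem[OF T xvec_V1] by (metis V1E)
  have B: "B1 (T v) (T w) = B1 v w" if "v \<in> V1" "w \<in> V1" for v w using T that by (simp add: UB_def)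
  have ad: "\<alpha> * cnj \<delta> = 1" using B[OF xvec_V1 xvec_V1, of 1 0 0 1] by (simp add: 0 gd B1_xvec)
  have gdi: "\<gamma> * cnj \<delta> + \<delta> * cnj \<gamma> = 0" using B[OF xvec_V1 xvec_V1, of 0 1 0 1] by (simp add: gd B1_xvec)
  have a0: "\<alpha> \<noteq> 0" using ad by auto
  define l where "l = cmod \<alpha>"
  \<comment> \<open>\<open>k\<close> is the phase of \<open>\<alpha>\<close>. Up to this scalar the
    other entries are determined by \<open>ad\<close> and by \<open>gdi\<close>, which makes
    \<open>\<gamma> / k\<close> purely imaginary.\<close>
  define k where "k = \<alpha> / of_real l"
  have l: "l > 0" using a0 by (simp add: l_def)
  have k1: "cmod k = 1" using a0 by (simp add: k_def l_def norm_divide)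
  then have kk: "k * cnj k = 1" by (simp add: mult_cnj_cmod)
  have k0: "k \<noteq> 0" using k1 by auto
  have \<alpha>: "\<alpha> = k * of_real l" using l by (simp add: k_def)
  have "\<delta> = cnj (1 / \<alpha>)" using ad a0 by (simp add: field_simps) (metis complex_cnj_mult complex_cnj_one complex_cnj_cnj mult.commute)
  also have "\<dots> = k / of_real l"
    using kk k0 l by (simp add: \<alpha> field_simps)
  finally have \<delta>: "\<delta> = k / of_real l" .
  define b where "b = Im (\<gamma> / k)"
  have cnjk: "cnj k = 1 / k" using kk k0 by (simp add: field_simps)
  have "\<gamma> / k + cnj (\<gamma> / k) = of_real l * (\<gamma> * cnj \<delta> + \<delta> * cnj \<gamma>)"
    using l k0 by (simp add: \<delta> cnjk field_simps)
  then have "Re (\<gamma> / k) = 0" unfolding gdi complex_add_cnj by simp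
  then have "\<gamma> / k = \<i> * of_real b" by (simp add: b_def complex_eq_iff)
  then have \<gamma>: "\<gamma> = k * (\<i> * of_real b)" using k0 by (simp add: field_simps)
  have "T (xvec a c) = vscale k (gmat l b (xvec a c))" for a c
  proof -
    have "T (xvec a c) = T (vadd (vscale a (xvec 1 0)) (vscale c (xvec 0 1)))" by (simp add: xvec_lin)
    also have "\<dots> = vadd (vscale a (T (xvec 1 0))) (vscale c (T (xvec 0 1)))"
      using T xvec_V1 by (simp add: UB_def)
    also have "\<dots> = vscale k (gmat l b (xvec a c))"
      unfolding 0 gd xvec_lin unfolding gmat_xvec vscale_xvec \<alpha> \<gamma> \<delta> by (simp add: algebra_simps)
    finally show ?thesis .
  qed
  then have "ind V1 B1 T = gg l b"
    unfolding gg_def by (intro ind_V1_eqI[OF T gmat_UB[OF l] _ k0])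
  with l show ?thesis using that by blast
qed

text \<open>Bruhat decomposition, read off from the image of the first isotropic basis vector. If
  its line is moved, isotropy makes the ratio of the two coordinates of the image equal to
  \<open>\<i> * c\<close> with real \<open>c\<close>; then \<open>gmat 1 (- c)\<close> followed by
  \<open>wmat\<close> brings the line back, and the rest is upper triangular.\<close>

lemma G1_cases:
  assumes "g \<in> G1"
  obtains (borel) l b where "l > 0" "g = gg l b"
    | (big_cell) c l b where "l > 0" "g = compose D1 (gg 1 c) (compose D1 gw (gg l b))"
proof -
  obtain T where T: "T \<in> UB V1 B1" "g = ind V1 B1 T" using assms by (auto simp: PU_def)
  obtain \<alpha> \<beta> where ab: "T (xvec 1 0) = xvec \<alpha> \<beta>" using dim1.UB_mem[OF T(1) xvec_V1] by (metis V1E)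
  show ?thesis
  proof (cases "\<beta> = 0")
    case True
    then show ?thesis using upper_triangular[OF T(1)] ab T(2) borel by metis
  next
    case False
    have "B1 (T (xvec 1 0)) (T (xvec 1 0)) = 0" using T(1) xvec_V1 by (simp add: UB_def B1_xvec)
    then have iso: "\<alpha> * cnj \<beta> + \<beta> * cnj \<alpha> = 0" by (simp add: ab B1_xvec)
    define c where "c = Im (\<alpha> / \<beta>)"
    have "\<alpha> / \<beta> + cnj (\<alpha> / \<beta>) = (\<alpha> * cnj \<beta> + \<beta> * cnj \<alpha>) / (\<beta> * cnj \<beta>)"
      using False by (simp add: field_simps)
    then have "Re (\<alpha> / \<beta>) = 0" unfolding iso complex_add_cnj by simp
    then have "\<alpha> / \<beta> = \<i> * of_real c" by (simp add: c_def complex_eq_iff)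
    then have \<alpha>: "\<alpha> = \<i> * of_real c * \<beta>" using False by (simp add: field_simps)
    have U: "gmat 1 (- c) \<in> UB V1 B1" "gmat 1 c \<in> UB V1 B1" by (auto intro: gmat_UB)
    define S where "S v = wmat (gmat 1 (- c) (T v))" for v
    have S: "S \<in> UB V1 B1" 
      unfolding S_def[abs_def] by (rule dim1.UB_comp[OF wmat_UB dim1.UB_comp[OF U(1) T(1)]])
    have "S (xvec 1 0) = xvec \<beta> 0" by (simp add: S_def ab gmat_xvec wmat_xvec \<alpha>)
    then obtain l b where l: "l > 0" "ind V1 B1 S = gg l b" using upper_triangular[OF S] by metis
    have "compose D1 (gg 1 c) (compose D1 gw (gg l b)) = ind V1 B1 (\<lambda>v. gmat 1 c (wmat (S v)))"
      unfolding l(2)[symmetric] gw_def dim1.ind_compose[OF wmat_UB S] unfolding gg_def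
      by (rule dim1.ind_compose[OF U(2) dim1.UB_comp[OF wmat_UB S]])
    also have "\<dots> = ind V1 B1 T"
    proof (rule ind_V1_eqI[OF dim1.UB_comp[OF U(2) dim1.UB_comp[OF wmat_UB S]] T(1), where k = 1])
      fix x y
      obtain x' y' where "T (xvec x y) = xvec x' y'" using dim1.UB_mem[OF T(1) xvec_V1] by (metis V1E)
      then show "gmat 1 c (wmat (S (xvec x y))) = vscale 1 (T (xvec x y))"
        by (simp add: S_def gmat_xvec wmat_xvec)
    qed simp
    finally show ?thesis using big_cell l(1) T(2) by metis
  qed
qed

section \<open>Continuity in the group parameters\<close>

lemma V1_Vinf: "v \<in> V1 \<Longrightarrow> v \<in> Vinf"
  unfolding V1_def Vinf_def mem_Collect_eq by (rule summable_finite[of "{..<2}"]) auto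

lemma B1_Binf:
  assumes "v \<in> V1" "w \<in> V1"
  shows "B1 v w = Binf v w"
proof -
  have "(\<Sum>n. v (Suc n) * cnj (w (Suc n))) = (\<Sum>n\<in>{0}. v (Suc n) * cnj (w (Suc n)))"
    by (rule suminf_finite) (use assms in \<open>auto simp: V1_def\<close>)
  then show ?thesis by (simp add: B1_def Binf_def)
qed

text \<open>Supplies the pointwise convergence that \<open>orb_cont\<close> has as its
  premise.\<close>

lemma gg_tendsto_id:
  assumes l: "l \<longlonglongrightarrow> 1" "\<And>n. l n > 0" and b: "b \<longlonglongrightarrow> 0" and y: "y \<in> hpts V1 B1"
  shows "(\<lambda>n. hdist B1 (gg (l n) (b n) y) (gg 1 0 y)) \<longlonglongrightarrow> 0"
proof -
  obtain v where v: "v \<in> V1" "y = lineof v" "Re (B1 v v) > 0" using y by (auto simp: hpts_def)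
  obtain a c where ac: "v = xvec a c" using v(1) by (metis V1E)
  define q where "q = Re (B1 v v)"
  have q: "q > 0" using v(3) by (simp add: q_def)
  have nz: "v \<noteq> (\<lambda>n. 0)" using v(3) by (auto simp: B1_def)
  have gm: "gg l b y = lineof (gmat l b v)" if "l > 0" for l b
    unfolding gg_def v(2) using v(1,3) nz by (intro dim1.ind_lineof gmat_UB that) auto
  have Bg: "B1 (gmat l b v) (gmat l b v) = B1 v v" if "l > 0" for l b
    using gmat_UB[OF that] v(1) by (simp add: UB_def)
  have mem: "gmat l b v \<in> V1" if "l > 0" for l b
    by (rule dim1.UB_mem[OF gmat_UB[OF that] v(1)])
  define f where "f n = cmod (B1 (gmat (l n) (b n) v) (gmat 1 0 v)) / sqrt (q * q)" for n
  have hd: "hdist B1 (gg (l n) (b n) y) (gg 1 0 y) = arcosh (f n)" for n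
  proof -
    have "hdist B1 (lineof (gmat (l n) (b n) v)) (lineof (gmat 1 0 v)) = arcosh (cmod (B1 (gmat (l n) (b n) v) (gmat 1 0 v))
       / sqrt (Re (B1 (gmat (l n) (b n) v) (gmat (l n) (b n) v)) * Re (B1 (gmat 1 0 v) (gmat 1 0 v))))"
      by (rule dim1.hdist_lineof[OF mem[OF l(2)] mem]) (auto simp: Bg l(2) v(3))
    then show ?thesis using l(2)[of n] by (simp add: gm Bg f_def q_def)
  qed
  have f1: "f n \<ge> 1" for n
  proof -
    \<comment> \<open>The lower bound is imported from the infinite-dimensional form, which
      restricts to \<open>B1\<close> on \<open>V1\<close>.\<close>
    let ?x = "mk_ell2 (gmat (l n) (b n) v)" and ?y = "mk_ell2 (gmat 1 0 v)"
    have B: "B ?x ?y = B1 (gmat (l n) (b n) v) (gmat 1 0 v)" "B ?x ?x = B1 v v" "B ?y ?y = B1 v v"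
      using mem[OF l(2)] mem[of 1 0] Bg[OF l(2)] Bg[of 1 0] by (simp_all add: B_def V1_Vinf B1_Binf)
    show ?thesis using hdist_argument_ge_1[of ?x ?y] v(3) unfolding B f_def q_def by simp
  qed
  have "f \<longlonglongrightarrow> cmod ((of_real 1 * a + \<i> * of_real 0 * c) * cnj c + c / of_real 1 * cnj a) / sqrt (q * q)"
    unfolding f_def ac gmat_xvec B1_xvec using q
    by (intro tendsto_intros tendsto_of_real[OF l(1)] tendsto_of_real[OF b]) simp_all
  also have "cmod ((of_real 1 * a + \<i> * of_real 0 * c) * cnj c + c / of_real 1 * cnj a) / sqrt (q * q) = 1"
  proof -
    have "a * cnj c + c * cnj a = of_real q"
      using dim1.H_self_real[OF v(1)] unfolding ac B1_xvec q_def by (simp add: complex_eq_iff)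
    then show ?thesis using q by simp
  qed
  finally have "(\<lambda>n. arcosh (f n)) \<longlonglongrightarrow> arcosh 1"
    by (rule tendsto_arcosh_strong) (auto simp: f1)
  then show ?thesis by (simp add: hd)
qed

section \<open>Non-elementary representations\<close>

locale nonelementary_rep =
  fixes \<rho> :: "isom \<Rightarrow> isom"
  assumes rep: "is_rep \<rho>" and nonelem: "non_elementary \<rho>"
begin

text \<open>An arbitrary lift; since it is determined only up to a unit scalar, all its algebraic
  properties are stated with \<open>peq\<close>.\<close>

definition L :: "isom \<Rightarrow> ell2 \<Rightarrow> ell2" where
  "L g = lift (SOME F. F \<in> UB Vinf Binf \<and> \<rho> g = ind Vinf Binf F)"

lemma L_props:
  assumes "g \<in> G1"
  shows "isU (L g)" and "x \<in> cone \<Longrightarrow> \<rho> g (cline x) = cline (L g x)"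
proof -
  have "\<exists>F. F \<in> UB Vinf Binf \<and> \<rho> g = ind Vinf Binf F" using rep assms by (auto simp: is_rep_def PU_def)
  then obtain F where F: "F \<in> UB Vinf Binf" "\<rho> g = ind Vinf Binf F" "L g = lift F"
    unfolding L_def by (metis (mono_tags, lifting) someI_ex)
  show "isU (L g)" using F isU_lift by simp
  show "x \<in> cone \<Longrightarrow> \<rho> g (cline x) = cline (L g x)" using F ind_cline by simp
qed

lemmas L_isU = L_props(1) and rho_cline = L_props(2)

lemma peq_L_if_ind:
  assumes "F \<in> UB Vinf Binf" "g \<in> G1" "ind Vinf Binf F = \<rho> g"
  shows "peq (lift F) (L g)"
proof (rule peq_if_lines_agree)
  fix x assume "Re (B x x) > 0"
  then have "cline (lift F x) = cline (L g x)"
    using ind_cline[OF assms(1)] rho_cline[OF assms(2)] assms(3) cone_positive by metis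
  then show "\<exists>c. lift F x = c *c L g x" using cline_eq_iff by blast
qed (use assms isU_lift L_isU in auto)

lemma L_compose:
  assumes g: "g \<in> G1" and h: "h \<in> G1"
  shows "peq (L (compose D1 g h)) (\<lambda>x. L g (L h x))"
proof (rule peq_if_lines_agree)
  note gh = G1_compose[OF g h]
  show "isU (L (compose D1 g h))" using gh by (rule L_isU)
  show "isU (\<lambda>x. L g (L h x))" by (rule isU_comp[OF L_isU[OF g] L_isU[OF h]])
  fix x assume "Re (B x x) > 0"
  then have x: "x \<in> cone" by (rule cone_positive)
  then have D: "cline x \<in> Dinf" by (auto simp: Dinf_iff)
  have "\<rho> (compose D1 g h) = compose Dinf (\<rho> g) (\<rho> h)" using rep g h by (simp add: is_rep_def)
  then have "\<rho> (compose D1 g h) (cline x) = \<rho> g (\<rho> h (cline x))" using D by (simp add: compose_def)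
  then have "cline (L (compose D1 g h) x) = cline (L g (L h x))"
    using rho_cline[OF gh x] rho_cline[OF h x] rho_cline[OF g cone_isU[OF L_isU[OF h] x]] by simp
  then show "\<exists>c. L (compose D1 g h) x = c *c L g (L h x)" using cline_eq_iff by blast
qed

text \<open>\<open>gg 1 0\<close> is idempotent, so its lift agrees up to a scalar with its own
  square; surjectivity cancels one factor.\<close>

lemma L_id: "peq (L (gg 1 0)) (\<lambda>x. x)"
proof -
  have 1: "gg 1 0 \<in> G1" by (rule gg_G1) simp
  obtain c where c: "cmod c = 1" "\<And>x. L (gg 1 0) x = c *c L (gg 1 0) (L (gg 1 0) x)"
    using peqE[OF L_compose[OF 1 1]] gg_1_0[OF 1] by metis
  have "y = c *c L (gg 1 0) y" for y
    using c(2) isU_surj[OF L_isU[OF 1]] by (metis surjD)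
  then have "peq (\<lambda>x. x) (L (gg 1 0))" using c(1) by (auto simp: peq_def)
  then show ?thesis by (rule peq_sym)
qed

lemma L_gg_gg:
  assumes "l > 0" "l' > 0"
  shows "peq (L (gg (l * l') (l * b' + b / l'))) (\<lambda>x. L (gg l b) (L (gg l' b') x))"
  using L_compose[OF gg_G1[OF assms(1)] gg_G1[OF assms(2)]] gg_gg[OF assms] by metis

lemma L_borel:
  assumes "l > 0"
  shows "peq (L (gg l b)) (\<lambda>x. L (gg 1 (b * l)) (L (gg l 0) x))"
  using L_gg_gg[OF zero_less_one assms, of 0 "b * l"] assms by simp

text \<open>Orbital continuity at the identity in terms of the form: \<open>cosh\<close> is applied
  to the distances, which tend to 0.\<close>

lemma L_orbit_tendsto:
  assumes "l \<longlonglongrightarrow> 1" "\<And>n. l n > 0" "b \<longlonglongrightarrow> 0" and x: "Re (B x x) > 0"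
  shows "(\<lambda>n. cmod (B (L (gg (l n) (b n)) x) x)) \<longlonglongrightarrow> Re (B x x)"
proof -
  define q where "q = Re (B x x)"
  have q: "q > 0" using x by (simp add: q_def)
  have xc: "x \<in> cone" using x by (rule cone_positive)
  have 1: "gg 1 0 \<in> G1" by (rule gg_G1) simp
  have id: "\<rho> (gg 1 0) (cline x) = cline x"
    unfolding rho_cline[OF 1 xc] using peqE[OF L_id] cline_csc by metis
  have g: "gg (l n) (b n) \<in> G1" for n using assms(2) by (rule gg_G1)
  define f where "f n = cmod (B (L (gg (l n) (b n)) x) x) / sqrt (q * q)" for n
  have pos: "Re (B (L (gg (l n) (b n)) x) (L (gg (l n) (b n)) x)) = q" for n
    by (simp add: isU_B[OF L_isU[OF g]] q_def)
  have "(\<lambda>n. hdist Binf (\<rho> (gg (l n) (b n)) (cline x)) (\<rho> (gg 1 0) (cline x))) \<longlonglongrightarrow> 0"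
  proof -
    have "orb_cont \<rho>" using rep by (simp add: is_rep_def)
    moreover have "cline x \<in> hpts Vinf Binf" using x by (auto simp: hpts_iff)
    ultimately show ?thesis
      unfolding orb_cont_def using 1 g gg_tendsto_id[OF assms(1,2,3)]
      by (auto dest!: bspec[of _ _ "cline x"])
  qed
  moreover have "hdist Binf (\<rho> (gg (l n) (b n)) (cline x)) (\<rho> (gg 1 0) (cline x)) = arcosh (f n)" for n
    unfolding id rho_cline[OF g xc] f_def
    using hdist_cline[of "L (gg (l n) (b n)) x" x] pos[of n] q by (simp add: q_def)
  ultimately have "(\<lambda>n. cosh (arcosh (f n))) \<longlonglongrightarrow> cosh 0"
    by (intro tendsto_intros) simp
  moreover have "f n \<ge> 1" for n
    using hdist_argument_ge_1[of "L (gg (l n) (b n)) x" x] pos[of n] q by (simp add: f_def q_def)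
  ultimately have "f \<longlonglongrightarrow> 1" by simp
  then have "(\<lambda>n. f n * q) \<longlonglongrightarrow> 1 * q" by (intro tendsto_intros)
  then show ?thesis using q by (simp add: f_def q_def)
qed

section \<open>Subsets of the group with bounded orbits\<close>

definition orbit_bounded :: "isom set \<Rightarrow> bool" where
  "orbit_bounded S \<longleftrightarrow> S \<subseteq> G1 \<and> (\<exists>M. \<forall>g\<in>S. norm (L g e0) \<le> M)"

lemma norm_L_e0: "g \<in> G1 \<Longrightarrow> (norm (L g e0))\<^sup>2 = 2 * (cmod (B (L g e0) e0))\<^sup>2 - 1"
  by (simp add: ell2_norm_B isU_B[OF L_isU])

lemma orbit_boundedI:
  assumes "S \<subseteq> G1" "\<And>g. g \<in> S \<Longrightarrow> cmod (B (L g e0) e0) \<le> M"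
  shows "orbit_bounded S"
proof -
  have "norm (L g e0) \<le> 2 * M" if g: "g \<in> S" for g
  proof -
    let ?C = "cmod (B (L g e0) e0)"
    have "(norm (L g e0))\<^sup>2 \<le> (2 * ?C)\<^sup>2"
    proof -
      have "(norm (L g e0))\<^sup>2 = 2 * ?C\<^sup>2 - 1" using norm_L_e0 assms(1) g by blast
      moreover have "0 \<le> ?C\<^sup>2" by simp
      moreover have "(2 * ?C)\<^sup>2 = 4 * ?C\<^sup>2" by (simp add: power_mult_distrib)
      ultimately show ?thesis by linarith
    qed
    then have "norm (L g e0) \<le> 2 * ?C" by (rule power2_le_imp_le) simp
    then show ?thesis using assms(2)[OF g] by linarith
  qed
  then show ?thesis using assms(1) by (auto simp: orbit_bounded_def)
qed

lemma orbit_bounded_cmod: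
  assumes "orbit_bounded S"
  shows "\<exists>M. \<forall>g\<in>S. cmod (B (L g e0) e0) \<le> M"
proof -
  obtain M where M: "\<And>g. g \<in> S \<Longrightarrow> norm (L g e0) \<le> M" using assms by (auto simp: orbit_bounded_def)
  obtain K where K: "K > 0" "\<And>x y. cmod (B x y) \<le> K * norm x * norm y" using B_bound by blast
  have "cmod (B (L g e0) e0) \<le> K * M * norm e0" if "g \<in> S" for g
    using K(2)[of "L g e0" e0] K(1) M[OF that]
    by (meson order_trans mult_right_mono mult_left_mono norm_ge_zero less_imp_le)
  then show ?thesis by blast
qed

lemma orbit_bounded_subset: "orbit_bounded S \<Longrightarrow> S' \<subseteq> S \<Longrightarrow> orbit_bounded S'"
  unfolding orbit_bounded_def by blast

lemma orbit_bounded_Un: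
  assumes "orbit_bounded S" "orbit_bounded S'"
  shows "orbit_bounded (S \<union> S')"
proof -
  obtain M M' where "\<forall>g\<in>S. norm (L g e0) \<le> M" "\<forall>g\<in>S'. norm (L g e0) \<le> M'"
    using assms by (auto simp: orbit_bounded_def)
  then have "\<forall>g\<in>S \<union> S'. norm (L g e0) \<le> max M M'" by fastforce
  then show ?thesis using assms unfolding orbit_bounded_def by blast
qed

lemma orbit_bounded_singleton: "g \<in> G1 \<Longrightarrow> orbit_bounded {g}"
  unfolding orbit_bounded_def by auto

abbreviation set_compose :: "isom set \<Rightarrow> isom set \<Rightarrow> isom set" (infixr "\<odot>" 70) where
  "S \<odot> S' \<equiv> {compose D1 g h | g h. g \<in> S \<and> h \<in> S'}"

text \<open>\<open>norm (L g e0)\<close> controls the operator norm of \<open>L g\<close> by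
  \<open>isU_norm_bound\<close>; hence the choice of the norm as the measure of boundedness.\<close>

lemma orbit_bounded_compose:
  assumes "orbit_bounded S" "orbit_bounded S'"
  shows "orbit_bounded (S \<odot> S')"
proof -
  obtain M where M: "\<And>g. g \<in> S \<Longrightarrow> norm (L g e0) \<le> M" using assms(1) by (auto simp: orbit_bounded_def)
  obtain M' where M': "\<And>g. g \<in> S' \<Longrightarrow> norm (L g e0) \<le> M'" using assms(2) by (auto simp: orbit_bounded_def)
  have S: "S \<subseteq> G1" "S' \<subseteq> G1" using assms by (auto simp: orbit_bounded_def)
  obtain K where K: "K > 0" "\<And>T x. isU T \<Longrightarrow> norm (T x) \<le> (2 * K * norm (T e0) + 1) * norm x"
    using isU_norm_bound by blast
  have "norm (L (compose D1 g h) e0) \<le> (2 * K * M + 1) * M'" if gh: "g \<in> S" "h \<in> S'" for g h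
  proof -
    have G: "g \<in> G1" "h \<in> G1" using gh S by auto
    have M0: "0 \<le> M" using M[OF gh(1)] norm_ge_zero[of "L g e0"] by linarith
    have "norm (L (compose D1 g h) e0) = norm (L g (L h e0))" by (rule peq_norm[OF L_compose[OF G]])
    also have "\<dots> \<le> (2 * K * norm (L g e0) + 1) * norm (L h e0)" by (rule K(2)[OF L_isU[OF G(1)]])
    also have "\<dots> \<le> (2 * K * M + 1) * M'"
      using K(1) M[OF gh(1)] M'[OF gh(2)] M0 by (intro mult_mono add_mono mult_left_mono) auto
    finally show ?thesis .
  qed
  then show ?thesis using S G1_compose unfolding orbit_bounded_def by blast
qed

text \<open>A bounded orbit has a circumcentre, which is fixed by the whole group.\<close>

lemma not_orbit_bounded_G1: "\<not> orbit_bounded G1"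
proof
  assume "orbit_bounded G1"
  then obtain M where M: "\<And>g. g \<in> G1 \<Longrightarrow> norm (L g e0) \<le> M" by (auto simp: orbit_bounded_def)
  have 1: "gg 1 0 \<in> G1" by (rule gg_G1) simp
  define A where "A = insert e0 {L g e0 | g. g \<in> G1}"
  have e0A: "e0 \<in> A" by (simp add: A_def)
  have bdA: "norm v \<le> M" if "v \<in> A" for v
    using that M M[OF 1] peq_norm[OF L_id, of e0] by (auto simp: A_def)
  obtain x where x: "B x x = 1"
    "\<And>y. B y y = 1 \<Longrightarrow> (\<And>s. (\<forall>v\<in>A. cmod (B v x) \<le> s) \<Longrightarrow> (\<forall>v\<in>A. cmod (B v y) \<le> s)) \<Longrightarrow> \<exists>c. y = c *c x"
    using circumcentre[OF e0A bdA] by blast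
  have xc: "x \<in> cone" using x(1) by (intro cone_positive) simp
  have fix_line: "\<rho> h (cline x) = cline x" if h: "h \<in> G1" for h
  proof -
    have "\<exists>c. L h x = c *c x"
    proof (rule x(2))
      show "B (L h x) (L h x) = 1" using isU_B[OF L_isU[OF h]] x(1) by simp
      fix s assume s: "\<forall>v\<in>A. cmod (B v x) \<le> s"
      \<comment> \<open>Applying the lift of the inverse \<open>k\<close> moves the test from
        \<open>L h x\<close> back to \<open>x\<close>, while the orbit point of \<open>g\<close>
        becomes that of \<open>k\<close> composed with \<open>g\<close>.\<close>
      obtain k where k: "k \<in> G1" "compose D1 k h = gg 1 0" using G1_inverse[OF h] by blast
      have *: "cmod (B (L g e0) (L h x)) \<le> s" if g: "g \<in> G1" for g
      proof -
        have "cmod (B (L g e0) (L h x)) = cmod (B (L k (L g e0)) (L k (L h x)))"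
          by (simp add: isU_B[OF L_isU[OF k(1)]])
        also have "\<dots> = cmod (B (L (compose D1 k g) e0) (L k (L h x)))"
          by (rule peq_cmod_B[OF L_compose[OF k(1) g], symmetric])
        also have "\<dots> = cmod (B (L (compose D1 k g) e0) x)"
          unfolding cmod_B_commute[of "L (compose D1 k g) e0"]
          by (rule peq_cmod_B[OF peq_trans[OF peq_sym[OF L_compose[OF k(1) h, unfolded k(2)]] L_id]])
        also have "\<dots> \<le> s" using s G1_compose[OF k(1) g] by (auto simp: A_def)
        finally show ?thesis .
      qed
      have "cmod (B e0 (L h x)) \<le> s" using *[OF 1] peq_cmod_B[OF L_id] by simp
      with * show "\<forall>v\<in>A. cmod (B v (L h x)) \<le> s" by (auto simp: A_def)
    qed
    then obtain c where c: "L h x = c *c x" by blast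
    moreover have "x \<noteq> 0" using x(1) by auto
    then have "c \<noteq> 0" using c isU_eq_0_iff[OF L_isU[OF h], of x] by auto
    ultimately show ?thesis using rho_cline[OF h xc] cline_csc by simp
  qed
  moreover have "cline x \<in> Dinf" using xc by (auto simp: Dinf_iff)
  ultimately show False using nonelem by (auto simp: non_elementary_def)
qed

text \<open>Parameters violating the bound at every scale \<open>1 / Suc n\<close> would converge to
  those of the identity, where the displacement tends to \<open>B e0 e0 = 1\<close>; 2 is a
  convenient value above 1.\<close>

lemma local_bound:
  obtains \<epsilon> where "\<epsilon> > 0"
    "\<And>l b. l > 0 \<Longrightarrow> \<bar>l - 1\<bar> < \<epsilon> \<Longrightarrow> \<bar>b\<bar> < \<epsilon> \<Longrightarrow> cmod (B (L (gg l b) e0) e0) \<le> 2"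
proof (rule ccontr)
  assume no: "\<not> thesis"
  have "\<exists>l b. l > 0 \<and> \<bar>l - 1\<bar> < 1 / real (Suc n) \<and> \<bar>b\<bar> < 1 / real (Suc n)
      \<and> \<not> cmod (B (L (gg l b) e0) e0) \<le> 2" for n
    using that[of "1 / real (Suc n)"] no by fastforce
  then obtain l b where lb: "\<And>n. l n > 0" "\<And>n. \<bar>l n - 1\<bar> < 1 / real (Suc n)"
      "\<And>n. \<bar>b n\<bar> < 1 / real (Suc n)" "\<And>n. \<not> cmod (B (L (gg (l n) (b n)) e0) e0) \<le> 2"
    by metis
  have lim: "(\<lambda>n. 1 / real (Suc n)) \<longlonglongrightarrow> 0" using LIMSEQ_Suc[OF lim_1_over_n] by simp
  have "(\<lambda>n. l n - 1) \<longlonglongrightarrow> 0"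
    by (rule Lim_null_comparison[OF _ lim]) (auto intro!: always_eventually less_imp_le lb(2) simp del: of_nat_Suc)
  then have "l \<longlonglongrightarrow> 1" by (simp add: LIM_zero_iff)
  moreover have "b \<longlonglongrightarrow> 0"
    by (rule Lim_null_comparison[OF _ lim]) (auto intro!: always_eventually less_imp_le lb(3) simp del: of_nat_Suc)
  ultimately have "(\<lambda>n. cmod (B (L (gg (l n) (b n)) e0) e0)) \<longlonglongrightarrow> 1"
    using L_orbit_tendsto[of l b e0] lb(1) by simp
  then have "\<forall>\<^sub>F n in sequentially. cmod (B (L (gg (l n) (b n)) e0) e0) < 2"
    by (rule order_tendstoD) simp
  then obtain n where "cmod (B (L (gg (l n) (b n)) e0) e0) < 2" by (auto simp: eventually_sequentially)
  then show False using lb(4)[of n] by simp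
qed

lemma gg_conj:
  assumes "t > 0"
  shows "gg 1 b = compose D1 (gg t 0) (compose D1 (gg 1 (b / t\<^sup>2)) (gg (1 / t) 0))"
  using assms by (simp add: gg_gg power2_eq_square)

text \<open>Conjugation by \<open>gg t 0\<close> divides the unipotent parameter by
  \<open>t^2\<close>. With \<open>t^2 = |R| / \<epsilon> + 1\<close> the whole interval lands in the
  neighbourhood of \<open>local_bound\<close>, at the price of two fixed factors.\<close>

lemma unipotent_bounded: "orbit_bounded {gg 1 b | b. \<bar>b\<bar> \<le> R}"
proof -
  obtain \<epsilon> where e: "\<epsilon> > 0"
    "\<And>l b. l > 0 \<Longrightarrow> \<bar>l - 1\<bar> < \<epsilon> \<Longrightarrow> \<bar>b\<bar> < \<epsilon> \<Longrightarrow> cmod (B (L (gg l b) e0) e0) \<le> 2"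
    using local_bound by blast
  define N where "N = {gg 1 b | b. \<bar>b\<bar> < \<epsilon>}"
  have N: "orbit_bounded N" unfolding N_def
    by (rule orbit_boundedI[of _ 2]) (use e in \<open>auto intro: gg_G1\<close>)
  define t where "t = sqrt (\<bar>R\<bar> / \<epsilon> + 1)"
  have t: "t > 0" using e(1) by (simp add: t_def add_nonneg_pos)
  have t2: "t\<^sup>2 = \<bar>R\<bar> / \<epsilon> + 1" using e(1) by (simp add: t_def)
  have "{gg 1 b | b. \<bar>b\<bar> \<le> R} \<subseteq> {gg t 0} \<odot> N \<odot> {gg (1 / t) 0}"
  proof clarify
    fix b assume "\<bar>b\<bar> \<le> R"
    then have "\<bar>b\<bar> < \<epsilon> * t\<^sup>2" unfolding t2 using e(1) by (simp add: distrib_left)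
    then have "\<bar>b / t\<^sup>2\<bar> < \<epsilon>" using t by (simp add: pos_divide_less_eq mult.commute)
    then show "\<exists>g h. gg 1 b = compose D1 g h \<and> g \<in> {gg t 0} \<and>
        h \<in> N \<odot> {gg (1 / t) 0}"
      using gg_conj[OF t, of b] unfolding N_def by blast
  qed
  moreover have "orbit_bounded ({gg t 0} \<odot> N \<odot> {gg (1 / t) 0})"
    by (intro orbit_bounded_compose orbit_bounded_singleton gg_G1 N) (use t in auto)
  ultimately show ?thesis by (rule orbit_bounded_subset[rotated])
qed

lemma cmod_B_gg_inverse:
  assumes l: "l > 0"
  shows "cmod (B (L (gg (1 / l) 0) e0) e0) = cmod (B (L (gg l 0) e0) e0)"
proof -
  have il: "1 / l > 0" using l by simp
  have "cmod (B (L (gg (1/l) 0) e0) e0) = cmod (B (L (gg l 0) (L (gg (1/l) 0) e0)) (L (gg l 0) e0))"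
    by (simp add: isU_B[OF L_isU[OF gg_G1[OF l]]])
  also have "\<dots> = cmod (B e0 (L (gg l 0) e0))"
    using peq_cmod_B[OF peq_trans[OF peq_sym[OF L_gg_gg[OF l il, of 0 0]], of "\<lambda>x. x"]] L_id l by simp
  finally show ?thesis by (simp add: cmod_B_commute)
qed

text \<open>If the powers of one diagonal element had bounded orbit, boundedness would spread: to
  all diagonal elements through a fundamental interval and inverses, to the unipotent group by
  conjugation into \<open>|b| \<le> 1\<close>, to the Borel subgroup, and by the Bruhat
  decomposition to \<open>G1\<close>, contrary to \<open>not_orbit_bounded_G1\<close>.\<close>

lemma hyperbolic_unbounded:
  obtains \<beta> where "\<beta> > 1" "\<And>M. \<exists>k::nat. cmod (B (L (gg (\<beta> ^ k) 0) e0) e0) > M"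
proof -
  obtain \<epsilon> where e: "\<epsilon> > 0"
    "\<And>l b. l > 0 \<Longrightarrow> \<bar>l - 1\<bar> < \<epsilon> \<Longrightarrow> \<bar>b\<bar> < \<epsilon> \<Longrightarrow> cmod (B (L (gg l b) e0) e0) \<le> 2"
    using local_bound by blast
  \<comment> \<open>Chosen so that the fundamental interval from 1 to \<open>\<beta>\<close> lies
    inside the neighbourhood of \<open>local_bound\<close>.\<close>
  define \<beta> where "\<beta> = 1 + \<epsilon> / 2"
  have b1: "\<beta> > 1" using e(1) by (simp add: \<beta>_def)
  have False if bd: "\<And>k::nat. cmod (B (L (gg (\<beta> ^ k) 0) e0) e0) \<le> M" for M
  proof -
    have A1: "orbit_bounded {gg (\<beta> ^ k) 0 | k. True}"
      by (rule orbit_boundedI[of _ M]) (use bd b1 in \<open>auto intro!: gg_G1\<close>)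
    have A2: "orbit_bounded {gg l 0 | l. 1 \<le> l \<and> l \<le> \<beta>}"
      by (rule orbit_boundedI[of _ 2]) (use e in \<open>auto intro!: gg_G1 e(2) simp: \<beta>_def\<close>)
    have sub: "{gg l 0 | l. 1 \<le> l} \<subseteq> {gg (\<beta> ^ k) 0 | k. True} \<odot> {gg l 0 | l. 1 \<le> l \<and> l \<le> \<beta>}"
    proof clarify
      fix l :: real assume l: "1 \<le> l"
      \<comment> \<open>The least exponent with \<open>l < \<beta> ^ n\<close> is positive, and its
        predecessor \<open>k\<close> places \<open>l / \<beta> ^ k\<close> in the fundamental
        interval.\<close>
      define n where "n = (LEAST n. l < \<beta> ^ n)"
      obtain n0 where "l < \<beta> ^ n0" using real_arch_pow[OF b1] by blast
      then have n: "l < \<beta> ^ n" unfolding n_def by (rule LeastI)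
      then have "n \<noteq> 0" using l by (intro notI) simp
      then obtain k where k: "n = Suc k" using not0_implies_Suc by blast
      have "\<not> l < \<beta> ^ k" using not_less_Least[of k "\<lambda>n. l < \<beta> ^ n"] k by (simp add: n_def[symmetric])
      then have ge: "\<beta> ^ k \<le> l" by simp
      have p: "\<beta> ^ k > 0" using b1 by simp
      have "l / \<beta> ^ k > 0" using l p by simp
      then have "gg l 0 = compose D1 (gg (\<beta> ^ k) 0) (gg (l / \<beta> ^ k) 0)"
        using gg_gg[OF p, of "l / \<beta> ^ k" 0 0] p b1 by simp
      moreover have "1 \<le> l / \<beta> ^ k" "l / \<beta> ^ k \<le> \<beta>"
        using ge n p by (simp_all add: k pos_le_divide_eq pos_divide_le_eq mult.commute)
      ultimately show "\<exists>g h. gg l 0 = compose D1 g h \<and> g \<in> {gg (\<beta> ^ k) 0 | k. True} \<and> h \<in> {gg l 0 | l. 1 \<le> l \<and> l \<le> \<beta>}"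
        by blast
    qed
    have "orbit_bounded {gg l 0 | l. 1 \<le> l}"
      by (rule orbit_bounded_subset[OF orbit_bounded_compose[OF A1 A2] sub])
    from orbit_bounded_cmod[OF this] obtain M'
      where bd': "\<forall>g\<in>{gg l 0 | l. 1 \<le> l}. cmod (B (L g e0) e0) \<le> M'" ..
    have M': "cmod (B (L (gg l 0) e0) e0) \<le> M'" if "1 \<le> l" for l
      by (rule bspec[OF bd']) (use that in blast)
    have A: "orbit_bounded {gg l 0 | l. l > 0}"
    proof (rule orbit_boundedI[of _ M'])
      fix g assume "g \<in> {gg l 0 | l. l > 0}"
      then obtain l where l: "l > 0" "g = gg l 0" by blast
      show "cmod (B (L g e0) e0) \<le> M'"
      proof (cases "1 \<le> l")
        case True then show ?thesis using M' l by simp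
      next
        case False
        then have "1 \<le> 1 / l" using l by simp
        then show ?thesis using M' cmod_B_gg_inverse[OF l(1)] l(2) by metis
      qed
    qed (auto intro: gg_G1)
    have N1: "orbit_bounded {gg 1 b | b. \<bar>b\<bar> \<le> 1}" by (rule unipotent_bounded)
    have "{gg 1 b | b. True} \<subseteq> {gg l 0 | l. l > 0} \<odot> {gg 1 b | b. \<bar>b\<bar> \<le> 1} \<odot> {gg l 0 | l. l > 0}"
    proof clarify
      fix b :: real
      define t where "t = sqrt (\<bar>b\<bar> + 1)"
      have t: "t > 0" by (simp add: t_def add_nonneg_pos)
      have "\<bar>b / t\<^sup>2\<bar> \<le> 1" by (simp add: t_def)
      moreover have "1 / t > 0" using t by simp
      ultimately show "\<exists>g h. gg 1 b = compose D1 g h \<and> g \<in> {gg l 0 | l. l > 0} \<and>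
          h \<in> {gg 1 b | b. \<bar>b\<bar> \<le> 1} \<odot> {gg l 0 | l. l > 0}"
        using gg_conj[OF t, of b] t by blast
    qed
    then have N: "orbit_bounded {gg 1 b | b. True}"
      by (rule orbit_bounded_subset[rotated]) (intro orbit_bounded_compose A N1)
    have P: "orbit_bounded {gg l b | l b. l > 0}"
    proof (rule orbit_bounded_subset[OF orbit_bounded_compose[OF N A]], clarify)
      fix l b :: real assume l: "l > 0"
      have "gg l b = compose D1 (gg 1 (b * l)) (gg l 0)" using l by (simp add: gg_gg)
      then show "\<exists>g h. gg l b = compose D1 g h \<and> g \<in> {gg 1 b | b. True} \<and> h \<in> {gg l 0 | l. l > 0}"
        using l by blast
    qed
    have Q: "orbit_bounded ({gg 1 b | b. True} \<odot> {gw} \<odot> {gg l b | l b. l > 0})"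
      by (intro orbit_bounded_compose N P orbit_bounded_singleton gw_G1)
    have "G1 \<subseteq> {gg l b | l b. l > 0} \<union> ({gg 1 b | b. True} \<odot> {gw} \<odot> {gg l b | l b. l > 0})" (is "_ \<subseteq> ?P \<union> ?Q")
    proof
      fix g assume "g \<in> G1"
      then show "g \<in> ?P \<union> ?Q" by (cases rule: G1_cases) blast+
    qed
    then have "orbit_bounded G1"
      by (rule orbit_bounded_subset[OF orbit_bounded_Un[OF P Q]])
    then show False using not_orbit_bounded_G1 by blast
  qed
  then have "\<exists>k::nat. cmod (B (L (gg (\<beta> ^ k) 0) e0) e0) > M" for M by (meson not_le)
  then show ?thesis using that b1 by blast
qed

text \<open>Along record times \<open>k\<^sub>j\<close> of the displacement \<open>c k\<close> of \<open>e0\<close> under \<open>gg (\<beta> ^ k) 0\<close>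
  the orbit points form a Gromov sequence; they converge to an isotropic line, which is fixed by
  every \<open>g\<close> displacing these points by a bounded amount.\<close>

lemma borel_fixed_line:
  obtains u where "u \<noteq> 0" "B u u = 0" "\<And>l b. l > 0 \<Longrightarrow> \<exists>c. L (gg l b) u = c *c u"
proof -
  obtain \<beta> where b1: "\<beta> > 1" and unb: "\<And>M. \<exists>k::nat. cmod (B (L (gg (\<beta> ^ k) 0) e0) e0) > M"
    using hyperbolic_unbounded by blast
  define a where "a k = gg (\<beta> ^ k) 0" for k :: nat
  define c where "c k = cmod (B (L (a k) e0) e0)" for k
  have bp: "\<beta> ^ k > 0" for k using b1 by simp
  have aG: "a k \<in> G1" for k unfolding a_def using bp by (rule gg_G1)
  have "\<exists>k\<le>j. \<forall>i\<le>j. c i \<le> c k" for j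
  proof -
    have "Max (c ` {..j}) \<in> c ` {..j}" by (rule Max_in) auto
    then obtain k where "k \<le> j" "Max (c ` {..j}) = c k" by (metis atMost_iff imageE)
    then show ?thesis by (metis Max_ge atMost_iff finite_atMost finite_imageI imageI)
  qed
  then obtain k where k: "\<And>j. k j \<le> j" "\<And>j i. i \<le> j \<Longrightarrow> c i \<le> c (k j)" by metis
  define v where "v j = L (a (k j)) e0" for j
  define z where "z j = B (v j) e0" for j
  have zc: "cmod (z j) = c (k j)" for j by (simp add: z_def v_def c_def)
  have vv: "B (v j) (v j) = 1" for j by (simp add: v_def isU_B[OF L_isU[OF aG]])
  have z1: "cmod (z j) \<ge> 1" for j
    unfolding z_def by (rule cmod_B_ge_1[OF vv B_e0_e0])
  have diff: "cmod (B (L (a m) e0) (L (a n) e0)) = c (n - m)" if "m \<le> n" for m n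
  proof -
    have "\<beta> ^ n = \<beta> ^ m * \<beta> ^ (n - m)" using that by (simp add: power_add[symmetric])
    then have "peq (L (a n)) (\<lambda>x. L (a m) (L (a (n - m)) x))"
      using L_gg_gg[OF bp bp, of m "n - m" 0 0] by (simp add: a_def)
    then have "cmod (B (L (a n) e0) (L (a m) e0)) = cmod (B (L (a m) (L (a (n - m)) e0)) (L (a m) e0))"
      by (rule peq_cmod_B)
    then show ?thesis by (simp add: isU_B[OF L_isU[OF aG]] c_def cmod_B_commute)
  qed
  \<comment> \<open>The indices \<open>k i\<close> and \<open>k j\<close> differ by at most
    \<open>j\<close>, so the displacement between the two orbit points is at most the record value
    at \<open>j\<close>.\<close>
  have Bv: "cmod (B (v i) (v j)) \<le> cmod (z j)" if "i \<le> j" for i j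
  proof (cases "k i \<le> k j")
    case True
    then show ?thesis using diff[OF True] k(1)[of j] k(2)[of "k j - k i" j] by (simp add: v_def zc)
  next
    case False
    then have "k j \<le> k i" by simp
    then show ?thesis using diff[of "k j" "k i"] k(1)[of i] that k(2)[of "k i - k j" j]
      by (simp add: v_def zc cmod_B_commute)
  qed
  have mono: "cmod (z i) \<le> cmod (z j)" if "i \<le> j" for i j
    unfolding zc using k(1)[of i] that k(2)[of "k i" j] by simp
  have ztop: "filterlim (\<lambda>j. cmod (z j)) at_top sequentially"
    unfolding filterlim_at_top_gt[of _ _ 0] eventually_sequentially
  proof (intro allI impI)
    fix Z :: real
    obtain m where "c m > Z" using unb[of Z] by (auto simp: c_def a_def)
    then have "\<forall>j\<ge>m. Z \<le> cmod (z j)" using k(2)[of m] zc by (metis less_imp_le order_trans)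
    then show "\<exists>N. \<forall>n\<ge>N. Z \<le> cmod (z n)" by blast
  qed
  have zinv: "(\<lambda>j. 1 / cmod (z j)) \<longlonglongrightarrow> 0"
    using tendsto_inverse_0_at_top[OF ztop] by (simp add: inverse_eq_divide)
  define w where "w j = (1 / z j) *c v j" for j
  have "Cauchy w"
  proof (rule Cauchy_if_dist_sq_le)
    show "(\<lambda>i. 2 * (1 / cmod (z i))) \<longlonglongrightarrow> 0" using tendsto_mult[OF tendsto_const zinv, of 2] by simp
    fix i j :: nat assume ij: "i \<le> j"
    have "(norm (w i - w j))\<^sup>2 \<le> 2 * cmod (B (v i) (v j)) / (cmod (z i) * cmod (z j))
        - 1 / (cmod (z i))\<^sup>2 - 1 / (cmod (z j))\<^sup>2"
      using projective_dist_sq[OF vv vv, of i j] by (simp add: w_def z_def)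
    also have "\<dots> \<le> 2 * cmod (B (v i) (v j)) / (cmod (z i) * cmod (z j))"
    proof -
      have "0 \<le> 1 / (cmod (z i))\<^sup>2" "0 \<le> 1 / (cmod (z j))\<^sup>2" by simp_all
      then show ?thesis by linarith
    qed
    also have "\<dots> \<le> 2 * cmod (z j) / (cmod (z i) * cmod (z j))"
      using Bv[OF ij] by (intro divide_right_mono mult_left_mono) auto
    also have "\<dots> = 2 * (1 / cmod (z i))" using z1[of j] by auto
    finally show "(norm (w i - w j))\<^sup>2 \<le> 2 * (1 / cmod (z i))" .
  qed
  then obtain u where u: "w \<longlonglongrightarrow> u" using Cauchy_convergent convergent_def by blast
  have "(\<lambda>j. B (w j) e0) \<longlonglongrightarrow> B u e0" by (intro tendsto_intros u)
  moreover have "B (w j) e0 = 1" for j using z1[of j] by (auto simp: w_def z_def[symmetric])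
  ultimately have "B u e0 = 1" by (simp add: LIMSEQ_const_iff)
  then have u0: "u \<noteq> 0" by auto
  \<comment> \<open>\<open>w j\<close> is \<open>v j\<close> divided by \<open>z j\<close>, whose
    modulus tends to infinity, so pairings bounded along \<open>v j\<close> vanish in the limit.
    With \<open>T\<close> the identity this makes \<open>u\<close> isotropic; with \<open>T\<close>
    a lift from the Borel subgroup it makes \<open>T u\<close> parallel to \<open>u\<close>.\<close>
  have small: "B (T u) u = 0" if T: "isU T" and bd: "\<And>j. cmod (B (T (v j)) (v j)) \<le> M" for T M
  proof -
    have "(\<lambda>j. B (T (w j)) (w j)) \<longlonglongrightarrow> B (T u) u" by (intro tendsto_B isU_tendsto[OF T] u)
    moreover have "(\<lambda>j. B (T (w j)) (w j)) \<longlonglongrightarrow> 0"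
    proof (rule Lim_null_comparison)
      show "(\<lambda>j. M * (1 / cmod (z j) * (1 / cmod (z j)))) \<longlonglongrightarrow> 0"
        using tendsto_mult[OF tendsto_const tendsto_mult[OF zinv zinv], of M] by simp
      have "norm (B (T (w j)) (w j)) \<le> M * (1 / cmod (z j) * (1 / cmod (z j)))" for j
      proof -
        have "norm (B (T (w j)) (w j)) = cmod (B (T (v j)) (v j)) * (1 / cmod (z j) * (1 / cmod (z j)))"
          by (simp add: w_def isU_csc[OF T] norm_mult norm_divide)
        also have "\<dots> \<le> M * (1 / cmod (z j) * (1 / cmod (z j)))"
          using bd[of j] by (intro mult_right_mono) auto
        finally show ?thesis .
      qed
      then show "\<forall>\<^sub>F j in sequentially. norm (B (T (w j)) (w j)) \<le> M * (1 / cmod (z j) * (1 / cmod (z j)))"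
        by simp
    qed
    ultimately show ?thesis by (rule LIMSEQ_unique)
  qed
  have uu: "B u u = 0" using small[OF isU_id, of 1] vv by simp
  have "\<exists>d. L (gg l b) u = d *c u" if l: "l > 0" for l b
  proof -
    have g: "gg l b \<in> G1" using l by (rule gg_G1)
    have bdd: "orbit_bounded ({gg 1 b' | b'. \<bar>b'\<bar> \<le> \<bar>b * l\<bar>} \<odot> {gg l 0})"
      by (intro orbit_bounded_compose unipotent_bounded orbit_bounded_singleton g gg_G1 l)
    from orbit_bounded_cmod[OF bdd] obtain M
      where bd': "\<forall>g\<in>{gg 1 b' | b'. \<bar>b'\<bar> \<le> \<bar>b * l\<bar>} \<odot> {gg l 0}.
        cmod (B (L g e0) e0) \<le> M" ..
    have M: "cmod (B (L (compose D1 (gg 1 b') (gg l 0)) e0) e0) \<le> M" if "\<bar>b'\<bar> \<le> \<bar>b * l\<bar>" for b'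
      by (rule bspec[OF bd']) (use that in blast)
    have "cmod (B (L (gg l b) (v j)) (v j)) \<le> M" for j
    proof -
      define t where "t = \<beta> ^ k j"
      have t: "t \<ge> 1" "t > 0" using b1 by (auto simp: t_def)
      let ?b = "b / t\<^sup>2"
      \<comment> \<open>Moved past \<open>gg t 0\<close> with \<open>t \<ge> 1\<close>, the
        parameter \<open>b\<close> shrinks to \<open>b / t^2\<close>; hence one bound serves the
        displacements of all \<open>v j\<close>.\<close>
      have "peq (\<lambda>x. L (gg l b) (L (gg t 0) x)) (\<lambda>x. L (gg t 0) (L (gg l ?b) x))"
      proof -
        have "peq (L (gg (l * t) (b / t))) (\<lambda>x. L (gg l b) (L (gg t 0) x))"
          using L_gg_gg[OF l t(2), of 0 b] by simp
        moreover have "peq (L (gg (l * t) (b / t))) (\<lambda>x. L (gg t 0) (L (gg l ?b) x))"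
          using L_gg_gg[OF t(2) l, of ?b 0] t by (simp add: power2_eq_square mult.commute)
        ultimately show ?thesis using peq_sym peq_trans by blast
      qed
      then have "cmod (B (L (gg l b) (v j)) (v j)) = cmod (B (L (gg t 0) (L (gg l ?b) e0)) (L (gg t 0) e0))"
        using peq_cmod_B by (simp add: v_def a_def t_def) blast
      also have "\<dots> = cmod (B (L (gg l ?b) e0) e0)" by (simp add: isU_B[OF L_isU[OF gg_G1[OF t(2)]]])
      also have "gg l ?b = compose D1 (gg 1 (?b * l)) (gg l 0)" using l by (simp add: gg_gg)
      also have "cmod (B (L \<dots> e0) e0) \<le> M"
      proof (rule M)
        have "\<bar>b * l\<bar> / t\<^sup>2 \<le> \<bar>b * l\<bar> / 1" using t by (intro divide_left_mono) auto
        then show "\<bar>?b * l\<bar> \<le> \<bar>b * l\<bar>" by (simp add: abs_mult)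
      qed
      finally show ?thesis .
    qed
    then have "B (L (gg l b) u) u = 0" by (rule small[OF L_isU[OF g]])
    then show ?thesis using isU_B[OF L_isU[OF g], of u u] uu u0
      by (intro isotropic_orthogonal_parallel) auto
  qed
  with u0 uu show ?thesis using that by blast
qed

text \<open>Were the Weyl image of \<open>u\<close> orthogonal to \<open>u\<close>, it would span
  the same line, and by the Bruhat decomposition the whole group would fix a boundary point. So the
  pairing can be normalised to 1; the Weyl element swaps the two lines because its square is
  trivial.\<close>

lemma isotropic_frame:
  obtains e1 e2 where "B e1 e1 = 0" "B e2 e2 = 0" "B e1 e2 = 1"
    "\<And>l b. l > 0 \<Longrightarrow> \<exists>c. L (gg l b) e1 = c *c e1" "\<exists>c. L gw e1 = c *c e2" "\<exists>c. L gw e2 = c *c e1"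
proof -
  obtain u where u: "u \<noteq> 0" "B u u = 0" "\<And>l b. l > 0 \<Longrightarrow> \<exists>c. L (gg l b) u = c *c u"
    using borel_fixed_line by blast
  have uc: "u \<in> cone" using u by (intro cone_isotropic)
  note W = L_isU[OF gw_G1]
  have "B u (L gw u) \<noteq> 0"
  proof
    assume "B u (L gw u) = 0"
    then have "B (L gw u) u = 0" using B_cnj[of u "L gw u"] by simp
    then obtain d where d: "L gw u = d *c u"
      using isotropic_orthogonal_parallel[of "L gw u" u] u isU_B[OF W, of u u] by auto
    have par: "\<exists>c. L g u = c *c u" if g: "g \<in> G1" for g
      using g
    proof (cases rule: G1_cases)
      case (borel l b) then show ?thesis using u(3) by simp
    next
      case (big_cell c l b)
      note G = gg_G1[OF zero_less_one, of c] gw_G1 gg_G1[OF big_cell(1), of b]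
      obtain p q r s where pq: "L (gg l b) u = p *c u" "L (gg 1 c) u = q *c u"
        "\<And>x. L (compose D1 gw (gg l b)) x = r *c L gw (L (gg l b) x)"
        "\<And>x. L g x = s *c L (gg 1 c) (L (compose D1 gw (gg l b)) x)"
        using u(3)[of l b] u(3)[of 1 c] big_cell peqE[OF L_compose[OF G(2,3)]]
          peqE[OF L_compose[OF G(1) G1_compose[OF G(2,3)]]] by (metis zero_less_one)
      then have "L g u = (s * (r * (p * (d * q)))) *c u"
        by (simp add: isU_csc[OF W] isU_csc[OF L_isU[OF G(1)]] d mult.assoc)
      then show ?thesis by blast
    qed
    have "\<rho> g (cline u) = cline u" if g: "g \<in> G1" for g
    proof -
      obtain c where c: "L g u = c *c u" using par[OF g] by blast
      have "L g u \<noteq> 0" using isU_eq_0_iff[OF L_isU[OF g]] u(1) by simp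
      then have "c \<noteq> 0" using c by auto
      then show ?thesis using rho_cline[OF g uc] c cline_csc by simp
    qed
    moreover have "cline u \<in> Dinf" using uc by (auto simp: Dinf_iff)
    ultimately show False using nonelem by (auto simp: non_elementary_def)
  qed
  note nz = this
  define d where "d = 1 / cnj (B u (L gw u))"
  have d0: "d \<noteq> 0" using nz by (simp add: d_def)
  show ?thesis
  proof (rule that[of u "d *c L gw u"])
    show "B u u = 0" by (rule u)
    show "B (d *c L gw u) (d *c L gw u) = 0" using isU_B[OF W] u by simp
    show "B u (d *c L gw u) = 1" using nz by (simp add: d_def)
    show "\<And>l b. l > 0 \<Longrightarrow> \<exists>c. L (gg l b) u = c *c u" by (rule u)
    have "L gw u = (1 / d) *c (d *c L gw u)" using d0 by simp
    then show "\<exists>c. L gw u = c *c (d *c L gw u)" by blast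
    obtain c where "\<And>x. L gw (L gw x) = c *c x"
      using peqE[OF peq_trans[OF peq_sym[OF L_compose[OF gw_G1 gw_G1, unfolded gw_gw]] L_id]] by metis
    then have "L gw (d *c L gw u) = (d * c) *c u" by (simp add: isU_csc[OF W])
    then show "\<exists>c. L gw (d *c L gw u) = c *c u" by blast
  qed
qed

end

section \<open>The invariants of a representation in an isotropic frame\<close>

text \<open>Cauchy's functional equation: positivity gives monotonicity, and comparing
  \<open>n * x\<close> with its floor leaves an error of at most \<open>f 1 / n\<close>.\<close>

lemma additive_positive_linear:
  fixes f :: "real \<Rightarrow> real"
  assumes add: "\<And>x y. f (x + y) = f x + f y" and pos: "\<And>x. x > 0 \<Longrightarrow> f x > 0"
  shows "f x = x * f 1"
proof -
  have f0: "f 0 = 0" using add[of 0 0] by simp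
  have neg: "f (- x) = - f x" for x using add[of x "- x"] f0 by simp
  have nat: "f (real n * x) = real n * f x" for n x
    by (induction n) (simp_all add: f0 add distrib_right)
  have int: "f (real_of_int i * x) = real_of_int i * f x" for i x
  proof (cases i rule: int_cases2)
    case (nonneg n) then show ?thesis using nat[of n x] by simp
  next
    case (nonpos n) then show ?thesis using nat[of n x] neg[of "real n * x"] by simp
  qed
  have mono: "f x \<le> f y" if "x \<le> y" for x y
    using pos[of "y - x"] add[of x "y - x"] that by (cases "x = y") auto
  have f1: "f 1 > 0" by (rule pos) simp
  have "\<bar>f x - x * f 1\<bar> \<le> f 1 / real (Suc n)" for n
  proof -
    let ?n = "real (Suc n)" and ?i = "\<lfloor>real (Suc n) * x\<rfloor>"
    have "f (real_of_int ?i * 1) \<le> f (?n * x)" by (rule mono) simp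
    then have 1: "real_of_int ?i * f 1 \<le> ?n * f x" unfolding int nat .
    have "f (?n * x) \<le> f (real_of_int (?i + 1) * 1)" by (rule mono) simp
    then have 2: "?n * f x \<le> real_of_int (?i + 1) * f 1" unfolding int nat .
    have "real_of_int ?i * f 1 \<le> (?n * x) * f 1" "(?n * x) * f 1 \<le> real_of_int (?i + 1) * f 1"
      using f1 by (auto intro!: mult_right_mono)
    with 1 2 have "\<bar>?n * f x - ?n * x * f 1\<bar> \<le> f 1" by (simp add: distrib_right abs_le_iff)
    moreover have "\<bar>?n * f x - ?n * x * f 1\<bar> = ?n * \<bar>f x - x * f 1\<bar>"
      by (metis abs_mult abs_of_nat mult.assoc right_diff_distrib)
    ultimately show ?thesis by (simp add: pos_le_divide_eq mult.commute)
  qed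
  then have "\<bar>f x - x * f 1\<bar> \<le> 0"
    using tendsto_mult[OF tendsto_const LIMSEQ_Suc[OF lim_1_over_n], of "f 1"]
    by (intro LIMSEQ_le_const[of "\<lambda>n. f 1 / real (Suc n)"]) auto
  then show ?thesis by simp
qed

text \<open>The frame is a parameter because later a frame is rescaled, and another one is
  transported through an equivalence.\<close>

locale rep_frame = nonelementary_rep +
  fixes e1 e2 :: ell2
  assumes e11: "B e1 e1 = 0" and e22: "B e2 e2 = 0" and e12: "B e1 e2 = 1"
    and borel_e1: "\<And>l b. l > 0 \<Longrightarrow> \<exists>c. L (gg l b) e1 = c *c e1"
    and gw_e1: "\<exists>c. L gw e1 = c *c e2" and gw_e2: "\<exists>c. L gw e2 = c *c e1"
begin

lemma e21: "B e2 e1 = 1"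
  using e12 B_cnj[of e1 e2] by simp

lemma e1_nz: "e1 \<noteq> 0" and e2_nz: "e2 \<noteq> 0"
  using e12 by auto

lemma e1_cone: "e1 \<in> cone" and e2_cone: "e2 \<in> cone"
  by (auto intro: cone_isotropic simp: e11 e22 e1_nz e2_nz)

lemma B_e12: "B (e1 + e2) (e1 + e2) = 2"
  by (simp add: B_simps e11 e22 e12 e21)

lemma orthogonal_e12_negative:
  assumes "B c e1 = 0" "B c e2 = 0"
  shows "Re (B c c) \<le> 0" and "Re (B c c) = 0 \<Longrightarrow> c = 0"
proof -
  have pos: "Re (B (e1 + e2) (e1 + e2)) > 0" by (simp add: B_e12)
  have orth: "B c (e1 + e2) = 0" using assms by (simp add: B_simps)
  note zero = orthogonal_positive_imp_zero[OF pos orth]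
  show "Re (B c c) \<le> 0" using zero by force
  show "Re (B c c) = 0 \<Longrightarrow> c = 0" using zero by simp
qed

text \<open>The eigenvalue of the lift at \<open>e1\<close>, read off by pairing with
  \<open>e2\<close>; only its modulus is independent of the lift.\<close>

definition \<kappa> :: "real \<Rightarrow> real \<Rightarrow> complex" where
  "\<kappa> l b = B (L (gg l b) e1) e2"

lemma L_e1: "l > 0 \<Longrightarrow> L (gg l b) e1 = \<kappa> l b *c e1"
  using borel_e1[of l b] e12 by (auto simp: \<kappa>_def)

lemma \<kappa>_nz: "l > 0 \<Longrightarrow> \<kappa> l b \<noteq> 0"
  using L_e1[of l b] isU_eq_0_iff[OF L_isU[OF gg_G1], of l b e1] e1_nz by auto

lemma cmod_\<kappa>_mult:
  assumes "l > 0" "l' > 0"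
  shows "cmod (\<kappa> (l * l') (l * b' + b / l')) = cmod (\<kappa> l b) * cmod (\<kappa> l' b')"
proof -
  have "l * l' > 0" using assms by simp
  have "\<kappa> (l * l') (l * b' + b / l') = B (L (gg (l * l') (l * b' + b / l')) e1) e2"
    by (simp add: \<kappa>_def)
  also have "cmod \<dots> = cmod (B (L (gg l b) (L (gg l' b') e1)) e2)"
    by (rule peq_cmod_B[OF L_gg_gg[OF assms]])
  also have "\<dots> = cmod (\<kappa> l b) * cmod (\<kappa> l' b')"
    by (simp add: L_e1 assms isU_csc[OF L_isU[OF gg_G1]] e12 norm_mult)
  finally show ?thesis .
qed

text \<open>Conjugation by \<open>gg 2 0\<close> multiplies the parameter of the unipotent group by \<open>4\<close>.\<close>

lemma cmod_\<kappa>_1: "cmod (\<kappa> 1 b) = 1"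
proof -
  let ?x = "cmod (\<kappa> 1 b)"
  have add: "cmod (\<kappa> 1 (b + b')) = cmod (\<kappa> 1 b') * cmod (\<kappa> 1 b)" for b b'
    using cmod_\<kappa>_mult[of 1 1 b b'] by simp
  \<comment> \<open>Multiplicativity makes the value at \<open>4 * b\<close> the fourth power of
    \<open>?x\<close>, conjugation makes it equal to \<open>?x\<close>.\<close>
  have "?x ^ 4 = cmod (\<kappa> 1 (4 * b))"
    using add[of b b] add[of "2 * b" "2 * b"] by (simp add: power4_eq_xxxx power2_eq_square)
  moreover have "cmod (\<kappa> 2 0) * ?x = cmod (\<kappa> 1 (4 * b)) * cmod (\<kappa> 2 0)"
    using cmod_\<kappa>_mult[of 2 1 b 0] cmod_\<kappa>_mult[of 1 2 0 "4 * b"] by simp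
  ultimately have "?x ^ 4 = ?x" using \<kappa>_nz[of 2 0] by simp
  then have "?x ^ 3 * ?x = 1 * ?x" by (simp add: power_Suc2[symmetric])
  moreover have "?x \<noteq> 0" using \<kappa>_nz[of 1 b] by simp
  ultimately have "?x ^ 3 = 1 ^ 3" using mult_right_cancel[of ?x "?x ^ 3" 1] by simp
  then show ?thesis by (rule power_eq_imp_eq_base) auto
qed

text \<open>The lift of \<open>gg 1 b\<close> normalised by \<open>T b e1 = e1\<close>. Projective
  identities among these lifts become true ones by \<open>peq_imp_eq\<close>, so \<open>T\<close> is
  a homomorphism.\<close>

definition T :: "real \<Rightarrow> ell2 \<Rightarrow> ell2" where
  "T b x = (1 / \<kappa> 1 b) *c L (gg 1 b) x"

lemma T_isU: "isU (T b)"
  unfolding T_def[abs_def] using cmod_\<kappa>_1 by (intro isU_unit_scale L_isU gg_G1) (auto simp: norm_divide)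

lemma T_peq: "peq (T b) (L (gg 1 b))"
  unfolding peq_def T_def using cmod_\<kappa>_1[of b] by (intro exI[of _ "1 / \<kappa> 1 b"]) (simp add: norm_divide)

lemma T_e1: "T b e1 = e1"
  using \<kappa>_nz[of 1 b] by (simp add: T_def L_e1)

lemma peq_imp_eq:
  assumes "peq S R" "S e = R e" "S e \<noteq> 0"
  shows "S = R"
proof -
  obtain c where c: "\<And>x. S x = c *c R x" using peqE[OF assms(1)] by metis
  then have "(c - 1) *c R e = 0" using assms(2) c[of e] by (simp add: csc_distrib)
  then have "c = 1" using assms by simp
  then show ?thesis using c by (simp add: fun_eq_iff)
qed

lemma peq_comp:
  assumes "peq S S'" "peq R R'" "isU S'"
  shows "peq (\<lambda>x. S (R x)) (\<lambda>x. S' (R' x))"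
proof -
  obtain c d where "cmod c = 1" "\<And>x. S x = c *c S' x" "cmod d = 1" "\<And>x. R x = d *c R' x"
    using assms(1,2) by (auto simp: peq_def)
  then show ?thesis unfolding peq_def
    by (intro exI[of _ "c * d"]) (simp add: isU_csc[OF assms(3)] norm_mult)
qed

lemma T_add: "T (b + b') x = T b (T b' x)"
proof -
  have 1: "(0::real) < 1" by simp
  have "peq (L (gg 1 (b + b'))) (\<lambda>x. L (gg 1 b) (L (gg 1 b') x))"
    using L_gg_gg[OF 1 1, of b' b] by (simp add: add.commute)
  moreover have "peq (\<lambda>x. T b (T b' x)) (\<lambda>x. L (gg 1 b) (L (gg 1 b') x))"
    by (rule peq_comp[OF T_peq T_peq L_isU[OF gg_G1[OF 1]]])
  ultimately have "peq (T (b + b')) (\<lambda>x. T b (T b' x))"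
    using T_peq peq_trans peq_sym by blast
  then have "T (b + b') = (\<lambda>x. T b (T b' x))"
    by (rule peq_imp_eq[where e = e1]) (simp_all add: T_e1 e1_nz)
  then show ?thesis by simp
qed

lemma T_0: "T 0 x = x"
proof -
  have "T 0 (T 0 x) = T 0 x" using T_add[of 0 0 x] by simp
  then show ?thesis using isU_bij[OF T_isU[of 0]] by (metis bij_is_inj injD)
qed

section \<open>The diagonal subgroup acting on the frame\<close>

abbreviation A :: "real \<Rightarrow> ell2 \<Rightarrow> ell2" where
  "A l \<equiv> L (gg l 0)"

abbreviation \<alpha> :: "real \<Rightarrow> complex" where
  "\<alpha> l \<equiv> \<kappa> l 0"

lemmas A_isU = L_isU[OF gg_G1]

text \<open>The Weyl element conjugates \<open>gg l 0\<close> into \<open>gg (1 / l) 0\<close> and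
  exchanges the two lines, so \<open>e2\<close> is an eigenvector; preservation of
  \<open>B e1 e2 = 1\<close> gives the eigenvalue.\<close>

lemma A_e2:
  assumes l: "l > 0"
  shows "A l e2 = (1 / cnj (\<alpha> l)) *c e2"
proof -
  have il: "1 / l > 0" using l by simp
  obtain p where p: "L gw e1 = p *c e2" using gw_e1 by blast
  have p0: "p \<noteq> 0" using p isU_eq_0_iff[OF L_isU[OF gw_G1], of e1] e1_nz by auto
  have "peq (\<lambda>x. L gw (A (1 / l) x)) (\<lambda>x. A l (L gw x))"
    using L_compose[OF gw_G1 gg_G1[OF il], of 0] L_compose[OF gg_G1[OF l] gw_G1, of 0] gw_gg[OF il] peq_sym peq_trans
    by (metis (no_types, lifting) div_by_1 divide_divide_eq_right mult_1)
  then obtain c where c: "\<And>x. L gw (A (1 / l) x) = c *c A l (L gw x)" using peqE by metis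
  have c0: "c \<noteq> 0" using c[of e1] isU_eq_0_iff[OF L_isU[OF gw_G1]] isU_eq_0_iff[OF A_isU[OF il]] e1_nz by auto
  have "A l e2 = (1 / (c * p)) *c (c *c A l (p *c e2))"
    using c0 p0 by (simp add: isU_csc[OF A_isU[OF l]])
  also have "\<dots> = (1 / (c * p)) *c L gw (A (1 / l) e1)" using c[of e1] p by simp
  finally obtain d where d: "A l e2 = d *c e2"
    using p by (simp add: L_e1[OF il] isU_csc[OF L_isU[OF gw_G1]])
  have "B (A l e1) (A l e2) = 1" using isU_B[OF A_isU[OF l]] e12 by simp
  then have "\<alpha> l * cnj d = 1" by (simp add: L_e1[OF l] d e12 mult.commute)
  then have "cnj d = 1 / \<alpha> l" using \<kappa>_nz[OF l] by (simp add: field_simps)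
  then have "d = 1 / cnj (\<alpha> l)" by (metis complex_cnj_cnj complex_cnj_divide complex_cnj_one)
  then show ?thesis using d by simp
qed

lemma A_T:
  assumes l: "l > 0"
  shows "A l (T b x) = T (l\<^sup>2 * b) (A l x)"
proof -
  have 1: "(0::real) < 1" by simp
  have "peq (\<lambda>x. A l (T b x)) (\<lambda>x. A l (L (gg 1 b) x))"
    by (rule peq_comp[OF peq_refl T_peq A_isU[OF l]])
  moreover have "peq (\<lambda>x. T (l\<^sup>2 * b) (A l x)) (\<lambda>x. L (gg 1 (l\<^sup>2 * b)) (A l x))"
    by (rule peq_comp[OF T_peq peq_refl A_isU[OF 1]])
  moreover have "peq (L (gg l (l * b))) (\<lambda>x. A l (L (gg 1 b) x))"
    using L_gg_gg[OF l 1, of b 0] by simp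
  moreover have "peq (L (gg l (l * b))) (\<lambda>x. L (gg 1 (l\<^sup>2 * b)) (A l x))"
    using L_gg_gg[OF 1 l, of 0 "l\<^sup>2 * b"] l by (simp add: power2_eq_square)
  ultimately have "peq (\<lambda>x. A l (T b x)) (\<lambda>x. T (l\<^sup>2 * b) (A l x))"
    using peq_sym peq_trans by blast
  then have "(\<lambda>x. A l (T b x)) = (\<lambda>x. T (l\<^sup>2 * b) (A l x))"
    by (rule peq_imp_eq[where e = e1])
      (simp_all add: T_e1 L_e1[OF l] isU_csc[OF T_isU] e1_nz \<kappa>_nz[OF l])
  then show ?thesis by (simp add: fun_eq_iff)
qed

text \<open>Pairing with \<open>e2\<close> extracts the coefficient of \<open>e1\<close> in
  \<open>T b e2\<close>, since \<open>e2\<close> is isotropic and orthogonal to the component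
  \<open>cc b\<close>.\<close>

definition K :: "real \<Rightarrow> complex" where
  "K b = B (T b e2) e2"

lemma B_T_T: "B (T b e2) (T b' e2) = K (b - b')"
  using isU_B[OF T_isU[of b'], of "T (b - b') e2" e2] T_add[of b' "b - b'" e2]
  by (simp add: K_def)

lemma K_neg: "K (- b) = cnj (K b)"
  using B_T_T[of 0 b] by (simp add: T_0 K_def B_cnj)

lemma K_0: "K 0 = 0"
  by (simp add: K_def T_0 e22)

lemma K_scale:
  assumes l: "l > 0"
  shows "K (l\<^sup>2 * b) = of_real ((cmod (\<alpha> l))\<^sup>2) * K b"
proof -
  have "K b = B (A l (T b e2)) (A l e2)" using isU_B[OF A_isU[OF l]] by (simp add: K_def)
  also have "\<dots> = B (T (l\<^sup>2 * b) (A l e2)) (A l e2)" by (simp add: A_T[OF l])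
  also have "\<dots> = K (l\<^sup>2 * b) / (cnj (\<alpha> l) * \<alpha> l)"
    by (simp add: A_e2[OF l] isU_csc[OF T_isU] K_def)
  also have "cnj (\<alpha> l) * \<alpha> l = of_real ((cmod (\<alpha> l))\<^sup>2)" by (simp add: mult_cnj_cmod)
  finally show ?thesis using \<kappa>_nz[OF l] by simp
qed

definition cc :: "real \<Rightarrow> ell2" where
  "cc b = T b e2 - K b *c e1 - e2"

lemma T_e2: "T b e2 = K b *c e1 + e2 + cc b"
  by (simp add: cc_def)

lemma B_T_e2_e1: "B (T b e2) e1 = 1" "B e1 (T b e2) = 1"
  using isU_B[OF T_isU[of b], of e2 e1] isU_B[OF T_isU[of b], of e1 e2] by (simp_all add: T_e1 e21 e12)

lemma cc_orth: "B (cc b) e1 = 0" "B (cc b) e2 = 0"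
  by (simp_all add: cc_def B_simps B_T_e2_e1 e11 e21 e12 e22 K_def[symmetric])

text \<open>Isotropy of \<open>T b e2\<close> ties the real part of \<open>K\<close> to the negative
  definite component; hence its sign, and the fixing of \<open>e2\<close> when
  \<open>K b = 0\<close>.\<close>

lemma cc_cc: "Re (B (cc b) (cc b)) = - 2 * Re (K b)"
proof -
  have o: "B e1 (cc b) = 0" "B e2 (cc b) = 0" using cc_orth B_cnj[of "cc b"] by (metis complex_cnj_zero)+
  have "0 = B (T b e2) (T b e2)" using isU_B[OF T_isU] e22 by simp
  also have "\<dots> = K b + cnj (K b) + B (cc b) (cc b)"
    by (simp add: T_e2 B_simps cc_orth o e11 e12 e21 e22)
  finally have "Re (B (cc b) (cc b)) = - Re (K b + cnj (K b))" by (simp add: add_eq_0_iff)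
  then show ?thesis by simp
qed

lemma Re_K: "Re (K b) \<ge> 0"
  using orthogonal_e12_negative(1)[OF cc_orth[of b]] by (simp add: cc_cc)

lemma T_e2_fixed: "K b = 0 \<Longrightarrow> T b e2 = e2"
  using orthogonal_e12_negative(2)[OF cc_orth[of b]] cc_cc[of b] T_e2[of b] by simp

text \<open>For \<open>e1 + e2\<close> orbital continuity says that \<open>|2 + K|\<close> tends to
  2; since \<open>Re K \<ge> 0\<close>, the square of \<open>|K|\<close> is at most
  \<open>|2 + K|^2 - 4\<close>.\<close>

lemma K_tendsto_0:
  assumes "b \<longlonglongrightarrow> 0"
  shows "(\<lambda>n. K (b n)) \<longlonglongrightarrow> 0"
proof -
  have "(\<lambda>n. cmod (B (L (gg 1 (b n)) (e1 + e2)) (e1 + e2))) \<longlonglongrightarrow> Re (B (e1 + e2) (e1 + e2))"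
    by (rule L_orbit_tendsto[of "\<lambda>n. 1"]) (simp_all add: assms B_e12)
  moreover have "cmod (B (L (gg 1 (b n)) (e1 + e2)) (e1 + e2)) = cmod (2 + K (b n))" for n
    unfolding peq_cmod_B[OF T_peq, symmetric] isU_add[OF T_isU] T_e1
    by (simp add: B_simps e11 e12 B_T_e2_e1 K_def[symmetric])
  ultimately have "(\<lambda>n. cmod (2 + K (b n))) \<longlonglongrightarrow> 2" by (simp add: B_e12)
  then have "(\<lambda>n. (cmod (2 + K (b n)))\<^sup>2 - 4) \<longlonglongrightarrow> 2\<^sup>2 - 4" by (intro tendsto_intros)
  then have lim: "(\<lambda>n. sqrt ((cmod (2 + K (b n)))\<^sup>2 - 4)) \<longlonglongrightarrow> 0"
    using tendsto_real_sqrt by fastforce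
  show ?thesis
  proof (rule Lim_null_comparison[OF _ lim])
    have "norm (K (b n)) \<le> sqrt ((cmod (2 + K (b n)))\<^sup>2 - 4)" for n
    proof (rule real_le_rsqrt)
      have "(cmod (2 + K (b n)))\<^sup>2 = 4 + 4 * Re (K (b n)) + (cmod (K (b n)))\<^sup>2"
        unfolding cmod_power2 by (simp add: power2_sum)
      then show "(norm (K (b n)))\<^sup>2 \<le> (cmod (2 + K (b n)))\<^sup>2 - 4" using Re_K[of "b n"] by simp
    qed
    then show "\<forall>\<^sub>F n in sequentially. norm (K (b n)) \<le> sqrt ((cmod (2 + K (b n)))\<^sup>2 - 4)" by simp
  qed
qed

lemma L_gg_e2_parallel_T:
  assumes l: "l > 0"
  shows "\<exists>c. L (gg l b) e2 = c *c T (b * l) e2"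
proof -
  obtain c where c: "\<And>x. L (gg l b) x = c *c L (gg 1 (b * l)) (A l x)" using peqE[OF L_borel[OF l]] by metis
  obtain d where d: "\<And>x. L (gg 1 (b * l)) x = d *c T (b * l) x" using peqE[OF peq_sym[OF T_peq]] by metis
  show ?thesis by (simp add: c d A_e2[OF l] isU_csc[OF T_isU]) blast
qed

lemma rho_cline_parallel:
  assumes g: "g \<in> G1" and x: "x \<in> cone" and c: "L g x = c *c y"
  shows "\<rho> g (cline x) = cline y"
proof -
  have "L g x \<noteq> 0" using x isU_eq_0_iff[OF L_isU[OF g]] by (simp add: cone_def)
  then have "c \<noteq> 0" using c by auto
  then show ?thesis unfolding rho_cline[OF g x] c by (rule cline_csc)
qed

lemma parallel_if_rho_cline:
  assumes "g \<in> G1" "x \<in> cone" "\<rho> g (cline x) = cline y"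
  shows "\<exists>c. L g x = c *c y"
  using assms rho_cline cline_eq_iff by metis

lemma cline_e1_neq_e2: "cline e1 \<noteq> cline e2"
proof
  assume "cline e1 = cline e2"
  then obtain c where "e1 = c *c e2" by (auto simp: cline_eq_iff)
  then have "B e1 e2 = 0" by (simp add: e22)
  then show False by (simp add: e12)
qed

text \<open>If the Borel subgroup fixed the line of \<open>e2\<close>, the pair of lines of \<open>e1\<close> and \<open>e2\<close> would be invariant.\<close>

lemma unipotent_moves_e2: "\<exists>b. T b e2 \<noteq> e2"
proof (rule ccontr)
  assume "\<not> ?thesis"
  then have fix2: "T b e2 = e2" for b by blast
  have 1: "gg 1 c \<in> G1" for c by (rule gg_G1) simp
  let ?p = "cline e1" and ?q = "cline e2"
  have D: "?p \<in> Dinf" "?q \<in> Dinf" using e1_cone e2_cone by (auto simp: Dinf_iff)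
  have b1: "\<rho> (gg l b) ?p = ?p" if "l > 0" for l b
    using rho_cline_parallel[OF gg_G1[OF that] e1_cone L_e1[OF that]] .
  have b2: "\<rho> (gg l b) ?q = ?q" if "l > 0" for l b
    using rho_cline_parallel[OF gg_G1[OF that] e2_cone] L_gg_e2_parallel_T[OF that, of b] fix2 by auto
  have w: "\<rho> gw ?p = ?q" "\<rho> gw ?q = ?p"
    using rho_cline_parallel[OF gw_G1] e1_cone e2_cone gw_e1 gw_e2 by blast+
  have comp: "\<rho> (compose D1 g h) p = \<rho> g (\<rho> h p)" if "g \<in> G1" "h \<in> G1" "p \<in> Dinf" for g h p
    using rep that by (simp add: is_rep_def compose_def)
  have "\<rho> g ` {?p, ?q} = {?p, ?q}" if "g \<in> G1" for g
    using that
  proof (cases rule: G1_cases)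
    case (borel l b) then show ?thesis using b1 b2 by simp
  next
    case (big_cell c l b)
    note G = 1[of c] gw_G1 gg_G1[OF big_cell(1), of b]
    have "\<rho> g ?p = ?q" "\<rho> g ?q = ?p"
      unfolding big_cell(2) using D b1 b2 w big_cell(1)
      by (simp_all add: comp[OF G(1) G1_compose[OF G(2,3)]] comp[OF G(2,3)])
    then show ?thesis by auto
  qed
  moreover have "?p \<in> bdry Vinf Binf" "?q \<in> bdry Vinf Binf"
    unfolding bdry_iff using e1_nz e2_nz e11 e22 by blast+
  moreover note cline_e1_neq_e2
  ultimately have "\<exists>\<xi>\<in>bdry Vinf Binf. \<exists>\<eta>\<in>bdry Vinf Binf. \<xi> \<noteq> \<eta> \<and> (\<forall>g\<in>G1. \<rho> g ` {\<xi>, \<eta>} = {\<xi>, \<eta>})"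
    by (intro bexI[of _ ?p] bexI[of _ ?q]) simp_all
  then show False using nonelem[unfolded non_elementary_def, THEN conjunct2] by contradiction
qed

text \<open>By \<open>K_scale\<close> the vanishing of \<open>K 1\<close> would spread to every
  \<open>K b\<close>, and then the unipotent group would fix \<open>e2\<close>.\<close>

lemma K_1_nz: "K 1 \<noteq> 0"
proof
  assume 0: "K 1 = 0"
  have pos: "K b = 0" if "b > 0" for b
    using K_scale[of "sqrt b" 1] 0 that by simp
  have "K b = 0" for b
    using pos[of b] pos[of "- b"] K_0 K_neg[of "- b"] by (cases b "0::real" rule: linorder_cases) auto
  then show False using unipotent_moves_e2 T_e2_fixed by blast
qed

section \<open>Growth of the eigenvalue of the diagonal subgroup\<close>

definition \<tau> :: real where
  "\<tau> = ln (cmod (\<alpha> (exp 1)))"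

lemma cmod_\<alpha>_mult: "l > 0 \<Longrightarrow> l' > 0 \<Longrightarrow> cmod (\<alpha> (l * l')) = cmod (\<alpha> l) * cmod (\<alpha> l')"
  using cmod_\<kappa>_mult[of l l' 0 0] by simp

text \<open>Otherwise the eigenvalues at the powers of \<open>1 / l\<close> have modulus at least 1,
  and \<open>K_scale\<close> keeps \<open>|K|\<close> at or above \<open>|K 1| > 0\<close> along
  parameters tending to 0, against \<open>K_tendsto_0\<close>.\<close>

lemma cmod_\<alpha>_gt_1:
  assumes l: "l > 1"
  shows "cmod (\<alpha> l) > 1"
proof (rule ccontr)
  assume "\<not> ?thesis"
  then have le: "cmod (\<alpha> l) \<le> 1" by simp
  have inv: "cmod (\<alpha> (1 / l)) \<ge> 1"
  proof -
    have "cmod (\<alpha> l) * cmod (\<alpha> (1 / l)) = 1" using cmod_\<alpha>_mult[of l "1/l"] l cmod_\<kappa>_1[of 0] by simp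
    then show ?thesis using le by (metis linorder_not_le mult_less_cancel_right2 mult.commute norm_ge_zero mult_left_le less_le_not_le mult_le_one le_less_trans)
  qed
  have m: "cmod (\<alpha> ((1/l) ^ n)) \<ge> 1" for n
  proof (induction n)
    case 0 then show ?case using cmod_\<kappa>_1[of 0] by simp
  next
    case (Suc n)
    have "1 * 1 \<le> cmod (\<alpha> (1/l)) * cmod (\<alpha> ((1/l) ^ n))" using inv Suc by (intro mult_mono) auto
    then show ?case using cmod_\<alpha>_mult[of "1/l" "(1/l)^n"] l by simp
  qed
  have "(\<lambda>n. ((1/l) ^ n)\<^sup>2 * 1) \<longlonglongrightarrow> 0\<^sup>2 * 1"
    using l by (intro tendsto_intros LIMSEQ_power_zero) simp
  then have "(\<lambda>n. K (((1/l) ^ n)\<^sup>2 * 1)) \<longlonglongrightarrow> 0" by (intro K_tendsto_0) simp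
  then have "(\<lambda>n. cmod (K (((1/l) ^ n)\<^sup>2 * 1))) \<longlonglongrightarrow> 0" using tendsto_norm_zero by blast
  moreover have "cmod (K (((1/l) ^ n)\<^sup>2 * 1)) \<ge> cmod (K 1)" for n
  proof -
    have "cmod (K (((1/l) ^ n)\<^sup>2 * 1)) = (cmod (\<alpha> ((1/l) ^ n)))\<^sup>2 * cmod (K 1)"
      using K_scale[of "(1/l)^n" 1] l by (simp add: norm_mult norm_power)
    moreover have "1 * cmod (K 1) \<le> (cmod (\<alpha> ((1/l) ^ n)))\<^sup>2 * cmod (K 1)"
      using m[of n] by (intro mult_right_mono one_le_power) auto
    ultimately show ?thesis by simp
  qed
  ultimately have "cmod (K 1) \<le> 0" by (intro LIMSEQ_le_const) auto
  then show False using K_1_nz by simp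
qed

lemma \<tau>_pos: "\<tau> > 0"
  unfolding \<tau>_def by (intro ln_gt_zero cmod_\<alpha>_gt_1) simp

lemma cmod_\<alpha>: 
  assumes l: "l > 0"
  shows "cmod (\<alpha> l) = exp (\<tau> * ln l)"
proof -
  define f where "f s = ln (cmod (\<alpha> (exp s)))" for s
  have pos: "cmod (\<alpha> (exp s)) > 0" for s using \<kappa>_nz[of "exp s" 0] by simp
  have "f (ln l) = ln l * f 1"
  proof (rule additive_positive_linear)
    show "f (x + y) = f x + f y" for x y
      unfolding f_def exp_add cmod_\<alpha>_mult[OF exp_gt_zero exp_gt_zero] using pos by (intro ln_mult_pos)
    show "x > 0 \<Longrightarrow> f x > 0" for x
      unfolding f_def by (intro ln_gt_zero cmod_\<alpha>_gt_1) simp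
  qed
  then have "ln (cmod (\<alpha> l)) = \<tau> * ln l" using l by (simp add: \<tau>_def f_def mult.commute)
  moreover have "cmod (\<alpha> l) > 0" using pos[of "ln l"] l by simp
  ultimately show ?thesis by (metis exp_ln)
qed

lemma K_pos:
  assumes "b > 0"
  shows "K b = of_real (exp (\<tau> * ln b)) * K 1"
proof -
  have "(cmod (\<alpha> (sqrt b)))\<^sup>2 = exp (\<tau> * ln b)"
    using assms by (simp add: cmod_\<alpha> ln_sqrt power2_eq_square exp_add[symmetric])
  then show ?thesis using K_scale[of "sqrt b" 1] assms by simp
qed

lemma K_nz: "b \<noteq> 0 \<Longrightarrow> K b \<noteq> 0"
  using K_pos[of b] K_pos[of "- b"] K_neg[of "- b"] K_1_nz by (cases "b > 0") auto

text \<open>Nonzero pairings of \<open>x\<close> with \<open>e1\<close> and with \<open>e2\<close>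
  would force its eigenvalue to be \<open>1 / cnj (\<alpha> 2)\<close> and
  \<open>\<alpha> 2\<close>, which have different moduli. So one pairing vanishes, and orthogonal
  isotropic vectors are parallel.\<close>

lemma A_fixed_lines:
  assumes x: "x \<noteq> 0" "B x x = 0" and par: "\<exists>c. A 2 x = c *c x"
  shows "cline x = cline e1 \<or> cline x = cline e2"
proof -
  obtain k where k: "A 2 x = k *c x" using par by blast
  have "B (A 2 x) (A 2 e1) = B x e1" by (simp add: isU_B[OF A_isU])
  then have 1: "k * cnj (\<alpha> 2) * B x e1 = B x e1" by (simp add: k L_e1 mult.assoc mult.left_commute)
  have "B (A 2 x) (A 2 e2) = B x e2" by (simp add: isU_B[OF A_isU])
  then have 2: "k / \<alpha> 2 * B x e2 = B x e2" by (simp add: k A_e2)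
  have gt: "cmod (\<alpha> 2) > 1" by (rule cmod_\<alpha>_gt_1) simp
  have "B x e1 = 0 \<or> B x e2 = 0"
  proof (rule ccontr)
    assume "\<not> ?thesis"
    then have k1: "k * cnj (\<alpha> 2) = 1" "k / \<alpha> 2 = 1" using 1 2 unfolding mult_cancel_right2 by blast+
    then have "k = \<alpha> 2" using \<kappa>_nz[of 2 0] by simp
    then have "\<alpha> 2 * cnj (\<alpha> 2) = 1" using k1(1) by simp
    then have "(complex_of_real (cmod (\<alpha> 2)))\<^sup>2 = 1" by (simp add: mult_cnj_cmod)
    then have "(cmod (\<alpha> 2))\<^sup>2 = 1" by (metis of_real_eq_1_iff of_real_power)
    then show False using gt by (simp add: power2_eq_1_iff)
  qed
  then have "(\<exists>c. x = c *c e1) \<or> (\<exists>c. x = c *c e2)"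
    using isotropic_orthogonal_parallel[OF x(2) e11 _ e1_nz] isotropic_orthogonal_parallel[OF x(2) e22 _ e2_nz] by blast
  then show ?thesis using x(1) by (metis cline_csc csc_algebra(3))
qed

section \<open>The invariants of the representation expressed in the frame\<close>

lemma eta1: "eta1 \<rho> = cline e1"
  unfolding eta1_def
proof (rule the_equality)
  have "cline e1 \<in> bdry Vinf Binf" unfolding bdry_iff using e1_nz e11 by blast
  moreover have "\<rho> (gg l b) (cline e1) = cline e1" if "l > 0" for l b
    using rho_cline_parallel[OF gg_G1[OF that] e1_cone L_e1[OF that]] .
  ultimately show "cline e1 \<in> bdry Vinf Binf \<and> (\<forall>lam>0. \<forall>b. \<rho> (gg lam b) (cline e1) = cline e1)" by blast
  fix \<eta> assume \<eta>: "\<eta> \<in> bdry Vinf Binf \<and> (\<forall>lam>0. \<forall>b. \<rho> (gg lam b) \<eta> = \<eta>)"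
  then obtain x where x: "\<eta> = cline x" "x \<noteq> 0" "B x x = 0" by (auto simp: bdry_iff)
  have xc: "x \<in> cone" using x by (intro cone_isotropic)
  have par: "\<exists>c. L (gg l b) x = c *c x" if "l > 0" for l b
    by (rule parallel_if_rho_cline[OF gg_G1[OF that] xc]) (use \<eta> that x(1) in simp)
  \<comment> \<open>\<open>A_fixed_lines\<close> leaves two candidates; the unipotent group moves
    the second.\<close>
  have "\<eta> \<noteq> cline e2"
  proof
    assume "\<eta> = cline e2"
    then have "\<exists>c. L (gg 1 b) e2 = c *c e2" for b
      by (intro parallel_if_rho_cline gg_G1 e2_cone) (use \<eta> in simp_all)
    then have "\<exists>c. T b e2 = c *c e2" for b by (metis T_def csc_algebra(1))
    moreover have "T b e2 = e2" if "T b e2 = c *c e2" for b c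
    proof -
      have "c = 1" using B_T_e2_e1(1)[of b] that by (simp add: e21)
      then show ?thesis using that by simp
    qed
    ultimately show False using unipotent_moves_e2 by metis
  qed
  then show "\<eta> = cline e1" using A_fixed_lines[OF x(2,3) par] x(1) by auto
qed

lemma eta2: "eta2 \<rho> = cline e2"
  unfolding eta2_def eta1
proof (rule the_equality)
  have "cline e2 \<in> bdry Vinf Binf" unfolding bdry_iff using e2_nz e22 by blast
  moreover have "\<rho> (gg l 0) (cline e2) = cline e2" if "l > 0" for l
    using rho_cline_parallel[OF gg_G1[OF that] e2_cone A_e2[OF that]] .
  ultimately show "cline e2 \<in> bdry Vinf Binf \<and> cline e2 \<noteq> cline e1 \<and> (\<forall>lam>0. \<rho> (gg lam 0) (cline e2) = cline e2)"
    using cline_e1_neq_e2 by auto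
  fix \<eta> assume \<eta>: "\<eta> \<in> bdry Vinf Binf \<and> \<eta> \<noteq> cline e1 \<and> (\<forall>lam>0. \<rho> (gg lam 0) \<eta> = \<eta>)"
  then obtain x where x: "\<eta> = cline x" "x \<noteq> 0" "B x x = 0" by (auto simp: bdry_iff)
  have xc: "x \<in> cone" using x by (intro cone_isotropic)
  have "\<exists>c. A 2 x = c *c x"
    by (rule parallel_if_rho_cline[OF gg_G1 xc]) (use \<eta> x(1) in simp_all)
  then show "\<eta> = cline e2" using A_fixed_lines[OF x(2,3)] x(1) \<eta> by auto
qed

text \<open>Cauchy-Schwarz in the negative definite complement for vectors of equal square, obtained
  from the sign of the form at \<open>t *c c + d\<close>, where the phase \<open>t\<close> aligns
  the cross terms.\<close>

lemma negative_CS: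
  assumes c: "B c e1 = 0" "B c e2 = 0" and d: "B d e1 = 0" "B d e2 = 0" and dd: "B d d = B c c"
  shows "cmod (B d c) \<le> - Re (B c c)"
proof -
  obtain t where t: "cmod t = 1" "B d c = t * of_real (cmod (B d c))" using polar_form by blast
  have tt: "cnj t * t = 1" using t(1) by (simp add: mult_cnj_cmod)
  have t0: "t \<noteq> 0" using t(1) by auto
  let ?y = "t *c c + d"
  have 1: "cnj t * B d c = of_real (cmod (B d c))"
    by (subst t(2)) (simp add: tt mult.assoc[symmetric])
  have "t * B c d = cnj (cnj t * B d c)" by (simp add: B_cnj)
  then have 2: "t * B c d = of_real (cmod (B d c))" unfolding 1 by simp
  have "B ?y ?y = (cnj t * t) * B c c + B d d + cnj t * B d c + t * B c d"
    by (simp add: B_simps algebra_simps)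
  also have "\<dots> = 2 * B c c + 2 * of_real (cmod (B d c))" unfolding tt dd 1 2 by simp
  finally have "Re (B ?y ?y) = 2 * Re (B c c) + 2 * cmod (B d c)" by simp
  moreover have "Re (B ?y ?y) \<le> 0"
    by (rule orthogonal_e12_negative(1)) (simp_all add: B_simps c d)
  ultimately show ?thesis by simp
qed

text \<open>Split \<open>x\<close> into components along \<open>e1\<close>, \<open>e2\<close> and
  their complement. With \<open>m\<close>, \<open>w\<close>, \<open>\<gamma>\<close> as below, the
  frame part contributes at least \<open>(m + 1 / m) * Re w\<close> and the complement takes away at
  most \<open>\<gamma>\<close>; this loss is absorbed because
  \<open>2 * Re w = Re (B x x) + \<gamma>\<close> and \<open>cosh \<ge> 1\<close>.\<close>

lemma displacement_lower_bound:
  assumes l: "l > 0" and x: "Re (B x x) > 0"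
  shows "Re (B x x) * cosh (\<tau> * ln l) \<le> cmod (B (A l x) x)"
proof -
  define m where "m = cmod (\<alpha> l)"
  have m: "m > 0" using \<kappa>_nz[OF l] by (simp add: m_def)
  have m_exp: "m = exp (\<tau> * ln l)" using cmod_\<alpha>[OF l] by (simp add: m_def)
  define t where "t = \<alpha> l / of_real m"
  have t1: "cmod t = 1" using m by (simp add: t_def norm_divide m_def)
  have tt: "cnj t * t = 1" using t1 by (simp add: mult_cnj_cmod)
  have \<alpha>: "\<alpha> l = t * of_real m" using m by (simp add: t_def)
  have t0: "t \<noteq> 0" using t1 by auto
  have "1 / cnj (\<alpha> l) = t / of_real m"
    using tt t0 m by (simp add: \<alpha> field_simps)
  note Ae = L_e1[OF l, of 0, unfolded \<alpha>] A_e2[OF l, unfolded this]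
  define p q where "p = B x e2" and "q = B x e1"
  define c where "c = x - p *c e1 - q *c e2"
  have c: "B c e1 = 0" "B c e2 = 0" by (simp_all add: c_def p_def q_def B_simps e11 e12 e21 e22)
  have c': "B e1 c = 0" "B e2 c = 0" using c B_cnj[of c] by (metis complex_cnj_zero)+
  have xx: "x = p *c e1 + q *c e2 + c" by (simp add: c_def)
  have Ac: "B (A l c) e1 = 0" "B (A l c) e2 = 0"
  proof -
    have "B (A l c) (A l e1) = 0" "B (A l c) (A l e2) = 0" using isU_B[OF A_isU[OF l]] c by simp_all
    then show "B (A l c) e1 = 0" "B (A l c) e2 = 0" using t0 m by (simp_all add: Ae)
  qed
  define w where "w = p * cnj q"
  define \<gamma> where "\<gamma> = - Re (B c c)"
  have \<gamma>0: "\<gamma> \<ge> 0" using orthogonal_e12_negative(1)[OF c] by (simp add: \<gamma>_def)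
  have "B x x = w + cnj w + B c c"
    by (subst (1 2) xx) (simp add: B_simps c c' e11 e12 e21 e22 w_def mult.commute)
  then have Bxx: "Re (B x x) = 2 * Re w - \<gamma>" by (simp add: \<gamma>_def)
  have Ax: "A l x = (p * (t * of_real m)) *c e1 + (q * (t / of_real m)) *c e2 + A l c"
    by (subst xx) (simp only: isU_add[OF A_isU[OF l]] isU_csc[OF A_isU[OF l]] Ae csc_algebra(1))
  have "B (A l x) x = t * (of_real m * w + cnj w / of_real m) + B (A l c) c"
  proof -
    have "B (A l x) x = B (A l x) (p *c e1 + q *c e2 + c)" by (simp only: xx[symmetric])
    then show ?thesis unfolding Ax by (simp add: B_simps Ac c' e11 e12 e21 e22 w_def algebra_simps)
  qed
  then have "cmod (t * (of_real m * w + cnj w / of_real m)) \<le> cmod (B (A l x) x) + cmod (B (A l c) c)"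
    by (metis add_diff_cancel norm_triangle_ineq4)
  moreover have "cmod (B (A l c) c) \<le> \<gamma>"
    unfolding \<gamma>_def using isU_B[OF A_isU[OF l]] by (intro negative_CS c Ac) simp
  moreover have "Re (of_real m * w + cnj w / of_real m) \<le> cmod (t * (of_real m * w + cnj w / of_real m))"
    unfolding norm_mult t1 mult_1 by (rule complex_Re_le_cmod)
  moreover have "Re (of_real m * w + cnj w / of_real m) = (m + inverse m) * Re w"
    by (simp add: Re_divide_of_real field_simps)
  moreover have "(m + inverse m) * Re w = cosh (\<tau> * ln l) * (Re (B x x) + \<gamma>)"
    unfolding Bxx cosh_field_def by (simp add: m_exp exp_minus field_simps)
  moreover have "cosh (\<tau> * ln l) * \<gamma> \<ge> 1 * \<gamma>"
    using \<gamma>0 cosh_real_ge_1 by (intro mult_right_mono) auto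
  ultimately show ?thesis by (simp add: algebra_simps)
qed

text \<open>The point of \<open>e1 + e2\<close> lies on the common axis, where the lower bound is
  sharp.\<close>

lemma displacement_attained:
  assumes l: "l > 0"
  shows "cmod (B (A l (e1 + e2)) (e1 + e2)) = 2 * cosh (\<tau> * ln l)"
proof -
  define m where "m = cmod (\<alpha> l)"
  have m: "m > 0" using \<kappa>_nz[OF l] by (simp add: m_def)
  have m_exp: "m = exp (\<tau> * ln l)" using cmod_\<alpha>[OF l] by (simp add: m_def)
  have "B (A l (e1 + e2)) (e1 + e2) = \<alpha> l + 1 / cnj (\<alpha> l)"
    by (simp add: isU_add[OF A_isU[OF l]] L_e1[OF l] A_e2[OF l] B_simps e11 e12 e21 e22)
  also have "1 / cnj (\<alpha> l) = \<alpha> l * of_real (1 / m\<^sup>2)"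
    using \<kappa>_nz[OF l, of 0] mult_cnj_cmod(1)[of "\<alpha> l"] by (simp add: m_def field_simps)
  also have "\<alpha> l + \<alpha> l * of_real (1 / m\<^sup>2) = \<alpha> l * of_real (1 + 1 / m\<^sup>2)"
    by (simp add: distrib_left)
  finally have "cmod (B (A l (e1 + e2)) (e1 + e2)) = m * \<bar>1 + 1 / m\<^sup>2\<bar>"
    unfolding m_def by (simp only: norm_mult norm_of_real)
  also have "\<dots> = m + inverse m" using m by (simp add: field_simps power2_eq_square)
  finally show ?thesis by (simp add: cosh_field_def m_exp exp_minus)
qed

lemma ell: "ell \<rho> = \<tau>"
proof -
  have inf: "(INF x\<in>hpts Vinf Binf. hdist Binf (\<rho> (gg l 0) x) x) = \<tau> * \<bar>ln l\<bar>" if l: "l > 0" for l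
  proof -
    have g: "gg l 0 \<in> G1" using l by (rule gg_G1)
    have abs: "\<tau> * \<bar>ln l\<bar> = \<bar>\<tau> * ln l\<bar>" using \<tau>_pos by (simp add: abs_mult)
    have hd: "hdist Binf (\<rho> (gg l 0) (cline x)) (cline x) = arcosh (cmod (B (A l x) x) / Re (B x x))"
      if x: "Re (B x x) > 0" for x
      using hdist_cline[of "A l x" x] x rho_cline[OF g cone_positive[OF x]] isU_B[OF A_isU[OF l]] by simp
    have lower: "\<tau> * \<bar>ln l\<bar> \<le> hdist Binf (\<rho> (gg l 0) (cline x)) (cline x)" if x: "Re (B x x) > 0" for x
    proof -
      have "cosh \<bar>\<tau> * ln l\<bar> \<le> cmod (B (A l x) x) / Re (B x x)"
        using displacement_lower_bound[OF l x] x by (simp add: pos_le_divide_eq mult.commute)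
      then have "arcosh (cosh \<bar>\<tau> * ln l\<bar>) \<le> arcosh (cmod (B (A l x) x) / Re (B x x))"
        using cosh_real_ge_1[of "\<bar>\<tau> * ln l\<bar>"] arcosh_less_iff_real[of "cmod (B (A l x) x) / Re (B x x)" "cosh \<bar>\<tau> * ln l\<bar>"]
        by linarith
      then show ?thesis unfolding abs hd[OF x] by (simp only: arcosh_cosh_real abs_ge_zero)
    qed
    have att: "hdist Binf (\<rho> (gg l 0) (cline (e1 + e2))) (cline (e1 + e2)) = \<tau> * \<bar>ln l\<bar>"
    proof -
      have "arcosh (cosh (\<tau> * ln l)) = \<bar>\<tau> * ln l\<bar>" by (metis arcosh_cosh_real abs_ge_zero cosh_real_abs)
      then show ?thesis unfolding abs by (subst hd) (simp_all add: B_e12 displacement_attained[OF l])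
    qed
    show ?thesis
    proof (rule cInf_eq_minimum)
      show "\<tau> * \<bar>ln l\<bar> \<in> (\<lambda>x. hdist Binf (\<rho> (gg l 0) x) x) ` hpts Vinf Binf"
        by (rule image_eqI[of _ _ "cline (e1 + e2)"]) (use att in \<open>auto simp: hpts_iff B_e12 intro!: exI[of _ "e1 + e2"]\<close>)
      fix y assume "y \<in> (\<lambda>x. hdist Binf (\<rho> (gg l 0) x) x) ` hpts Vinf Binf"
      then show "\<tau> * \<bar>ln l\<bar> \<le> y" using lower by (auto simp: hpts_iff)
    qed
  qed
  show ?thesis unfolding ell_def
  proof (rule the_equality)
    show "\<tau> > 0 \<and> (\<forall>lam>0. (INF x\<in>hpts Vinf Binf. hdist Binf (\<rho> (gg lam 0) x) x) = \<tau> * \<bar>ln lam\<bar>)"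
      using \<tau>_pos inf by blast
    fix t assume t: "t > 0 \<and> (\<forall>lam>0. (INF x\<in>hpts Vinf Binf. hdist Binf (\<rho> (gg lam 0) x) x) = t * \<bar>ln lam\<bar>)"
    then have "t * \<bar>ln (exp 1)\<bar> = \<tau> * \<bar>ln (exp 1)\<bar>" using inf[of "exp 1"] by (metis exp_gt_zero)
    then show "t = \<tau>" by simp
  qed
qed

lemma Kval: "\<exists>r>0. Kval \<rho> = of_real r * K 1"
proof -
  define Q where "Q K' \<longleftrightarrow> (\<exists>f1 f2 F c. f1 \<in> eta1 \<rho> \<and> f2 \<in> eta2 \<rho> \<and> Binf f1 f2 = 1 \<and>
      F \<in> UB Vinf Binf \<and> ind Vinf Binf F = \<rho> (gg 1 1) \<and> F f1 = f1 \<and>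
      c \<in> Vinf \<and> Binf c f1 = 0 \<and> Binf c f2 = 0 \<and>
      F f2 = vadd (vadd (vscale K' f1) f2) c)" for K'
  have 1: "gg 1 1 \<in> G1" by (rule gg_G1) simp
  have "Q (K 1)"
    unfolding Q_def
  proof (intro exI conjI)
    show "coord e1 \<in> eta1 \<rho>" "coord e2 \<in> eta2 \<rho>" by (simp_all add: eta1 eta2 cline_def lineof_self)
    show "Binf (coord e1) (coord e2) = 1" using e12 by (simp add: B_def)
    show U: "unlift (T 1) \<in> UB Vinf Binf" by (rule unlift_UB[OF T_isU])
    show "ind Vinf Binf (unlift (T 1)) = \<rho> (gg 1 1)"
    proof -
      obtain F where F: "F \<in> UB Vinf Binf" "\<rho> (gg 1 1) = ind Vinf Binf F"
        using rep 1 by (auto simp: is_rep_def PU_def)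
      have "peq (T 1) (lift F)" using T_peq peq_L_if_ind[OF F(1) 1] F(2) peq_sym peq_trans by metis
      then show ?thesis using ind_eq_if_peq[OF U F(1)] F(2) by (simp add: lift_unlift)
    qed
    show "unlift (T 1) (coord e1) = coord e1" by (simp add: unlift_def coord_inverse T_e1)
    show "coord (cc 1) \<in> Vinf" by simp
    show "Binf (coord (cc 1)) (coord e1) = 0" "Binf (coord (cc 1)) (coord e2) = 0"
      using cc_orth by (simp_all add: B_def)
    show "unlift (T 1) (coord e2) = vadd (vadd (vscale (K 1) (coord e1)) (coord e2)) (coord (cc 1))"
      unfolding unlift_def coord_inverse T_e2 by (simp add: fun_eq_iff vadd_def vscale_def)
  qed
  then have "Q (SOME K'. Q K')" by (rule someI[of Q])
  moreover have "Kval \<rho> = (SOME K'. Q K')" by (simp only: Kval_def Q_def)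
  ultimately have "Q (Kval \<rho>)" by simp
  then obtain f1 f2 F c where f: "f1 \<in> eta1 \<rho>" "f2 \<in> eta2 \<rho>" "Binf f1 f2 = 1"
      "F \<in> UB Vinf Binf" "ind Vinf Binf F = \<rho> (gg 1 1)" "F f1 = f1"
      "c \<in> Vinf" "Binf c f2 = 0"
      "F f2 = vadd (vadd (vscale (Kval \<rho>) f1) f2) c"
    unfolding Q_def by blast
  obtain a d where ad: "f1 = coord (a *c e1)" "f2 = coord (d *c e2)"
    using f(1,2) unfolding eta1 eta2 mem_cline by blast
  have Bf: "B (a *c e1) (d *c e2) = 1" using f(3) ad by (simp only: B_def)
  then have nz: "a \<noteq> 0" "d \<noteq> 0" by auto
  \<comment> \<open>The lift of \<open>F\<close> and \<open>T 1\<close> induce the same map and both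
    fix \<open>a *c e1\<close>, so they are equal.\<close>
  have "peq (lift F) (T 1)" using peq_L_if_ind[OF f(4) 1 f(5)] T_peq peq_sym peq_trans by blast
  moreover have "lift F (a *c e1) = a *c e1"
    unfolding lift_def ad(1)[symmetric] f(6) by (simp only: ad(1) coord_inverse)
  moreover have "T 1 (a *c e1) = a *c e1" by (simp add: isU_csc[OF T_isU] T_e1)
  ultimately have FT: "lift F = T 1" by (intro peq_imp_eq[of _ _ "a *c e1"]) (simp_all add: nz e1_nz)
  have "T 1 (d *c e2) = mk_ell2 (F f2)" unfolding FT[symmetric] lift_def ad(2)[symmetric] ..
  also have "\<dots> = Kval \<rho> *c (a *c e1) + d *c e2 + mk_ell2 c"
  proof -
    have "F f2 = coord (Kval \<rho> *c (a *c e1) + d *c e2 + mk_ell2 c)"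
      unfolding f(9) unfolding ad using f(7) by (simp add: fun_eq_iff vadd_def vscale_def)
    then show ?thesis by (simp only: coord_inverse)
  qed
  finally have "B (T 1 (d *c e2)) (d *c e2) = Kval \<rho> * B (a *c e1) (d *c e2) + B (mk_ell2 c) (d *c e2)"
    by (simp add: B_simps e22 algebra_simps)
  also have "B (mk_ell2 c) (d *c e2) = 0" using f(7,8) ad(2) by (simp add: B_def)
  finally have "Kval \<rho> = B (T 1 (d *c e2)) (d *c e2)" unfolding Bf by (simp only: mult_1_right add_0_right)
  also have "\<dots> = (d * cnj d) * K 1" by (simp add: isU_csc[OF T_isU] K_def)
  finally have "Kval \<rho> = of_real ((cmod d)\<^sup>2) * K 1" by (simp add: mult_cnj_cmod)
  then show ?thesis using nz by (intro exI[of _ "(cmod d)\<^sup>2"]) simp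
qed

lemma Argrho: "Argrho \<rho> = Arg (K 1)"
proof -
  obtain r where "r > 0" "Kval \<rho> = of_real r * K 1" using Kval by blast
  then show ?thesis by (simp add: Argrho_def Arg_times_of_real)
qed

end

section \<open>Isometries determined by Gram matrices\<close>

definition csubspace :: "ell2 set \<Rightarrow> bool" where
  "csubspace X \<longleftrightarrow> closed X \<and> 0 \<in> X \<and> (\<forall>x\<in>X. \<forall>y\<in>X. x + y \<in> X) \<and> (\<forall>c. \<forall>x\<in>X. c *c x \<in> X)"

text \<open>Phrased through closed subspaces, so that an identity extends from the family to the
  whole space once its solution set is a \<open>csubspace\<close>.\<close>

definition total :: "('i \<Rightarrow> ell2) \<Rightarrow> bool" where
  "total s \<longleftrightarrow> (\<forall>X. csubspace X \<longrightarrow> range s \<subseteq> X \<longrightarrow> X = UNIV)"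

lemma totalD: "total s \<Longrightarrow> csubspace X \<Longrightarrow> (\<And>i. s i \<in> X) \<Longrightarrow> x \<in> X"
  unfolding total_def by blast

lemma csubspace_equaliser:
  assumes S: "bounded_linear S" "\<And>c x. S (c *c x) = c *c S x"
    and T: "bounded_linear T" "\<And>c x. T (c *c x) = c *c T x"
  shows "csubspace {x. S x = (T x :: ell2)}"
  unfolding csubspace_def
proof (intro conjI)
  show "closed {x. S x = T x}"
    by (intro closed_Collect_eq linear_continuous_on S(1) T(1))
  show "0 \<in> {x. S x = T x}"
    by (simp add: linear_simps(3)[OF S(1)] linear_simps(3)[OF T(1)])
qed (auto simp: S T linear_simps(1)[OF S(1)] linear_simps(1)[OF T(1)])

text \<open>A relation and not a map, since the \<open>s i\<close> may be linearly dependent;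
  single-valuedness comes only from the norm estimate.\<close>

inductive_set span_graph :: "('i \<Rightarrow> ell2) \<Rightarrow> ('i \<Rightarrow> ell2) \<Rightarrow> (ell2 \<times> ell2) set"
  for s t :: "'i \<Rightarrow> ell2"
  where
    generator: "(s i, t i) \<in> span_graph s t"
  | zero: "(0, 0) \<in> span_graph s t"
  | add: "(x, y) \<in> span_graph s t \<Longrightarrow> (x', y') \<in> span_graph s t \<Longrightarrow> (x + x', y + y') \<in> span_graph s t"
  | scale: "(x, y) \<in> span_graph s t \<Longrightarrow> (c *c x, c *c y) \<in> span_graph s t"

lemma span_graph_B:
  assumes gram: "\<And>i j. B (s i) (s j) = B (t i) (t j)"
    and "(x, y) \<in> span_graph s t" "(x', y') \<in> span_graph s t"
  shows "B x x' = B y y'"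
  using assms(2,3)
proof (induction arbitrary: x' y' rule: span_graph.induct)
  case (generator i)
  then show ?case
  proof (induction rule: span_graph.induct)
    case (generator j) then show ?case by (rule gram)
  qed (simp_all add: B_simps)
qed (simp_all add: B_simps)

text \<open>The closure of the graph of \<open>s i \<mapsto> t i\<close> is again the graph of a map, because the norm is
  controlled by the form together with one positive vector of the span.\<close>

lemma gram_isometry:
  fixes s t :: "'i \<Rightarrow> ell2"
  assumes gram: "\<And>i j. B (s i) (s j) = B (t i) (t j)"
    and tot: "total s" and pos: "Re (B (s i0 + s j0) (s i0 + s j0)) > 0"
  obtains U where "bounded_linear U" "\<And>c x. U (c *c x) = c *c U x" "\<And>x y. B (U x) (U y) = B x y"
    "\<And>i. U (s i) = t i"
proof -
  define G where "G = closure (span_graph s t)"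
  have G_seq: "z \<in> G \<longleftrightarrow> (\<exists>f. (\<forall>n. f n \<in> span_graph s t) \<and> f \<longlonglongrightarrow> z)" for z
    unfolding G_def closure_sequential ..
  have sub: "span_graph s t \<subseteq> G" unfolding G_def by (rule closure_subset)
  have G_add: "(x + x', y + y') \<in> G" if xy: "(x, y) \<in> G" "(x', y') \<in> G" for x y x' y'
  proof -
    obtain f f' where f: "\<And>n. f n \<in> span_graph s t" "f \<longlonglongrightarrow> (x, y)"
      "\<And>n. f' n \<in> span_graph s t" "f' \<longlonglongrightarrow> (x', y')" using xy unfolding G_seq by blast
    have "f n + f' n \<in> span_graph s t" for n
      using span_graph.add[of "fst (f n)" "snd (f n)" s t "fst (f' n)" "snd (f' n)"] f(1)[of n] f(3)[of n]
      by (simp add: plus_prod_def)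
    moreover have "(\<lambda>n. f n + f' n) \<longlonglongrightarrow> (x, y) + (x', y')" by (intro tendsto_intros f)
    ultimately show ?thesis unfolding G_seq by (intro exI[of _ "\<lambda>n. f n + f' n"]) simp
  qed
  have G_csc: "(c *c x, c *c y) \<in> G" if xy: "(x, y) \<in> G" for x y c
  proof -
    obtain f where f: "\<And>n. f n \<in> span_graph s t" "f \<longlonglongrightarrow> (x, y)" using xy unfolding G_seq by blast
    have "(c *c fst (f n), c *c snd (f n)) \<in> span_graph s t" for n
      using span_graph.scale[of "fst (f n)" "snd (f n)" s t c] f(1)[of n] by simp
    moreover have "(\<lambda>n. (c *c fst (f n), c *c snd (f n))) \<longlonglongrightarrow> (c *c fst (x, y), c *c snd (x, y))"
      by (intro tendsto_intros f)
    ultimately show ?thesis unfolding G_seq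
      by (intro exI[of _ "\<lambda>n. (c *c fst (f n), c *c snd (f n))"]) simp
  qed
  have G_B: "B x x' = B y y'" if xy: "(x, y) \<in> G" "(x', y') \<in> G" for x y x' y'
  proof -
    obtain f f' where f: "\<And>n. f n \<in> span_graph s t" "f \<longlonglongrightarrow> (x, y)"
      "\<And>n. f' n \<in> span_graph s t" "f' \<longlonglongrightarrow> (x', y')" using xy unfolding G_seq by blast
    have "B (fst (f n)) (fst (f' n)) = B (snd (f n)) (snd (f' n))" for n
      by (rule span_graph_B[where s = s and t = t, OF gram]) (simp_all add: f)
    moreover have "(\<lambda>n. B (fst (f n)) (fst (f' n))) \<longlonglongrightarrow> B (fst (x, y)) (fst (x', y'))"
      by (intro tendsto_intros f)
    moreover have "(\<lambda>n. B (snd (f n)) (snd (f' n))) \<longlonglongrightarrow> B (snd (x, y)) (snd (x', y'))"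
      by (intro tendsto_intros f)
    ultimately show ?thesis by (simp add: LIMSEQ_unique)
  qed
  define p q where "p = s i0 + s j0" and "q = t i0 + t j0"
  have pq: "(p, q) \<in> G" unfolding p_def q_def
    by (intro G_add subsetD[OF sub] span_graph.generator)
  have Bq: "Re (B q q) > 0" using G_B[OF pq pq] pos by (simp add: p_def)
  obtain C where C: "C > 0" "\<And>x. (norm x)\<^sup>2 \<le> C * (2 * (cmod (B x q))\<^sup>2 / Re (B q q) - Re (B x x))"
    using norm_le_adapted_norm[OF Bq] by blast
  obtain K where K: "K > 0" "\<And>x y. cmod (B x y) \<le> K * norm x * norm y" using B_bound by blast
  \<comment> \<open>As \<open>|B y q| = |B x p| \<le> K * norm x * norm p\<close>, the adapted norm
    of \<open>y\<close> is at most a multiple of \<open>norm x\<close>; \<open>D\<close> collects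
    the constants.\<close>
  define D where "D = sqrt (C * (2 * (K * norm p)\<^sup>2 / Re (B q q) + 1))"
  have D: "norm y \<le> D * norm x" if xy: "(x, y) \<in> G" for x y
  proof (rule power2_le_imp_le)
    have "(cmod (B y q))\<^sup>2 \<le> (K * norm p * norm x)\<^sup>2"
      using G_B[OF xy pq] K(2)[of x p] by (intro power_mono) (simp_all add: mult.assoc mult.commute[of "norm p"])
    moreover have "- Re (B y y) \<le> (norm x)\<^sup>2" using G_B[OF xy xy] ell2_norm_B[of x] by simp
    ultimately have "2 * (cmod (B y q))\<^sup>2 / Re (B q q) - Re (B y y)
        \<le> 2 * (K * norm p * norm x)\<^sup>2 / Re (B q q) + (norm x)\<^sup>2"
      using Bq by (intro order_trans[OF diff_conv_add_uminus[THEN eq_refl]] add_mono divide_right_mono) auto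
    then have "(norm y)\<^sup>2 \<le> C * (2 * (K * norm p * norm x)\<^sup>2 / Re (B q q) + (norm x)\<^sup>2)"
      using C by (meson order_trans mult_left_mono less_imp_le)
    also have "\<dots> = C * (2 * (K * norm p)\<^sup>2 / Re (B q q) + 1) * (norm x)\<^sup>2"
      by (simp add: power_mult_distrib algebra_simps)
    also have "\<dots> = (D * norm x)\<^sup>2"
      using C(1) Bq by (simp add: D_def power_mult_distrib)
    finally show "(norm y)\<^sup>2 \<le> (D * norm x)\<^sup>2" .
    show "0 \<le> D * norm x" using C(1) Bq by (simp add: D_def)
  qed
  have G_diff: "(x - x', y - y') \<in> G" if "(x, y) \<in> G" "(x', y') \<in> G" for x y x' y'
    using G_add[OF that(1) G_csc[OF that(2), of "-1"]] by simp
  have G_unique: "y = y'" if "(x, y) \<in> G" "(x, y') \<in> G" for x y y'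
    using D[OF G_diff[OF that]] by simp
  have "csubspace {x. \<exists>y. (x, y) \<in> G}"
    unfolding csubspace_def
  proof (intro conjI)
    show "0 \<in> {x. \<exists>y. (x, y) \<in> G}" using sub span_graph.zero by blast
    show "\<forall>x\<in>{x. \<exists>y. (x, y) \<in> G}. \<forall>y\<in>{x. \<exists>y. (x, y) \<in> G}. x + y \<in> {x. \<exists>y. (x, y) \<in> G}"
      using G_add by blast
    show "\<forall>c. \<forall>x\<in>{x. \<exists>y. (x, y) \<in> G}. c *c x \<in> {x. \<exists>y. (x, y) \<in> G}" using G_csc by blast
    show "closed {x. \<exists>y. (x, y) \<in> G}"
      unfolding closed_sequential_limits
    proof (intro allI impI, elim conjE)
      fix f l assume "\<forall>n. f n \<in> {x. \<exists>y. (x, y) \<in> G}" and l: "f \<longlonglongrightarrow> l"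
      then have "\<forall>n. \<exists>y. (f n, y) \<in> G" by simp
      from choice[OF this] obtain g where g': "\<forall>n. (f n, g n) \<in> G" ..
      have g: "(f n, g n) \<in> G" for n using g' by (rule spec)
      \<comment> \<open>\<open>D\<close> turns convergence of the first components into convergence
        of the second ones, so the closed graph has a closed domain.\<close>
      have "Cauchy g"
      proof (rule metric_CauchyI)
        fix e :: real assume e: "e > 0"
        have D0: "\<bar>D\<bar> + 1 > 0" by simp
        then obtain M where M: "\<forall>m\<ge>M. \<forall>n\<ge>M. dist (f m) (f n) < e / (\<bar>D\<bar> + 1)"
          using LIMSEQ_imp_Cauchy[OF l] metric_CauchyD[of f "e / (\<bar>D\<bar> + 1)"] e by auto
        have "dist (g m) (g n) < e" if "m \<ge> M" "n \<ge> M" for m n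
        proof -
          have "dist (g m) (g n) \<le> D * dist (f m) (f n)"
            unfolding dist_norm by (rule D[OF G_diff[OF g g]])
          also have "\<dots> \<le> (\<bar>D\<bar> + 1) * dist (f m) (f n)" by (intro mult_right_mono) auto
          also have "\<dots> < (\<bar>D\<bar> + 1) * (e / (\<bar>D\<bar> + 1))"
            using M that D0 by (intro mult_strict_left_mono) auto
          also have "\<dots> = e" using D0 by simp
          finally show ?thesis .
        qed
        then show "\<exists>M. \<forall>m\<ge>M. \<forall>n\<ge>M. dist (g m) (g n) < e" by blast
      qed
      then obtain y where y: "g \<longlonglongrightarrow> y" using Cauchy_convergent convergent_def by blast
      have "closed G" by (simp add: G_def)
      then have "(l, y) \<in> G" using g tendsto_Pair[OF l y] by (rule closed_sequentially)
      then show "l \<in> {x. \<exists>y. (x, y) \<in> G}" by blast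
    qed
  qed
  note dom = this
  have gen: "(s i, t i) \<in> G" for i by (rule subsetD[OF sub span_graph.generator])
  have "x \<in> {x. \<exists>y. (x, y) \<in> G}" for x
    by (rule totalD[OF tot dom]) (use gen in blast)
  then have "\<forall>x. \<exists>y. (x, y) \<in> G" by simp
  from choice[OF this] obtain U where U': "\<forall>x. (x, U x) \<in> G" ..
  have U: "(x, U x) \<in> G" for x using U' by (rule spec)
  have csc: "U (c *c x) = c *c U x" for c x by (rule G_unique[OF U G_csc[OF U]])
  have "bounded_linear U"
  proof (rule bounded_linear_intro)
    show "U (x + y) = U x + U y" for x y by (rule G_unique[OF U G_add[OF U U]])
    show "U (r *\<^sub>R x) = r *\<^sub>R U x" for r x by (simp add: scaleR_csc csc)
    show "norm (U x) \<le> norm x * D" for x using D[OF U[of x]] by (simp add: mult.commute)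
  qed
  moreover have "B (U x) (U y) = B x y" for x y by (rule G_B[OF U U, symmetric])
  moreover have "U (s i) = t i" for i
    by (rule G_unique[OF U gen])
  ultimately show ?thesis using that csc by blast
qed

text \<open>The isometries obtained in the two directions are inverse to each other on a total
  family, hence everywhere; this gives surjectivity.\<close>

lemma gram_unitary:
  fixes s t :: "'i \<Rightarrow> ell2"
  assumes gram: "\<And>i j. B (s i) (s j) = B (t i) (t j)"
    and tot: "total s" "total t" and pos: "Re (B (s i0 + s j0) (s i0 + s j0)) > 0"
  obtains U where "isU U" "\<And>i. U (s i) = t i"
proof -
  obtain U where U: "bounded_linear U" "\<And>c x. U (c *c x) = c *c U x" "\<And>x y. B (U x) (U y) = B x y"
    "\<And>i. U (s i) = t i" using gram_isometry[OF gram tot(1) pos] by blast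
  have pos': "Re (B (t i0 + t j0) (t i0 + t j0)) > 0"
    using pos by (simp add: B_simps gram)
  obtain V where V: "bounded_linear V" "\<And>c x. V (c *c x) = c *c V x" "\<And>x y. B (V x) (V y) = B x y"
    "\<And>i. V (t i) = s i" using gram_isometry[OF gram[symmetric] tot(2) pos'] by blast
  have "csubspace {y. U (V y) = y}"
    by (rule csubspace_equaliser) (simp_all add: U V bounded_linear_compose)
  then have "U (V y) = y" for y
    using totalD[OF tot(2), of "{y. U (V y) = y}" y] by (simp add: U V)
  then have "surj U" by (metis surjI)
  then have "isU U" using U by (simp add: isU_def linear_simps(1)[OF U(1)])
  then show ?thesis using that U(4) by blast
qed

section \<open>The boundary circle of an irreducible representation\<close>

text \<open>The coset of \<open>g\<close> modulo the Borel subgroup, i.e. a point of the boundary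
  circle: \<open>None\<close> is the point fixed by that subgroup. Only \<open>G1\<close> is
  involved, so the same index serves both representations.\<close>

definition cell :: "isom \<Rightarrow> real option \<Rightarrow> bool" where
  "cell g j \<longleftrightarrow> (case j of None \<Rightarrow> \<exists>l b. l > 0 \<and> g = gg l b
     | Some c \<Rightarrow> \<exists>l b. l > 0 \<and> g = compose D1 (gg 1 c) (compose D1 gw (gg l b)))"

lemma cell_exists: 
  assumes "g \<in> G1"
  shows "\<exists>j. cell g j"
  using assms
proof (cases rule: G1_cases)
  case (borel l b) then show ?thesis by (intro exI[of _ None]) (auto simp: cell_def)
next
  case (big_cell c l b) then show ?thesis by (intro exI[of _ "Some c"]) (auto simp: cell_def)
qed

definition coset_rep :: "real option \<Rightarrow> isom" where
  "coset_rep j = (case j of None \<Rightarrow> gg 1 0 | Some c \<Rightarrow> compose D1 (gg 1 c) gw)"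

lemma coset_rep_G1: "coset_rep j \<in> G1"
  by (auto simp: coset_rep_def intro!: gg_G1 G1_compose gw_G1 split: option.split)

context rep_frame
begin

definition circle :: "real option \<Rightarrow> ell2" where
  "circle j = (case j of None \<Rightarrow> e1 | Some b \<Rightarrow> T b e2)"

lemma circle_simps [simp]: "circle None = e1" "circle (Some b) = T b e2"
  by (simp_all add: circle_def)

lemma L_unipotent_e2: "\<exists>k. k \<noteq> 0 \<and> L (gg 1 c) e2 = k *c T c e2"
  using \<kappa>_nz[of 1 c] by (intro exI[of _ "\<kappa> 1 c"]) (simp add: T_def)

lemma L_gw_e1: "\<exists>k. k \<noteq> 0 \<and> L gw e1 = k *c e2"
proof -
  obtain k where k: "L gw e1 = k *c e2" using gw_e1 by blast
  moreover have "L gw e1 \<noteq> 0" using isU_eq_0_iff[OF L_isU[OF gw_G1]] e1_nz by simp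
  ultimately show ?thesis by auto
qed

lemma L_cell:
  assumes "cell g j"
  shows "\<exists>k. L g e1 = k *c circle j"
proof (cases j)
  case None
  then show ?thesis using assms L_e1 by (auto simp: cell_def)
next
  case (Some c)
  then obtain l b where lb: "l > 0" "g = compose D1 (gg 1 c) (compose D1 gw (gg l b))"
    using assms by (auto simp: cell_def)
  note G = gg_G1[OF zero_less_one, of c] gw_G1 gg_G1[OF lb(1), of b]
  obtain k1 where k1: "\<And>x. L g x = k1 *c L (gg 1 c) (L (compose D1 gw (gg l b)) x)"
    unfolding lb(2) using peqE[OF L_compose[OF G(1) G1_compose[OF G(2,3)]]] by metis
  obtain k2 where k2: "\<And>x. L (compose D1 gw (gg l b)) x = k2 *c L gw (L (gg l b) x)"
    using peqE[OF L_compose[OF G(2,3)]] by metis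
  obtain k3 where k3: "L gw e1 = k3 *c e2" using gw_e1 by blast
  obtain k4 where k4: "L (gg 1 c) e2 = k4 *c T c e2" using L_unipotent_e2 by blast
  have "L g e1 = (k1 * (k2 * (\<kappa> l b * (k3 * k4)))) *c T c e2"
    by (simp add: k1 k2 L_e1[OF lb(1)] isU_csc[OF L_isU[OF G(1)]] isU_csc[OF L_isU[OF G(2)]] k3 k4 mult.assoc)
  then show ?thesis using Some by auto
qed

lemma L_coset_rep: "\<exists>k. k \<noteq> 0 \<and> L (coset_rep j) e1 = k *c circle j"
proof (cases j)
  case None
  then show ?thesis using \<kappa>_nz[of 1 0] L_e1[of 1 0] by (auto simp: coset_rep_def)
next
  case (Some c)
  note G = gg_G1[OF zero_less_one, of c] gw_G1
  obtain k1 where k1: "k1 \<noteq> 0" "\<And>x. L (compose D1 (gg 1 c) gw) x = k1 *c L (gg 1 c) (L gw x)"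
    using peqE[OF L_compose[OF G]] by metis
  obtain k3 where k3: "k3 \<noteq> 0" "L gw e1 = k3 *c e2" using L_gw_e1 by blast
  obtain k4 where k4: "k4 \<noteq> 0" "L (gg 1 c) e2 = k4 *c T c e2" using L_unipotent_e2 by blast
  have "L (coset_rep j) e1 = (k1 * (k3 * k4)) *c T c e2"
    by (simp add: Some coset_rep_def k1 k3 k4 isU_csc[OF L_isU[OF G(1)]])
  then show ?thesis using Some k1 k3 k4 by (intro exI[of _ "k1 * (k3 * k4)"]) simp
qed

text \<open>\<open>circle i\<close> is parallel to the image of \<open>e1\<close> under the lift of
  \<open>coset_rep i\<close>; thus the action on the circle is left multiplication on cosets,
  independent of the representation.\<close>

lemma L_circle:
  assumes g: "g \<in> G1" and j: "cell (compose D1 g (coset_rep i)) j"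
  shows "\<exists>k. L g (circle i) = k *c circle j"
proof -
  obtain k1 where k1: "k1 \<noteq> 0" "L (coset_rep i) e1 = k1 *c circle i" using L_coset_rep by blast
  obtain k2 where k2: "k2 \<noteq> 0" "\<And>x. L (compose D1 g (coset_rep i)) x = k2 *c L g (L (coset_rep i) x)"
    using peqE[OF L_compose[OF g coset_rep_G1]] by metis
  obtain k3 where k3: "L (compose D1 g (coset_rep i)) e1 = k3 *c circle j" using L_cell[OF j] by blast
  have eq: "k3 *c circle j = (k2 * k1) *c L g (circle i)"
    using k3 k2(2)[of e1] k1(2) isU_csc[OF L_isU[OF g]] by simp
  have "L g (circle i) = (1 / (k2 * k1)) *c ((k2 * k1) *c L g (circle i))" using k1 k2 by simp
  also have "\<dots> = (1 / (k2 * k1) * k3) *c circle j" unfolding eq[symmetric] by simp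
  finally show ?thesis by blast
qed

lemma L_circle_parallel: "g \<in> G1 \<Longrightarrow> \<exists>j k. L g (circle i) = k *c circle j"
  using L_circle cell_exists[OF G1_compose[OF _ coset_rep_G1]] by blast

text \<open>The positive vector makes \<open>X\<close> a complex hyperbolic subspace, so
  irreducibility puts all positive vectors into \<open>X\<close>; and these span.\<close>

lemma invariant_csubspace_UNIV:
  assumes irr: "irreducible_rep \<rho>" and X: "csubspace X" and x0: "x0 \<in> X" "Re (B x0 x0) > 0"
    and inv: "\<And>g x. g \<in> G1 \<Longrightarrow> x \<in> X \<Longrightarrow> L g x \<in> X"
  shows "X = UNIV"
proof -
  define W where "W = coord ` X"
  define S where "S = {p \<in> hpts Vinf Binf. p \<subseteq> W}"
  have X_add: "x + y \<in> X" if "x \<in> X" "y \<in> X" for x y using X that by (simp add: csubspace_def)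
  have X_csc: "c *c x \<in> X" if "x \<in> X" for x c using X that by (simp add: csubspace_def)
  have mem_W: "coord x \<in> W \<longleftrightarrow> x \<in> X" for x by (auto simp: W_def coord_inject)
  have line_W: "cline x \<subseteq> W \<longleftrightarrow> x \<in> X" for x
  proof
    assume "cline x \<subseteq> W"
    then have "coord x \<in> W" using lineof_self[of "coord x"] by (auto simp: cline_def)
    then show "x \<in> X" by (simp add: mem_W)
  qed (auto simp: mem_cline mem_W X_csc simp del: coord_simps)
  have S_iff: "p \<in> S \<longleftrightarrow> (\<exists>x\<in>X. p = cline x \<and> Re (B x x) > 0)" for p
    unfolding S_def mem_Collect_eq hpts_iff using line_W by blast
  have "closed_csubspace W"
    unfolding closed_csubspace_def
  proof (intro conjI ballI allI impI)
    show "W \<subseteq> Vinf" by (auto simp: W_def)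
    have "coord 0 \<in> W" using X by (simp add: mem_W csubspace_def)
    moreover have "coord 0 = (\<lambda>n. 0)" by (simp add: coord_eq_zero_iff)
    ultimately show "(\<lambda>n. 0) \<in> W" by simp
    fix v w a b assume "v \<in> W" "w \<in> W"
    then obtain x y where xy: "x \<in> X" "y \<in> X" "v = coord x" "w = coord y" by (auto simp: W_def)
    have "vadd (vscale a v) (vscale b w) = coord (a *c x + b *c y)"
      by (simp add: xy vadd_def vscale_def fun_eq_iff)
    then show "vadd (vscale a v) (vscale b w) \<in> W" using xy X_add X_csc by (simp add: mem_W)
  next
    fix ws v assume a: "(\<forall>n. ws n \<in> W) \<and> v \<in> Vinf \<and> (\<lambda>n. l2norm (vadd (ws n) (vscale (- 1) v))) \<longlonglongrightarrow> 0"
    then have "\<forall>n. \<exists>x\<in>X. ws n = coord x" by (auto simp: W_def)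
    then obtain x where x: "\<And>n. x n \<in> X" "\<And>n. ws n = coord (x n)" by metis
    have v: "coord (mk_ell2 v) = v" using a by simp
    have "vadd (ws n) (vscale (- 1) v) = coord (x n - mk_ell2 v)" for n
      by (simp add: x v vadd_def vscale_def fun_eq_iff)
    then have "(\<lambda>n. norm (x n - mk_ell2 v)) \<longlonglongrightarrow> 0" using a by (simp add: ell2_norm)
    then have "x \<longlonglongrightarrow> mk_ell2 v" by (simp add: tendsto_norm_zero_iff LIM_zero_iff)
    moreover have "closed X" using X by (simp add: csubspace_def)
    ultimately have "mk_ell2 v \<in> X" using x(1) closed_sequentially by metis
    then show "v \<in> W" using v mem_W by metis
  qed
  moreover have "sig_1 W"
    unfolding sig_1_def
  proof (intro bexI[of _ "coord x0"] conjI ballI impI)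
    show "0 < Re (Binf (coord x0) (coord x0))" using x0 by (simp add: B_def)
    show "coord x0 \<in> W" using x0 by (simp add: mem_W)
    fix w assume "w \<in> W" and w: "Binf w (coord x0) = 0 \<and> w \<noteq> (\<lambda>n. 0)"
    then obtain y where y: "w = coord y" by (auto simp: W_def)
    then have "B y x0 = 0" "y \<noteq> 0" using w by (simp_all add: B_def coord_eq_zero_iff)
    then have "\<not> Re (B y y) \<ge> 0" using orthogonal_positive_imp_zero[OF x0(2)] by blast
    then show "Re (Binf w w) < 0" by (simp add: y B_def)
  qed
  ultimately have "ch_subspace S" unfolding ch_subspace_def S_def by blast
  moreover have "\<rho> g ` S = S" if g: "g \<in> G1" for g
  proof (intro equalityI subsetI)
    fix p assume "p \<in> \<rho> g ` S"
    then obtain x where x: "x \<in> X" "Re (B x x) > 0" "p = \<rho> g (cline x)" by (auto simp: S_iff)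
    then have "p = cline (L g x)" using rho_cline[OF g cone_positive] by simp
    then show "p \<in> S" unfolding S_iff using inv[OF g x(1)] x(2) isU_B[OF L_isU[OF g]] by auto
  next
    fix p assume "p \<in> S"
    then obtain x where x: "x \<in> X" "Re (B x x) > 0" "p = cline x" by (auto simp: S_iff)
    obtain h where h: "h \<in> G1" "compose D1 h g = gg 1 0" using G1_inverse[OF g] by blast
    define y where "y = inv (L g) x"
    have gy: "L g y = x" by (simp add: y_def isU_inv(2)[OF L_isU[OF g]])
    obtain c where c: "c \<noteq> 0" "\<And>z. L h (L g z) = c *c z"
      using peqE[OF peq_trans[OF peq_sym[OF L_compose[OF h(1) g, unfolded h(2)]] L_id]] by metis
    have "y = (1 / c) *c L h x" using c(1) c(2)[of y] gy by simp
    then have "y \<in> X" using X_csc inv[OF h(1) x(1)] by simp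
    moreover have yy: "Re (B y y) > 0" using isU_B[OF L_isU[OF g], of y y] gy x(2) by simp
    ultimately have "cline y \<in> S" by (auto simp: S_iff)
    moreover have "\<rho> g (cline y) = p" using rho_cline[OF g cone_positive[OF yy]] gy x(3) by simp
    ultimately show "p \<in> \<rho> g ` S" by blast
  qed
  ultimately have "S = hpts Vinf Binf" using irr unfolding irreducible_rep_def by blast
  then have pos: "x \<in> X" if "Re (B x x) > 0" for x
    using line_W that hpts_iff S_def by (metis (no_types, lifting) mem_Collect_eq)
  have "x \<in> X" for x
  proof -
    \<comment> \<open>Every vector is a difference of two positive ones:
      \<open>t * t = t * (a + 1) + 2 * (t * r)\<close> outweighs both the cross term and
      \<open>B x x\<close>.\<close>
    define a r where "a = \<bar>Re (B x x)\<bar>" and "r = \<bar>Re (B x e0)\<bar>"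
    define t where "t = a + 2 * r + 1"
    have t1: "t \<ge> 1" by (simp add: t_def a_def r_def)
    let ?y = "x + of_real t *c e0"
    have e0x: "Re (B e0 x) = Re (B x e0)" using arg_cong[OF B_cnj[of x e0], of Re] by simp
    have yy: "Re (B ?y ?y) = Re (B x x) + 2 * (t * Re (B x e0)) + t * t"
      by (simp add: B_simps e0x algebra_simps)
    have "t * Re (B x e0) \<ge> - (t * r)"
      using t1 mult_left_mono[of "- r" "Re (B x e0)" t] by (simp add: r_def)
    moreover have "t * t = t * (a + 1) + 2 * (t * r)" by (simp add: t_def algebra_simps)
    moreover have "t * (a + 1) \<ge> 1 * (a + 1)" using t1 by (intro mult_right_mono) (simp_all add: a_def)
    moreover have "Re (B x x) \<ge> - a" by (simp add: a_def)
    ultimately have "Re (B x x) + 2 * (t * Re (B x e0)) + t * t > 0" unfolding mult_1 by linarith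
    then have "Re (B ?y ?y) > 0" by (simp only: yy)
    then have "?y \<in> X" by (rule pos)
    moreover have "(- of_real t) *c e0 \<in> X" by (intro X_csc pos) simp
    ultimately have "?y + (- of_real t) *c e0 \<in> X" by (rule X_add)
    then show ?thesis by simp
  qed
  then show ?thesis by blast
qed

text \<open>The smallest closed subspace containing the circle is invariant, because the lifts
  permute the lines of the circle, and it contains the positive vector
  \<open>e1 + e2\<close>.\<close>

lemma circle_total:
  assumes irr: "irreducible_rep \<rho>"
  shows "total circle"
proof -
  define Y where "Y = \<Inter> {X. csubspace X \<and> range circle \<subseteq> X}"
  have Y: "csubspace Y" unfolding csubspace_def Y_def by (auto intro!: closed_Inter simp: csubspace_def)
  have circle_Y: "circle j \<in> Y" for j by (auto simp: Y_def)
  have Y_min: "Y \<subseteq> X" if "csubspace X" "\<And>j. circle j \<in> X" for X using that by (auto simp: Y_def)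
  have "Y = UNIV"
  proof (rule invariant_csubspace_UNIV[OF irr Y])
    have "circle None + circle (Some 0) \<in> Y" using Y circle_Y by (simp add: csubspace_def del: circle_simps)
    then show "e1 + e2 \<in> Y" by (simp add: T_0)
    show "Re (B (e1 + e2) (e1 + e2)) > 0" by (simp add: B_e12)
    fix g x assume g: "g \<in> G1" and x: "x \<in> Y"
    note U = L_isU[OF g]
    have "csubspace {x. L g x \<in> Y}"
      unfolding csubspace_def
    proof (intro conjI)
      have "closed (L g -` Y)"
        using Y isU_bounded_linear[OF U]
        by (intro continuous_closed_vimage) (auto simp: csubspace_def intro: linear_continuous_at)
      then show "closed {x. L g x \<in> Y}" by (simp add: vimage_def)
    qed (use Y in \<open>auto simp: csubspace_def isU_zero[OF U] isU_add[OF U] isU_csc[OF U]\<close>)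
    moreover have "L g (circle j) \<in> Y" for j
      using L_circle_parallel[OF g, of j] Y circle_Y by (auto simp: csubspace_def simp del: circle_simps)
    ultimately have "Y \<subseteq> {x. L g x \<in> Y}" by (intro Y_min) auto
    then show "L g x \<in> Y" using x by blast
  qed
  then show ?thesis unfolding total_def using Y_min by blast
qed

lemma circle_gram:
  "B (circle i) (circle j) = (case (i, j) of (None, None) \<Rightarrow> 0 | (Some b, Some b') \<Rightarrow> K (b - b') | _ \<Rightarrow> 1)"
  by (auto simp: e11 B_T_e2_e1 B_T_T split: option.split)

text \<open>\<open>T\<close> does not change with the scale, while \<open>K\<close> is quadratic in
  \<open>e2\<close>; this freedom removes the modulus of \<open>K 1\<close>.\<close>

lemma rescaled_frame:
  assumes s: "s > 0"
  shows "rep_frame \<rho> (of_real s *c e1) ((1 / of_real s) *c e2)"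
    and "rep_frame.K \<rho> (of_real s *c e1) ((1 / of_real s) *c e2) b = K b / of_real (s\<^sup>2)"
proof -
  let ?f1 = "of_real s *c e1" and ?f2 = "(1 / of_real s) *c e2"
  have ss: "complex_of_real s \<noteq> 0" using s by simp
  note gwU = isU_csc[OF L_isU[OF gw_G1]]
  show frame: "rep_frame \<rho> ?f1 ?f2"
  proof unfold_locales
    show "B ?f1 ?f1 = 0" "B ?f2 ?f2 = 0" "B ?f1 ?f2 = 1" using ss by (simp_all add: e11 e22 e12)
    show "\<exists>c. L (gg l b) ?f1 = c *c ?f1" if "l > 0" for l b
      by (intro exI[of _ "\<kappa> l b"]) (simp add: isU_csc[OF L_isU[OF gg_G1[OF that]]] L_e1[OF that] mult.commute)
    obtain c where "L gw e1 = c *c e2" using gw_e1 by blast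
    then show "\<exists>c. L gw ?f1 = c *c ?f2"
      using ss by (intro exI[of _ "of_real s * c * of_real s"]) (simp add: gwU)
    obtain c where "L gw e2 = c *c e1" using gw_e2 by blast
    then show "\<exists>c. L gw ?f2 = c *c ?f1"
      using ss by (intro exI[of _ "c / of_real s / of_real s"]) (simp add: gwU)
  qed
  interpret f: rep_frame \<rho> ?f1 ?f2 by (rule frame)
  have "f.\<kappa> 1 b = \<kappa> 1 b"
    using ss by (simp add: f.\<kappa>_def \<kappa>_def isU_csc[OF L_isU[OF gg_G1]])
  then have "f.T b = T b" by (simp add: f.T_def T_def fun_eq_iff)
  then show "f.K b = K b / of_real (s\<^sup>2)"
    by (simp add: f.K_def K_def isU_csc[OF T_isU] power2_eq_square)
qed

end

lemma (in nonelementary_rep) frame_exists: "\<exists>e1 e2. rep_frame \<rho> e1 e2"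
proof -
  obtain e1 e2 where "B e1 e1 = 0" "B e2 e2 = 0" "B e1 e2 = 1"
    "\<And>l b. l > 0 \<Longrightarrow> \<exists>c. L (gg l b) e1 = c *c e1" "\<exists>c. L gw e1 = c *c e2" "\<exists>c. L gw e2 = c *c e1"
    using isotropic_frame by metis
  then have "rep_frame \<rho> e1 e2" by unfold_locales auto
  then show ?thesis by blast
qed

section \<open>Equivalent representations\<close>

lemma equivalent_if_K_eq:
  assumes "rep_frame \<rho>1 e1 e2" "rep_frame \<rho>2 f1 f2"
    and irr: "irreducible_rep \<rho>1" "irreducible_rep \<rho>2"
    and K: "\<And>b. rep_frame.K \<rho>1 e1 e2 b = rep_frame.K \<rho>2 f1 f2 b"
  shows "equivalent \<rho>1 \<rho>2"
proof -
  interpret r1: rep_frame \<rho>1 e1 e2 by fact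
  interpret r2: rep_frame \<rho>2 f1 f2 by fact
  have gram: "B (r1.circle i) (r1.circle j) = B (r2.circle i) (r2.circle j)" for i j
    unfolding r1.circle_gram r2.circle_gram K ..
  have pos: "Re (B (r1.circle None + r1.circle (Some 0)) (r1.circle None + r1.circle (Some 0))) > 0"
    by (simp add: r1.T_0 r1.B_e12)
  obtain U where U: "isU U" "\<And>i. U (r1.circle i) = r2.circle i"
    using gram_unitary[OF gram r1.circle_total[OF irr(1)] r2.circle_total[OF irr(2)] pos] by blast
  have inter: "peq (\<lambda>x. U (r1.L g x)) (\<lambda>x. r2.L g (U x))" if g: "g \<in> G1" for g
  proof -
    note L1 = r1.L_isU[OF g] and L2 = r2.L_isU[OF g]
    note V = isU_comp[OF U(1) L1] and V' = isU_comp[OF L2 U(1)]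
    have "\<exists>k. k \<noteq> 0 \<and> U (r1.L g (r1.circle i)) = k *c r2.L g (U (r1.circle i))" for i
    proof -
      obtain j where j: "cell (compose D1 g (coset_rep i)) j"
        using cell_exists[OF G1_compose[OF g coset_rep_G1]] by blast
      obtain k1 where k1: "r1.L g (r1.circle i) = k1 *c r1.circle j" using r1.L_circle[OF g j] by blast
      obtain k2 where k2: "r2.L g (r2.circle i) = k2 *c r2.circle j" using r2.L_circle[OF g j] by blast
      have nz: "r1.circle i \<noteq> 0" "r2.circle i \<noteq> 0"
        using isU_eq_0_iff[OF r1.T_isU] isU_eq_0_iff[OF r2.T_isU]
        by (auto simp: r1.e1_nz r1.e2_nz r2.e1_nz r2.e2_nz r1.circle_def r2.circle_def split: option.split)
      have "k1 \<noteq> 0" using isU_eq_0_iff[OF L1, of "r1.circle i"] nz k1 by auto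
      moreover have "k2 \<noteq> 0" using isU_eq_0_iff[OF L2, of "r2.circle i"] nz k2 by auto
      moreover have "U (r1.L g (r1.circle i)) = (k1 / k2) *c r2.L g (U (r1.circle i))"
        unfolding U(2) k1 k2 isU_csc[OF U(1)] using \<open>k2 \<noteq> 0\<close> by simp
      ultimately show ?thesis by (intro exI[of _ "k1 / k2"]) simp
    qed
    then obtain k where k: "\<And>i. U (r1.L g (r1.circle i)) = k i *c r2.L g (U (r1.circle i))" by metis
    \<comment> \<open>Both composites preserve the form, so the factors cancel wherever a Gram entry
      is nonzero.\<close>
    have kk: "k i * cnj (k j) = 1" if "B (r1.circle i) (r1.circle j) \<noteq> 0" for i j
    proof -
      have "B (r1.circle i) (r1.circle j) = B (U (r1.L g (r1.circle i))) (U (r1.L g (r1.circle j)))"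
        by (rule isU_B[OF V, symmetric])
      also have "\<dots> = (k i * cnj (k j)) * B (r1.circle i) (r1.circle j)"
        unfolding k by (simp add: isU_B[OF V'])
      finally show ?thesis using that by simp
    qed
    have some: "k (Some b) = 1 / cnj (k None)" for b
    proof -
      have "k (Some b) * cnj (k None) = 1" by (rule kk) (simp add: r1.B_T_e2_e1)
      then show ?thesis by (metis mult_zero_right nonzero_eq_divide_eq zero_neq_one)
    qed
    \<comment> \<open>Pairing with \<open>None\<close> leaves the modulus of \<open>k None\<close>
      free; two distinct finite indices, where \<open>K\<close> does not vanish, force it to be
      1.\<close>
    have "k (Some 1) * cnj (k (Some 0)) = 1"
      by (rule kk) (simp add: r1.B_T_T r1.K_nz)
    then have unit: "cnj (k None) * k None = 1"
      unfolding some by (simp add: field_simps)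
    then have inv: "1 / cnj (k None) = k None" by (metis mult_zero_left nonzero_divide_eq_eq mult.commute zero_neq_one)
    have "(complex_of_real (cmod (k None)))\<^sup>2 = 1" using unit by (simp only: mult_cnj_cmod)
    then have "(cmod (k None))\<^sup>2 = 1" by (metis of_real_eq_1_iff of_real_power)
    then have k1: "cmod (k None) = 1" using norm_ge_zero[of "k None"] unfolding power2_eq_1_iff by linarith
    have all: "k i = k None" for i using some inv by (cases i) simp_all
    have "csubspace {x. U (r1.L g x) = k None *c r2.L g (U x)}"
    proof (rule csubspace_equaliser)
      show "bounded_linear (\<lambda>x. U (r1.L g x))" by (rule isU_bounded_linear[OF V])
      show "bounded_linear (\<lambda>x. k None *c r2.L g (U x))"
        by (rule isU_bounded_linear[OF isU_unit_scale[OF V' k1]])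
    qed (simp_all add: isU_csc[OF U(1)] isU_csc[OF L1] isU_csc[OF L2] mult.commute)
    moreover have "U (r1.L g (r1.circle i)) = k None *c r2.L g (U (r1.circle i))" for i
      by (metis k all)
    ultimately have "U (r1.L g x) = k None *c r2.L g (U x)" for x
      using totalD[OF r1.circle_total[OF irr(1)], of "{x. U (r1.L g x) = k None *c r2.L g (U x)}" x] by simp
    then show ?thesis using k1 by (auto simp: peq_def)
  qed
  define \<phi> where "\<phi> = ind Vinf Binf (unlift U)"
  have UU: "unlift U \<in> UB Vinf Binf" by (rule unlift_UB[OF U(1)])
  have \<phi>: "\<phi> (cline x) = cline (U x)" if "x \<in> cone" for x
    unfolding \<phi>_def using ind_cline[OF UU that] by (simp add: lift_unlift)
  have "compose Dinf \<phi> (\<rho>1 g) = compose Dinf (\<rho>2 g) \<phi>" if g: "g \<in> G1" for g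
  proof
    fix p
    show "compose Dinf \<phi> (\<rho>1 g) p = compose Dinf (\<rho>2 g) \<phi> p"
    proof (cases "p \<in> Dinf")
      case True
      then obtain x where x: "x \<in> cone" "p = cline x" by (auto simp: Dinf_iff)
      obtain c where "c \<noteq> 0" "U (r1.L g x) = c *c r2.L g (U x)" using peqE[OF inter[OF g]] by metis
      then have "cline (U (r1.L g x)) = cline (r2.L g (U x))" by (simp add: cline_csc)
      then show ?thesis
        using True x by (simp add: compose_def r1.rho_cline[OF g x(1)] \<phi> cone_isU[OF r1.L_isU[OF g]]
            r2.rho_cline[OF g cone_isU[OF U(1)]])
    qed (simp add: compose_def)
  qed
  moreover have "\<phi> \<in> Ginf" unfolding \<phi>_def PU_def using UU by blast
  ultimately show ?thesis unfolding equivalent_def by blast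
qed

text \<open>The lift \<open>U\<close> of the conjugating isometry carries the frame to a frame of
  the second representation. There \<open>T 1\<close> corresponds exactly to the original one, since
  both sides send \<open>e1\<close> to \<open>U e1\<close>; so \<open>K 1\<close> is the
  same.\<close>

lemma Argrho_eq_if_equivalent:
  assumes "rep_frame \<rho>1 e1 e2" and ne: "nonelementary_rep \<rho>2" and eq: "equivalent \<rho>1 \<rho>2"
  shows "Argrho \<rho>1 = Argrho \<rho>2"
proof -
  interpret r1: rep_frame \<rho>1 e1 e2 by fact
  interpret r2: nonelementary_rep \<rho>2 by fact
  obtain F where F: "F \<in> UB Vinf Binf"
    and com: "\<And>g. g \<in> G1 \<Longrightarrow> compose Dinf (ind Vinf Binf F) (\<rho>1 g) = compose Dinf (\<rho>2 g) (ind Vinf Binf F)"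
    using eq by (auto simp: equivalent_def PU_def)
  define U where "U = lift F"
  have U: "isU U" unfolding U_def by (rule isU_lift[OF F])
  have inter: "peq (\<lambda>x. r2.L g (U x)) (\<lambda>x. U (r1.L g x))" if g: "g \<in> G1" for g
  proof (rule peq_if_lines_agree)
    show "isU (\<lambda>x. r2.L g (U x))" by (rule isU_comp[OF r2.L_isU[OF g] U])
    show "isU (\<lambda>x. U (r1.L g x))" by (rule isU_comp[OF U r1.L_isU[OF g]])
    fix x assume "Re (B x x) > 0"
    then have x: "x \<in> cone" by (rule cone_positive)
    then have "cline x \<in> Dinf" by (auto simp: Dinf_iff)
    then have "ind Vinf Binf F (\<rho>1 g (cline x)) = \<rho>2 g (ind Vinf Binf F (cline x))"
      using fun_cong[OF com[OF g], of "cline x"] by (simp add: compose_def)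
    then have "cline (U (r1.L g x)) = cline (r2.L g (U x))"
      unfolding r1.rho_cline[OF g x] ind_cline[OF F x] ind_cline[OF F cone_isU[OF r1.L_isU[OF g] x]] U_def[symmetric]
        r2.rho_cline[OF g cone_isU[OF U x]] .
    then show "\<exists>c. r2.L g (U x) = c *c U (r1.L g x)" using cline_eq_iff by metis
  qed
  have par: "\<exists>c. r2.L g (U x) = c *c U y" if g: "g \<in> G1" and h: "\<exists>c. r1.L g x = c *c y" for g x y
  proof -
    obtain c where "r1.L g x = c *c y" using h by blast
    moreover obtain d where "r2.L g (U x) = d *c U (r1.L g x)" using peqE[OF inter[OF g]] by metis
    ultimately show ?thesis by (simp add: isU_csc[OF U]) blast
  qed
  have "rep_frame \<rho>2 (U e1) (U e2)"
    by unfold_locales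
      (simp_all add: isU_B[OF U] r1.e11 r1.e22 r1.e12 par gw_G1 gg_G1 r1.borel_e1 r1.gw_e1 r1.gw_e2)
  then interpret f: rep_frame \<rho>2 "U e1" "U e2" .
  have 1: "gg 1 1 \<in> G1" by (rule gg_G1) simp
  have "peq (\<lambda>x. f.T 1 (U x)) (\<lambda>x. r2.L (gg 1 1) (U x))"
    by (rule r1.peq_comp[OF f.T_peq peq_refl r2.L_isU[OF 1]])
  moreover have "peq (\<lambda>x. U (r1.L (gg 1 1) x)) (\<lambda>x. U (r1.T 1 x))"
    by (rule r1.peq_comp[OF peq_refl peq_sym[OF r1.T_peq] U])
  ultimately have "peq (\<lambda>x. f.T 1 (U x)) (\<lambda>x. U (r1.T 1 x))"
    using inter[OF 1] peq_trans by blast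
  then have "(\<lambda>x. f.T 1 (U x)) = (\<lambda>x. U (r1.T 1 x))"
    by (rule r1.peq_imp_eq[where e = e1]) (simp_all add: f.T_e1 r1.T_e1 f.e1_nz)
  then have "f.K 1 = r1.K 1" by (metis f.K_def r1.K_def isU_B[OF U])
  then show ?thesis by (simp add: r1.Argrho f.Argrho)
qed

theorem mainTheorem3:
  assumes "is_rep \<rho>1" and "is_rep \<rho>2"
    and "irreducible_rep \<rho>1" and "irreducible_rep \<rho>2"
    and "ell \<rho>1 = ell \<rho>2"
  shows "equivalent \<rho>1 \<rho>2 \<longleftrightarrow> Argrho \<rho>1 = Argrho \<rho>2"
proof -
  interpret n1: nonelementary_rep \<rho>1 using assms by unfold_locales (simp_all add: irreducible_rep_def)
  interpret n2: nonelementary_rep \<rho>2 using assms by unfold_locales (simp_all add: irreducible_rep_def)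
  obtain e1 e2 where fr1: "rep_frame \<rho>1 e1 e2" using n1.frame_exists by blast
  obtain f1 f2 where fr2: "rep_frame \<rho>2 f1 f2" using n2.frame_exists by blast
  interpret r1: rep_frame \<rho>1 e1 e2 by (rule fr1)
  interpret r2: rep_frame \<rho>2 f1 f2 by (rule fr2)
  show ?thesis
  proof
    assume "equivalent \<rho>1 \<rho>2"
    then show "Argrho \<rho>1 = Argrho \<rho>2"
      by (rule Argrho_eq_if_equivalent[OF fr1 n2.nonelementary_rep_axioms])
  next
    assume "Argrho \<rho>1 = Argrho \<rho>2"
    then have Arg: "Arg (r1.K 1) = Arg (r2.K 1)" by (simp add: r1.Argrho r2.Argrho)
    define r where "r = cmod (r1.K 1) / cmod (r2.K 1)"
    have r: "r > 0" using r1.K_1_nz r2.K_1_nz by (simp add: r_def)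
    have K1: "r1.K 1 = of_real r * r2.K 1"
    proof -
      have "r1.K 1 = of_real (cmod (r1.K 1)) * cis (Arg (r1.K 1))"
        "r2.K 1 = of_real (cmod (r2.K 1)) * cis (Arg (r2.K 1))"
        by (metis rcis_cmod_Arg rcis_def)+
      then show ?thesis using Arg r2.K_1_nz
        by (metis (no_types, lifting) mult.assoc nonzero_eq_divide_eq norm_eq_zero of_real_mult r_def)
    qed
    \<comment> \<open>Rescaling the first frame by \<open>s\<close> divides its \<open>K\<close> by
      \<open>r\<close>.\<close>
    define s where "s = sqrt r"
    have s: "s > 0" "s\<^sup>2 = r" using r by (simp_all add: s_def)
    \<comment> \<open>Equality of the translation lengths makes the exponents agree, so the ratio at
      \<open>b = 1\<close> persists for all \<open>b > 0\<close>.\<close>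
    have \<tau>: "r1.\<tau> = r2.\<tau>" using assms(5) by (simp add: r1.ell r2.ell)
    have pos: "r1.K b = of_real r * r2.K b" if "b > 0" for b
      using r1.K_pos[OF that] r2.K_pos[OF that] K1 \<tau> by simp
    have K: "r1.K b = of_real r * r2.K b" for b
    proof (cases b "0::real" rule: linorder_cases)
      case less
      then show ?thesis using pos[of "- b"] r1.K_neg[of "- b"] r2.K_neg[of "- b"] by simp
    next
      case equal then show ?thesis by (simp add: r1.K_0 r2.K_0)
    next
      case greater then show ?thesis by (rule pos)
    qed
    show "equivalent \<rho>1 \<rho>2"
      by (rule equivalent_if_K_eq[OF r1.rescaled_frame(1)[OF s(1)] fr2 assms(3,4)])
        (use r in \<open>simp add: r1.rescaled_frame(2)[OF s(1)] s(2) K\<close>)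
  qed
qed

end
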